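(* For every $\kappa\in(0,1]$ there exists an integer $d_0\ge1$ such that for every integer $d\ge d_0$, every integer $N>0$, and every choice of $N$ degree $d$ marked Fubini-Study charts of capacity $\kappa$ centered at points $z_1,\dots,z_N\in\mathbb{CP}^2$ satisfying $$\min_{i\ne j}d_{FS}(z_i,z_j)\ge\sqrt{\frac{20\ln(d)}{d}},$$ the probability (with respect to random $P\in H^0(\mathbb{CP}^2,L^d)$) that at least one of these charts is a submanifold chart for the degree $d$ complex plane curve $V_P$ is greater than $1-14\,\gamma(\kappa)^N$, where $$\gamma(\kappa)=1-\exp\left(-\frac{2^{11}3^3}{\kappa^2}\right)(1-e^{-1/2}).$$
   Context: For an integer $d\ge 1$, $H^0(\mathbb{CP}^2,L^d)$ is the space of homogeneous complex polynomials of degree $d$ in $X_0,X_1,X_2$, of dimension $N_d=(d+1)(d+2)/2$, with the Hermitian product for which distinct monomials are orthogonal and $\|X_0^{i_0}X_1^{i_1}X_2^{i_2}\|^2=\frac{2\,i_0!\,i_1!\,i_2!}{(d+2)!}$ when $i_0+i_1+i_2=d$, and with the Gaussian probability measure of density $\pi^{-N_d}e^{-\|P\|^2}$. For such $P$, $V_P=\{P=0\}\subset\mathbb{CP}^2$. $\mathbb{C}^2$ is identified with $\{X_0\neq0\}\subset\mathbb{CP}^2$ by $(z_1,z_2)\mapsto[1:z_1:z_2]$, so $0=[1:0:0]$. The Fubini-Study distance is $d_{FS}([u],[v])=\arccos\frac{|\langle u,v\rangle|}{\|u\|\|v\|}\in[0,\pi/2]$ (so $\tan d_{FS}(0,z)=\|z\|$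 for $z\in\mathbb{C}^2$), and $PU_3(\mathbb{C})$ acts on $\mathbb{CP}^2$ by isometries. $D(0,r)$ and $\mathring{D}(0,r)$ are the closed and open discs of radius $r$ in $\mathbb{C}$. For $\kappa\in(0,1]$ let $\mathbb{B}_d(\kappa)=D(0,\frac{1}{\sqrt{6d}})\times D(0,\frac{\kappa}{\sqrt{6d}})\subset\mathbb{C}^2\subset\mathbb{CP}^2$. A degree $d$ marked Fubini-Study chart of capacity $\kappa$ centered at $z\in\mathbb{CP}^2$ is the image $B=\psi(\mathbb{B}_d(\kappa))$ of $\mathbb{B}_d(\kappa)$ under some $\psi\in PU_3(\mathbb{C})$ with $\psi(0)=z$ (the chart being given together with $\psi$). It is a submanifold chart for $V_P$ if $\psi^{-1}(V_P\cap B)$ is the graph of a map $D(0,\frac1{\sqrt{6d}})\to\mathring{D}(0,\frac{\kappa}{\sqrt{6d}})$. *)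

theory Defs
  imports "HOL-Probability.Probability"
begin

section \<open>The complex projective plane\<close>

definition proportional :: "complex^3 \<Rightarrow> complex^3 \<Rightarrow> bool" where
  "proportional u v \<longleftrightarrow> u \<noteq> 0 \<and> v \<noteq> 0 \<and> (\<exists>c. c \<noteq> 0 \<and> v = c *s u)"

lemma part_equivp_proportional: "part_equivp proportional"
proof (rule part_equivpI)
  show "\<exists>u. proportional u u"
    by (rule exI[of _ "axis 1 1"], auto simp: proportional_def intro!: exI[of _ 1])
  show "symp proportional"
  proof (rule sympI)
    fix u v assume "proportional u v"
    then obtain c where c: "u \<noteq> 0" "v \<noteq> 0" "c \<noteq> 0" "v = c *s u"
      by (auto simp: proportional_def)
    then have "u = inverse c *s v"
      by (simp add: vector_smult_assoc)
    with c show "proportional v u"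
      by (metis proportional_def inverse_nonzero_iff_nonzero)
  qed
  show "transp proportional"
    by (rule transpI) (auto simp: proportional_def vector_smult_assoc)
qed

quotient_type cp2 = "complex^3" / partial: proportional
  by (rule part_equivp_proportional)

text \<open>
  \<open>proj u\<close> is the point \<open>[u]\<close>; it is meaningful only for \<open>u \<noteq> 0\<close>. The homogeneous coordinates
  \<open>X\<^sub>0, X\<^sub>1, X\<^sub>2\<close> of \<open>u\<close> are the components \<open>u $ 1, u $ 2, u $ 3\<close>.
\<close>

definition proj :: "complex^3 \<Rightarrow> cp2" where
  "proj u = abs_cp2 u"

lemma proj_eq_iff:
  assumes "u \<noteq> 0" "v \<noteq> 0"
  shows "proj u = proj v \<longleftrightarrow> (\<exists>c. c \<noteq> 0 \<and> v = c *s u)"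
proof -
  have refl: "proportional w w" if "w \<noteq> 0" for w
    using that by (auto simp: proportional_def intro!: exI[of _ 1])
  show ?thesis
    using Quotient_rel[OF Quotient_cp2, of u v] refl[OF assms(1)] refl[OF assms(2)] assms
    by (auto simp: proj_def proportional_def)
qed

definition cinner3 :: "complex^3 \<Rightarrow> complex^3 \<Rightarrow> complex" where
  "cinner3 u v = (\<Sum>k\<in>UNIV. u $ k * cnj (v $ k))"

lemma cinner3_scale: "cinner3 (a *s u) (b *s v) = a * cnj b * cinner3 u v"
  by (simp add: cinner3_def sum_distrib_left algebra_simps)

lemma norm_scale3: "norm (a *s u) = cmod a * norm (u :: complex^3)"
  by (simp add: norm_vec_def L2_set_def norm_mult power_mult_distrib sum_distrib_left[symmetric]
      real_sqrt_mult)

lift_definition d_FS :: "cp2 \<Rightarrow> cp2 \<Rightarrow> real" is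
  "\<lambda>u v. arccos (cmod (cinner3 u v) / (norm u * norm v))"
  by (auto simp: proportional_def cinner3_scale norm_scale3 norm_mult)

lemma d_FS_proj:
  assumes "u \<noteq> 0" "v \<noteq> 0"
  shows "d_FS (proj u) (proj v) = arccos (cmod (cinner3 u v) / (norm u * norm v))"
proof -
  have "proportional w w" if "w \<noteq> 0" for w
    using that by (auto simp: proportional_def intro!: exI[of _ 1])
  then show ?thesis
    using assms by (simp add: proj_def d_FS.abs_eq)
qed

definition unitary3 :: "complex^3^3 \<Rightarrow> bool" where
  "unitary3 A \<longleftrightarrow> (\<chi> i j. cnj (A $ j $ i)) ** A = mat 1"

text \<open>\<open>PU\<^sub>3(\<complex>)\<close>, identified with its (faithful) image in the transformations of the plane.\<close>

definition PU3 :: "(cp2 \<Rightarrow> cp2) set" where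
  "PU3 = {\<psi>. \<exists>A. unitary3 A \<and> (\<forall>u. u \<noteq> 0 \<longrightarrow> \<psi> (proj u) = proj (A *v u))}"

definition affine_chart :: "complex \<times> complex \<Rightarrow> cp2" where
  "affine_chart z = proj (vector [1, fst z, snd z])"


section \<open>Homogeneous polynomials and their Gaussian measure\<close>

text \<open>
  A homogeneous polynomial of degree \<open>d\<close> is represented by the family of its coefficients in the
  monomial basis, i.e. by an element of \<open>forms d\<close> (extensional functions on the exponents).
\<close>

type_synonym form = "nat \<times> nat \<times> nat \<Rightarrow> complex"

definition exponents :: "nat \<Rightarrow> (nat \<times> nat \<times> nat) set" where
  "exponents d = {(i0, i1, i2). i0 + i1 + i2 = d}"

definition forms :: "nat \<Rightarrow> form set" where
  "forms d = (\<Pi>\<^sub>E i\<in>exponents d. UNIV)"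

definition form_eval :: "nat \<Rightarrow> form \<Rightarrow> complex^3 \<Rightarrow> complex" where
  "form_eval d P u =
     (\<Sum>(i0, i1, i2)\<in>exponents d. P (i0, i1, i2) * (u $ 1) ^ i0 * (u $ 2) ^ i1 * (u $ 3) ^ i2)"

text \<open>Squared norm of the monomial with exponents \<open>(i0, i1, i2)\<close>.\<close>

definition monomial_sqnorm :: "nat \<times> nat \<times> nat \<Rightarrow> real" where
  "monomial_sqnorm = (\<lambda>(i0, i1, i2). 2 * fact i0 * fact i1 * fact i2 / fact (i0 + i1 + i2 + 2))"

definition form_inner :: "nat \<Rightarrow> form \<Rightarrow> form \<Rightarrow> complex" where
  "form_inner d P Q = (\<Sum>i\<in>exponents d. of_real (monomial_sqnorm i) * P i * cnj (Q i))"

definition form_sqnorm :: "nat \<Rightarrow> form \<Rightarrow> real" where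
  "form_sqnorm d P = Re (form_inner d P P)"

text \<open>
  The Lebesgue measure of the Hermitian space of forms: the image of the standard Lebesgue measure
  under the coordinates in the orthonormal basis of normalised monomials.
\<close>

definition form_lebesgue :: "nat \<Rightarrow> form measure" where
  "form_lebesgue d =
     distr (\<Pi>\<^sub>M i\<in>exponents d. lborel) (\<Pi>\<^sub>M i\<in>exponents d. borel)
       (\<lambda>a. \<lambda>i\<in>exponents d. a i / of_real (sqrt (monomial_sqnorm i)))"

definition form_gaussian :: "nat \<Rightarrow> form measure" where
  "form_gaussian d =
     density (form_lebesgue d)
       (\<lambda>P. ennreal (exp (- form_sqnorm d P) / pi ^ ((d + 1) * (d + 2) div 2)))"

lemma space_form_gaussian: "space (form_gaussian d) = forms d"
  by (simp add: form_gaussian_def form_lebesgue_def space_PiM forms_def)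

lemma form_sqnorm_normalised:
  "form_sqnorm d (\<lambda>i\<in>exponents d. a i / of_real (sqrt (monomial_sqnorm i)))
     = (\<Sum>i\<in>exponents d. (cmod (a i))\<^sup>2)"
proof -
  have pos: "monomial_sqnorm i > 0" for i
    by (auto simp: monomial_sqnorm_def split: prod.split)
  have "Re (of_real (monomial_sqnorm i) * (a i / of_real (sqrt (monomial_sqnorm i)))
          * cnj (a i / of_real (sqrt (monomial_sqnorm i)))) = (cmod (a i))\<^sup>2" for i
  proof -
    have "of_real (monomial_sqnorm i) * (a i / of_real (sqrt (monomial_sqnorm i)))
          * cnj (a i / of_real (sqrt (monomial_sqnorm i)))
        = of_real (monomial_sqnorm i / (sqrt (monomial_sqnorm i))\<^sup>2) * (a i * cnj (a i))"
      by (simp add: power2_eq_square del: real_sqrt_mult_self)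
    also have "\<dots> = of_real ((cmod (a i))\<^sup>2)"
      using pos[of i] by (simp add: complex_norm_square[symmetric] less_imp_neq[symmetric])
    finally show ?thesis by (metis Re_complex_of_real)
  qed
  then show ?thesis
    by (simp add: form_sqnorm_def form_inner_def)
qed

definition plane_curve :: "nat \<Rightarrow> form \<Rightarrow> cp2 set" where
  "plane_curve d P = {proj u | u. u \<noteq> 0 \<and> form_eval d P u = 0}"


section \<open>Marked Fubini-Study charts\<close>

definition bidisc :: "nat \<Rightarrow> real \<Rightarrow> (complex \<times> complex) set" where
  "bidisc d \<kappa> = cball 0 (1 / sqrt (6 * real d)) \<times> cball 0 (\<kappa> / sqrt (6 * real d))"

text \<open>A marked chart is given by its marking \<open>\<psi>\<close>, which determines the underlying set.\<close>

definition marked_FS_chart_at :: "cp2 \<Rightarrow> (cp2 \<Rightarrow> cp2) \<Rightarrow> bool" where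
  "marked_FS_chart_at z \<psi> \<longleftrightarrow> \<psi> \<in> PU3 \<and> \<psi> (affine_chart (0, 0)) = z"

definition FS_chart :: "nat \<Rightarrow> real \<Rightarrow> (cp2 \<Rightarrow> cp2) \<Rightarrow> cp2 set" where
  "FS_chart d \<kappa> \<psi> = \<psi> ` affine_chart ` bidisc d \<kappa>"

definition submanifold_chart :: "nat \<Rightarrow> real \<Rightarrow> (cp2 \<Rightarrow> cp2) \<Rightarrow> form \<Rightarrow> bool" where
  "submanifold_chart d \<kappa> \<psi> P \<longleftrightarrow>
     (\<exists>f \<in> cball 0 (1 / sqrt (6 * real d)) \<rightarrow> ball 0 (\<kappa> / sqrt (6 * real d)).
        \<psi> -` (plane_curve d P \<inter> FS_chart d \<kappa> \<psi>)
          = affine_chart ` {(x, f x) | x. x \<in> cball 0 (1 / sqrt (6 * real d))})"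

definition capacity_gamma :: "real \<Rightarrow> real" where
  "capacity_gamma \<kappa> = 1 - exp (- (2 ^ 11 * 3 ^ 3 / \<kappa>\<^sup>2)) * (1 - exp (- 1 / 2))"

end

(*
  In unitary coordinates adapted to the i-th chart, rescaled by sqrt (6 d), a random form becomes a
  polynomial q(X, Y) with Gaussian coefficients, and the chart is a submanifold chart as soon as the
  coefficient b of Y dominates all the others (contraction principle). If all N charts fail, then
  in every chart whose other coefficients are bounded by a fixed constant (a tame chart), |b| is at
  most a constant over kappa. Two facts are combined.

  - At least a quarter of the charts are tame, except with probability exp (- N / 4). The size of the
    other coefficients is bounded by the mean of |q| over the nodes of a torus, so Jensen's inequality
    reduces the exponential moment of the sum over the charts to exponential moments of linear
    functionals attached to one point in each chart. Values at points of different charts are nearly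
    uncorrelated, because the normalised correlation is the d-th power of the cosine of the distance.

  - Starting from a form for which all charts fail, choose any set S of tame charts and raise b by a
    large constant in the charts of S, leaving the other charts almost unchanged. The set S can be
    recovered from the result, so the translates for different S are disjoint, whereas by the
    Cameron-Martin formula each of them loses at most a factor exp (- C card S). Summing over S
    gives the bound (1 + exp (- C)) ^ (- N / 4), where C = 28000 / kappa^2 leaves ample room
    compared with 2^11 3^3 / kappa^2.

  The number N of charts is at most a multiple of d^2 by the Welch bound, while the correlations
  decay like a higher power of 1 / d, so that their sum over all charts is small.
*)
theory Submission
  imports Defs "HOL-Real_Asymp.Real_Asymp"
begin

section \<open>Standard complex Gaussian vectors\<close>

text \<open>The obstacle is that the charts are correlated, so the probability that all of them fail
  does not factor. Both estimates therefore use exact Gaussian identities, the Laplace transform of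
  a linear functional and the density ratio of a translate, in which correlations enter only through
  Gram sums. If \<epsilon> bounds the correlations, it is enough that \<open>N * \<epsilon>\<close>
  is small compared with \<kappa>. The torus has radius 2 while the rescaled bidisc has radius at
  most 1; Cauchy estimates then decay geometrically, and the sum of all coefficients other than b is
  bounded independently of d. The translation uses the vector representing b. As a polynomial in its
  own chart it is Y / 6, so it leaves the other coefficients of that chart unchanged and disturbs
  the other charts only through correlations. The separation gives correlations of order 1 / d^8, up
  to a factor exp (O (sqrt (ln d))), against a number of charts of order d^2.\<close>

definition cgauss_density :: "'i set \<Rightarrow> ('i \<Rightarrow> complex) \<Rightarrow> real" where
  "cgauss_density I a = exp (- (\<Sum>i\<in>I. (cmod (a i))\<^sup>2)) / pi ^ card I"

definition cgauss :: "'i set \<Rightarrow> ('i \<Rightarrow> complex) measure" where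
  "cgauss I = density (\<Pi>\<^sub>M i\<in>I. lborel) (\<lambda>a. ennreal (cgauss_density I a))"

definition cdot :: "'i set \<Rightarrow> ('i \<Rightarrow> complex) \<Rightarrow> ('i \<Rightarrow> complex) \<Rightarrow> complex" where
  "cdot I a v = (\<Sum>i\<in>I. a i * cnj (v i))"

definition translate :: "'i set \<Rightarrow> ('i \<Rightarrow> complex) \<Rightarrow> ('i \<Rightarrow> complex) \<Rightarrow> ('i \<Rightarrow> complex)" where
  "translate I h a = (\<lambda>i\<in>I. a i + h i)"

lemma space_cgauss: "space (cgauss I) = (\<Pi>\<^sub>E i\<in>I. UNIV)"
  by (simp add: cgauss_def space_PiM)

lemma sets_cgauss [measurable_cong]: "sets (cgauss I) = sets (\<Pi>\<^sub>M i\<in>I. borel)"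
  unfolding cgauss_def sets_density by (rule sets_PiM_cong) auto

lemma measurable_cgauss_component [measurable (raw)]:
  "i \<in> I \<Longrightarrow> (\<lambda>a. a i) \<in> borel_measurable (cgauss I)"
  by (subst measurable_cong_sets[OF sets_cgauss refl]) simp

lemma measurable_cdot [measurable]: "(\<lambda>a. cdot I a v) \<in> borel_measurable (cgauss I)"
  unfolding cdot_def by (intro borel_measurable_sum borel_measurable_times) auto

lemma measurable_translate [measurable]: "translate I h \<in> cgauss I \<rightarrow>\<^sub>M cgauss I"
  unfolding translate_def measurable_cong_sets[OF refl sets_cgauss]
  by (rule measurable_restrict) measurable

lemma cdot_translate: "cdot I (translate I h a) v = cdot I a v + cdot I h v"
  by (simp add: cdot_def translate_def sum.distrib[symmetric] algebra_simps)

lemma cnj_cdot: "cnj (cdot I a v) = cdot I v a"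
  by (simp add: cdot_def mult.commute)

lemma cdot_self: "cdot I a a = of_real (\<Sum>i\<in>I. (cmod (a i))\<^sup>2)"
  by (simp add: cdot_def complex_norm_square[symmetric] del: of_real_power)

lemma cdot_scale_right: "cdot I a (\<lambda>i. c * v i) = cnj c * cdot I a v"
  by (simp add: cdot_def sum_distrib_left mult_ac)

lemma cdot_scale_left: "cdot I (\<lambda>i. c * v i) a = c * cdot I v a"
  by (simp add: cdot_def sum_distrib_left mult_ac)

lemma cdot_sum_right: "cdot I a (\<lambda>i. \<Sum>j\<in>S. v j i) = (\<Sum>j\<in>S. cdot I a (v j))"
  unfolding cdot_def cnj_sum sum_distrib_left by (rule sum.swap)

lemma cdot_sum_left: "cdot I (\<lambda>i. \<Sum>j\<in>S. v j i) a = (\<Sum>j\<in>S. cdot I (v j) a)"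
  unfolding cdot_def sum_distrib_right by (rule sum.swap)

section \<open>Normalisation of the Gaussian and the Cameron-Martin formula\<close>

lemma nn_integral_complex_gaussian:
  "(\<integral>\<^sup>+z. ennreal (exp (- (cmod z)\<^sup>2)) \<partial>lborel) = ennreal pi"
proof -
  have g: "(\<integral>\<^sup>+x. ennreal (exp (- x\<^sup>2)) \<partial>lborel) = ennreal (sqrt pi)"
    using has_bochner_integral_even_function[OF gaussian_moment_0]
    by (simp add: nn_integral_eq_integral has_bochner_integral_iff)
  have "(\<integral>\<^sup>+z. ennreal (exp (- (cmod z)\<^sup>2)) \<partial>lborel)
      = (\<integral>\<^sup>+z. (\<Prod>b\<in>Basis. ennreal (exp (- (z \<bullet> b)\<^sup>2))) \<partial>(lborel :: complex measure))"
    by (simp add: Basis_complex_def cmod_power2 ennreal_mult[symmetric] exp_add[symmetric] inner_complex_def)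
  also have "\<dots> = (\<Prod>b\<in>(Basis :: complex set). (\<integral>\<^sup>+x. ennreal (exp (- x\<^sup>2)) \<partial>lborel))"
    by (rule nn_integral_lborel_prod) auto
  also have "\<dots> = ennreal pi"
    unfolding g by (simp add: Basis_complex_def ennreal_mult[symmetric])
  finally show ?thesis .
qed

lemma prob_space_cgauss:
  assumes "finite I"
  shows "prob_space (cgauss I)"
proof
  interpret product_sigma_finite "\<lambda>_::'a. lborel :: complex measure"
    by standard
  have [measurable]: "(\<lambda>a. a i) \<in> borel_measurable (\<Pi>\<^sub>M i\<in>I. lborel :: complex measure)"
    if "i \<in> I" for i
    using that measurable_component_singleton[OF that, of "\<lambda>_. lborel"] by simp
  have [measurable]: "(\<lambda>a. ennreal (cgauss_density I a)) \<in> borel_measurable (\<Pi>\<^sub>M i\<in>I. lborel)"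
    unfolding cgauss_density_def by measurable
  have "emeasure (cgauss I) (space (cgauss I)) = (\<integral>\<^sup>+a. ennreal (cgauss_density I a) \<partial>(\<Pi>\<^sub>M i\<in>I. lborel))"
    unfolding cgauss_def by (subst emeasure_density) (auto intro!: nn_integral_cong)
  also have "\<dots> = (\<integral>\<^sup>+a. (\<Prod>i\<in>I. ennreal (exp (- (cmod (a i))\<^sup>2) / pi)) \<partial>(\<Pi>\<^sub>M i\<in>I. lborel))"
    using assms by (simp add: cgauss_density_def prod_ennreal prod_dividef sum_negf[symmetric] exp_sum)
  also have "\<dots> = (\<Prod>i\<in>I. (\<integral>\<^sup>+z. ennreal (exp (- (cmod z)\<^sup>2) / pi) \<partial>lborel))"
    using assms by (intro product_nn_integral_prod) auto
  also have "(\<integral>\<^sup>+z. ennreal (exp (- (cmod z)\<^sup>2) / pi) \<partial>lborel) = 1"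
  proof -
    have "(\<integral>\<^sup>+z. ennreal (exp (- (cmod z)\<^sup>2) / pi) \<partial>lborel)
        = (\<integral>\<^sup>+z. ennreal (exp (- (cmod z)\<^sup>2)) / ennreal pi \<partial>lborel)"
      by (simp add: divide_ennreal)
    also have "\<dots> = 1"
      by (subst nn_integral_divide) (auto simp: nn_integral_complex_gaussian)
    finally show ?thesis .
  qed
  finally show "emeasure (cgauss I) (space (cgauss I)) = 1" by simp
qed

lemma distr_translate_lborel:
  assumes "finite I"
  shows "distr (\<Pi>\<^sub>M i\<in>I. lborel) (\<Pi>\<^sub>M i\<in>I. lborel) (translate I h) = (\<Pi>\<^sub>M i\<in>I. lborel :: complex measure)"
proof -
  interpret product_sigma_finite "\<lambda>_::'a. lborel :: complex measure"
    by standard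
  have c: "(\<lambda>a. a i) \<in> borel_measurable (\<Pi>\<^sub>M i\<in>I. lborel :: complex measure)" if "i \<in> I" for i
    using that measurable_component_singleton[OF that, of "\<lambda>_. lborel"] by simp
  have m: "translate I h \<in> (\<Pi>\<^sub>M i\<in>I. lborel) \<rightarrow>\<^sub>M (\<Pi>\<^sub>M i\<in>I. lborel :: complex measure)"
    unfolding translate_def by (rule measurable_restrict) (use c in simp)
  show ?thesis
  proof (rule PiM_eqI)
    fix A :: "'a \<Rightarrow> complex set" assume A: "\<And>i. i \<in> I \<Longrightarrow> A i \<in> sets lborel"
    have A': "(\<lambda>z. h i + z) -` A i \<in> sets lborel" if "i \<in> I" for i
      using measurable_sets[of "\<lambda>z. h i + z" borel borel "A i"] A[OF that] by simp
    have eq: "translate I h -` Pi\<^sub>E I A \<inter> space (\<Pi>\<^sub>M i\<in>I. lborel) = (\<Pi>\<^sub>E i\<in>I. (\<lambda>z. h i + z) -` A i)"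
      by (auto simp: translate_def space_PiM PiE_iff add.commute extensional_def)
    have "emeasure (distr (\<Pi>\<^sub>M i\<in>I. lborel) (\<Pi>\<^sub>M i\<in>I. lborel) (translate I h)) (Pi\<^sub>E I A)
        = (\<Prod>i\<in>I. emeasure lborel ((\<lambda>z. h i + z) -` A i))"
      using A A' assms m
      by (subst emeasure_distr) (auto simp: eq intro!: emeasure_PiM sets_PiM_I_finite)
    also have "\<dots> = (\<Prod>i\<in>I. emeasure lborel (A i))"
    proof (rule prod.cong[OF refl])
      fix i assume "i \<in> I"
      have "emeasure lborel (A i) = emeasure (distr lborel borel ((+) (h i))) (A i)"
        by (simp add: lborel_distr_plus)
      also have "\<dots> = emeasure lborel ((\<lambda>z. h i + z) -` A i)"
        using A[OF \<open>i \<in> I\<close>] by (subst emeasure_distr) auto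
      finally show "emeasure lborel ((\<lambda>z. h i + z) -` A i) = emeasure lborel (A i)" ..
    qed
    finally show "emeasure (distr (\<Pi>\<^sub>M i\<in>I. lborel) (\<Pi>\<^sub>M i\<in>I. lborel) (translate I h)) (Pi\<^sub>E I A)
        = (\<Prod>i\<in>I. emeasure lborel (A i))" .
  qed (use assms in auto)
qed

lemma cgauss_density_translate:
  "cgauss_density I (translate I h a) =
     cgauss_density I a * exp (- 2 * Re (cdot I a h) - Re (cdot I h h))"
proof -
  have "(cmod (a i + h i))\<^sup>2 = (cmod (a i))\<^sup>2 + 2 * Re (a i * cnj (h i)) + (cmod (h i))\<^sup>2" for i
    unfolding cmod_power2 by (simp add: power2_eq_square algebra_simps)
  then have "(\<Sum>i\<in>I. (cmod (translate I h a i))\<^sup>2)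
      = (\<Sum>i\<in>I. (cmod (a i))\<^sup>2) + 2 * Re (cdot I a h) + Re (cdot I h h)"
    unfolding cdot_self by (simp add: translate_def sum.distrib cdot_def sum_distrib_left)
  then have "- (\<Sum>i\<in>I. (cmod (translate I h a i))\<^sup>2)
      = - (\<Sum>i\<in>I. (cmod (a i))\<^sup>2) + (- 2 * Re (cdot I a h) - Re (cdot I h h))"
    by simp
  then show ?thesis
    unfolding cgauss_density_def by (simp only: exp_add times_divide_eq_left)
qed

text \<open>Cameron-Martin formula: Lebesgue measure is translation invariant, so only the ratio of
  the Gaussian densities at the translated and the original point remains.\<close>

lemma nn_integral_cgauss_translate:
  assumes I: "finite I" and f [measurable]: "f \<in> borel_measurable (cgauss I)"
  shows "(\<integral>\<^sup>+a. f (translate I h a) * ennreal (exp (- 2 * Re (cdot I a h) - Re (cdot I h h))) \<partial>cgauss I)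
       = (\<integral>\<^sup>+a. f a \<partial>cgauss I)"
proof -
  let ?L = "\<Pi>\<^sub>M i\<in>I. lborel :: complex measure"
  have sL: "sets ?L = sets (cgauss I)"
    by (simp add: cgauss_def)
  note [measurable_cong] = sL
  have c [measurable]: "(\<lambda>a. a i) \<in> borel_measurable ?L" if "i \<in> I" for i
    using that measurable_component_singleton[OF that, of "\<lambda>_. lborel"] by simp
  have [measurable]: "(\<lambda>a. ennreal (cgauss_density I a)) \<in> borel_measurable ?L"
    unfolding cgauss_density_def by measurable
  have [measurable]: "translate I h \<in> ?L \<rightarrow>\<^sub>M ?L" "f \<in> borel_measurable ?L"
    using measurable_translate[of I h] f by (simp_all cong: measurable_cong_sets add: sL)
  have cd: "(\<lambda>a. cdot I a h) \<in> borel_measurable ?L"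
    using measurable_cdot[of I h] by (simp cong: measurable_cong_sets add: sL)
  note [measurable] = cd
  have nn: "cgauss_density I a \<ge> 0" for a
    by (simp add: cgauss_density_def)
  have "(\<integral>\<^sup>+a. f a \<partial>cgauss I) = (\<integral>\<^sup>+a. ennreal (cgauss_density I a) * f a \<partial>?L)"
    unfolding cgauss_def by (rule nn_integral_density) measurable
  also have "\<dots> = (\<integral>\<^sup>+a. ennreal (cgauss_density I a) * f a \<partial>distr ?L ?L (translate I h))"
    by (simp add: distr_translate_lborel[OF I])
  also have "\<dots> = (\<integral>\<^sup>+a. ennreal (cgauss_density I (translate I h a)) * f (translate I h a) \<partial>?L)"
    by (rule nn_integral_distr) measurable
  also have "\<dots> = (\<integral>\<^sup>+a. ennreal (cgauss_density I a) * (f (translate I h a)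
                    * ennreal (exp (- 2 * Re (cdot I a h) - Re (cdot I h h)))) \<partial>?L)"
    unfolding cgauss_density_translate by (simp add: ennreal_mult nn mult_ac)
  also have "\<dots> = (\<integral>\<^sup>+a. f (translate I h a) * ennreal (exp (- 2 * Re (cdot I a h) - Re (cdot I h h))) \<partial>cgauss I)"
    unfolding cgauss_def by (rule nn_integral_density[symmetric]) measurable
  finally show ?thesis by simp
qed

text \<open>Laplace transform by completing the square: after translation by \<open>v\<close>
  itself, the terms that are linear in \<open>a\<close> cancel.\<close>

lemma nn_integral_exp_cdot:
  assumes I: "finite I"
  shows "(\<integral>\<^sup>+a. ennreal (exp (2 * Re (cdot I a v))) \<partial>cgauss I) = ennreal (exp (Re (cdot I v v)))"
proof -
  interpret prob_space "cgauss I" by (rule prob_space_cgauss[OF I])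
  have "(\<integral>\<^sup>+a. ennreal (exp (2 * Re (cdot I a v))) \<partial>cgauss I)
      = (\<integral>\<^sup>+a. ennreal (exp (2 * Re (cdot I (translate I v a) v)))
            * ennreal (exp (- 2 * Re (cdot I a v) - Re (cdot I v v))) \<partial>cgauss I)"
    by (rule nn_integral_cgauss_translate[OF I, symmetric]) measurable
  also have "\<dots> = (\<integral>\<^sup>+a. ennreal (exp (Re (cdot I v v))) \<partial>cgauss I)"
    by (simp add: cdot_translate ennreal_mult[symmetric] exp_add[symmetric])
  finally show ?thesis
    by (simp add: emeasure_space_1)
qed

text \<open>The Laplace transform handles real parts of linear functionals only. Up to a factor
  \<open>sqrt 2\<close> the modulus is the largest real part among the four quarter turns of
  \<open>c\<close>.\<close>

lemma exp_mult_cmod_le: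
  fixes c :: complex and l :: real
  assumes "l \<ge> 0"
  shows "exp (l * cmod c) \<le> (\<Sum>p<4. exp (sqrt 2 * l * Re (\<i> ^ p * c)))"
proof -
  have "cmod c \<le> sqrt 2 * max \<bar>Re c\<bar> \<bar>Im c\<bar>"
  proof (rule power2_le_imp_le)
    have "(Re c)\<^sup>2 \<le> (max \<bar>Re c\<bar> \<bar>Im c\<bar>)\<^sup>2" "(Im c)\<^sup>2 \<le> (max \<bar>Re c\<bar> \<bar>Im c\<bar>)\<^sup>2"
      by (auto simp: abs_le_square_iff[symmetric])
    then show "(cmod c)\<^sup>2 \<le> (sqrt 2 * max \<bar>Re c\<bar> \<bar>Im c\<bar>)\<^sup>2"
      by (simp add: power_mult_distrib cmod_power2)
  qed auto
  moreover have "\<exists>p<4. Re (\<i> ^ p * c) = max \<bar>Re c\<bar> \<bar>Im c\<bar>"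
  proof -
    have "max \<bar>Re c\<bar> \<bar>Im c\<bar> \<in> {Re c, - Im c, - Re c, Im c}"
      by (auto simp: max_def abs_if)
    then consider "max \<bar>Re c\<bar> \<bar>Im c\<bar> = Re c" | "max \<bar>Re c\<bar> \<bar>Im c\<bar> = - Im c"
      | "max \<bar>Re c\<bar> \<bar>Im c\<bar> = - Re c" | "max \<bar>Re c\<bar> \<bar>Im c\<bar> = Im c"
      by blast
    then show ?thesis
    proof cases
      case 1
      then show ?thesis by (intro exI[of _ 0]) simp
    next
      case 2
      then show ?thesis by (intro exI[of _ 1]) simp
    next
      case 3
      then show ?thesis by (intro exI[of _ 2]) simp
    next
      case 4
      then show ?thesis by (intro exI[of _ 3]) (simp add: power3_eq_cube)
    qed
  qed
  ultimately obtain p :: nat where p: "p < 4" "cmod c \<le> sqrt 2 * Re (\<i> ^ p * c)"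
    by metis
  have "l * cmod c \<le> sqrt 2 * l * Re (\<i> ^ p * c)"
    using mult_left_mono[OF p(2) assms] by (simp add: mult_ac)
  then have "exp (l * cmod c) \<le> exp (sqrt 2 * l * Re (\<i> ^ p * c))" by simp
  also have "\<dots> \<le> (\<Sum>p<4. exp (sqrt 2 * l * Re (\<i> ^ p * c)))"
    using p(1) by (intro member_le_sum) auto
  finally show ?thesis .
qed

lemma exp_average_le:
  fixes f :: "'t \<Rightarrow> real"
  assumes "finite T" "T \<noteq> {}"
  shows "exp ((\<Sum>t\<in>T. f t) / card T) \<le> (\<Sum>t\<in>T. exp (f t)) / card T"
proof -
  have "exp (\<Sum>t\<in>T. (1 / card T) *\<^sub>R f t) \<le> (\<Sum>t\<in>T. 1 / card T * exp (f t))"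
    using assms by (intro convex_on_sum[OF _ _ exp_convex]) auto
  then show ?thesis by (simp add: sum_divide_distrib)
qed

text \<open>Jensen's inequality turns the exponential moment of the means into exponential moments of
  single linear functionals, one point being chosen for each \<open>j\<close>.\<close>

lemma tail_bound:
  fixes k :: "'j \<Rightarrow> 't \<Rightarrow> 'i \<Rightarrow> complex"
  assumes I: "finite I" and J: "finite J" and T: "finite T" "T \<noteq> {}"
    and gram: "\<And>g \<theta>. g \<in> J \<rightarrow> T \<Longrightarrow> (\<And>j. cmod (\<theta> j) = 1) \<Longrightarrow>
      Re (cdot I (\<lambda>i. \<Sum>j\<in>J. \<theta> j * k j (g j) i) (\<lambda>i. \<Sum>j\<in>J. \<theta> j * k j (g j) i)) \<le> 4 * card J"
  shows "measure (cgauss I) {a \<in> space (cgauss I).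
      card {j\<in>J. (\<Sum>t\<in>T. cmod (cdot I a (k j t))) / card T \<le> 5} < card J / 4} \<le> exp (- real (card J) / 4)"
proof -
  interpret prob_space "cgauss I" by (rule prob_space_cgauss[OF I])
  define M where "M j a = (\<Sum>t\<in>T. cmod (cdot I a (k j t))) / card T" for j a
  \<comment> \<open>With 4/5 the Chernoff exponent closes: \<open>5 * l * 3/4 = 3\<close> exceeds
    7/5 (from the four phases) plus 32/25 (from the Gram bound) by more than 1/4.\<close>
  define l :: real where "l = 4/5"
  \<comment> \<open>\<open>cdot\<close> is conjugate linear in its second argument, so the power of
    \<open>- \<i>\<close> becomes the phase \<open>\<i> ^ p\<close>.\<close>
  define K where "K j x i = (- \<i>) ^ snd x * k j (fst x) i" for j and x :: "'t \<times> nat" and i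
  define X where "X = T \<times> {..<4::nat}"
  define V where "V g i = (\<Sum>j\<in>J. K j (g j) i)" for g i
  have X: "finite X" "card X = 4 * card T"
    using T by (auto simp: X_def card_cartesian_product)
  have cT: "real (card T) > 0" using T by (simp add: card_gt_0_iff)
  have cK: "cdot I a (K j x) = \<i> ^ snd x * cdot I a (k j (fst x))" for a j x
    unfolding K_def by (subst cdot_scale_right) simp
  have U: "exp (l * M j a) \<le> (\<Sum>x\<in>X. exp (sqrt 2 * l * Re (cdot I a (K j x)))) / card T" for j a
  proof -
    have "exp (l * M j a) = exp ((\<Sum>t\<in>T. l * cmod (cdot I a (k j t))) / card T)"
      by (simp add: M_def sum_distrib_left)
    also have "\<dots> \<le> (\<Sum>t\<in>T. exp (l * cmod (cdot I a (k j t)))) / card T"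
      by (rule exp_average_le[OF T])
    also have "\<dots> \<le> (\<Sum>t\<in>T. \<Sum>p<4. exp (sqrt 2 * l * Re (\<i> ^ p * cdot I a (k j t)))) / card T"
      by (intro divide_right_mono sum_mono exp_mult_cmod_le) (auto simp: l_def)
    also have "(\<Sum>t\<in>T. \<Sum>p<4. exp (sqrt 2 * l * Re (\<i> ^ p * cdot I a (k j t))))
        = (\<Sum>x\<in>X. exp (sqrt 2 * l * Re (cdot I a (K j x))))"
      unfolding X_def cK by (simp add: sum.cartesian_product split_def)
    finally show ?thesis .
  qed
  \<comment> \<open>Expanding the product over \<open>J\<close> chooses one node and one phase per
    index; the product of exponentials is then the exponential of the single functional given by
    \<open>V g\<close>.\<close>
  have prodU: "exp (l * (\<Sum>j\<in>J. M j a))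
      \<le> (\<Sum>g\<in>J \<rightarrow>\<^sub>E X. exp (sqrt 2 * l * Re (cdot I a (V g)))) / card T ^ card J" for a
  proof -
    have "exp (l * (\<Sum>j\<in>J. M j a)) = (\<Prod>j\<in>J. exp (l * M j a))"
      using J by (simp add: sum_distrib_left exp_sum)
    also have "\<dots> \<le> (\<Prod>j\<in>J. (\<Sum>x\<in>X. exp (sqrt 2 * l * Re (cdot I a (K j x)))) / card T)"
      by (intro prod_mono) (use U in auto)
    also have "\<dots> = (\<Prod>j\<in>J. \<Sum>x\<in>X. exp (sqrt 2 * l * Re (cdot I a (K j x)))) / card T ^ card J"
      by (simp add: prod_dividef)
    also have "(\<Prod>j\<in>J. \<Sum>x\<in>X. exp (sqrt 2 * l * Re (cdot I a (K j x))))
        = (\<Sum>g\<in>J \<rightarrow>\<^sub>E X. \<Prod>j\<in>J. exp (sqrt 2 * l * Re (cdot I a (K j (g j)))))"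
      using J X by (intro prod_sum_PiE) auto
    also have "\<dots> = (\<Sum>g\<in>J \<rightarrow>\<^sub>E X. exp (sqrt 2 * l * Re (cdot I a (V g))))"
      unfolding V_def cdot_sum_right using J
      by (simp add: exp_sum[symmetric] sum_distrib_left)
    finally show ?thesis .
  qed
  have E: "(\<integral>\<^sup>+a. ennreal (exp (sqrt 2 * l * Re (cdot I a (V g)))) \<partial>cgauss I)
      \<le> ennreal (exp (32/25 * card J))" if g: "g \<in> J \<rightarrow>\<^sub>E X" for g
  proof -
    \<comment> \<open>Halved because the Laplace transform is stated for
      \<open>exp (2 * Re ...)\<close>. Its square 8/25 times the Gram bound
      \<open>4 * card J\<close> gives the exponent 32/25.\<close>
    define c :: real where "c = sqrt 2 * l / 2"
    have "sqrt 2 * l * Re (cdot I a (V g)) = 2 * Re (cdot I a (\<lambda>i. of_real c * V g i))" for a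
      by (subst cdot_scale_right) (simp add: c_def)
    then have "(\<integral>\<^sup>+a. ennreal (exp (sqrt 2 * l * Re (cdot I a (V g)))) \<partial>cgauss I)
        = ennreal (exp (Re (cdot I (\<lambda>i. of_real c * V g i) (\<lambda>i. of_real c * V g i))))"
      using nn_integral_exp_cdot[OF I, of "\<lambda>i. of_real c * V g i"] by simp
    moreover have "Re (cdot I (\<lambda>i. of_real c * V g i) (\<lambda>i. of_real c * V g i)) \<le> 32/25 * card J"
    proof -
      have "c * c = 8/25"
        unfolding c_def l_def by (simp add: field_simps)
      moreover have "cdot I (\<lambda>i. of_real c * V g i) (\<lambda>i. of_real c * V g i) = of_real (c * c) * cdot I (V g) (V g)"
        by (simp add: cdot_scale_left cdot_scale_right)
      moreover have "Re (cdot I (V g) (V g)) \<le> 4 * card J"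
        unfolding V_def K_def
        by (rule gram[of "\<lambda>j. fst (g j)" "\<lambda>j. (- \<i>) ^ snd (g j)"])
           (use g in \<open>auto simp: X_def norm_power PiE_def Pi_def mem_Times_iff\<close>)
      ultimately have "Re (cdot I (\<lambda>i. of_real c * V g i) (\<lambda>i. of_real c * V g i)) = 8/25 * Re (cdot I (V g) (V g))"
        by (simp only: Re_complex_of_real times_complex.sel Im_complex_of_real)
      also have "\<dots> \<le> 8/25 * (4 * card J)"
        using \<open>Re (cdot I (V g) (V g)) \<le> 4 * card J\<close> by (intro mult_left_mono) auto
      finally show ?thesis by simp
    qed
    ultimately show ?thesis by (simp add: ennreal_leI)
  qed
  define Z where "Z a = ennreal (exp (l * (\<Sum>j\<in>J. M j a)))" for a
  have mM [measurable]: "(\<lambda>a. M j a) \<in> borel_measurable (cgauss I)" for j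
    unfolding M_def by measurable
  have mZ [measurable]: "Z \<in> borel_measurable (cgauss I)"
    unfolding Z_def by measurable
  have "(\<integral>\<^sup>+a. Z a \<partial>cgauss I)
      \<le> (\<integral>\<^sup>+a. (\<Sum>g\<in>J \<rightarrow>\<^sub>E X. ennreal (1 / card T ^ card J) * ennreal (exp (sqrt 2 * l * Re (cdot I a (V g))))) \<partial>cgauss I)"
  proof (rule nn_integral_mono)
    fix a
    have "Z a \<le> ennreal ((\<Sum>g\<in>J \<rightarrow>\<^sub>E X. exp (sqrt 2 * l * Re (cdot I a (V g)))) / card T ^ card J)"
      unfolding Z_def by (rule ennreal_leI[OF prodU])
    then show "Z a \<le> (\<Sum>g\<in>J \<rightarrow>\<^sub>E X. ennreal (1 / card T ^ card J) * ennreal (exp (sqrt 2 * l * Re (cdot I a (V g)))))"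
      by (simp add: ennreal_mult[symmetric] sum_divide_distrib)
  qed
  also have "\<dots> = (\<Sum>g\<in>J \<rightarrow>\<^sub>E X. ennreal (1 / card T ^ card J)
      * (\<integral>\<^sup>+a. ennreal (exp (sqrt 2 * l * Re (cdot I a (V g)))) \<partial>cgauss I))"
    by (simp add: nn_integral_sum nn_integral_cmult)
  also have "\<dots> \<le> (\<Sum>g\<in>J \<rightarrow>\<^sub>E X. ennreal (1 / card T ^ card J) * ennreal (exp (32/25 * card J)))"
    by (intro sum_mono mult_left_mono E) auto
  also have "\<dots> = ennreal (4 ^ card J * exp (32/25 * card J))"
    using J X cT
    by (simp add: card_funcsetE power_mult_distrib ennreal_mult[symmetric] ennreal_of_nat_eq_real_of_nat)
  also have "\<dots> \<le> ennreal (exp (67/25 * card J))"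
  proof -
    \<comment> \<open>The number of choices per index, divided by \<open>card T\<close>, is 4, and
      \<open>4 \<le> exp (7/5)\<close>; the total exponent is 7/5 + 32/25 = 67/25.\<close>
    have "ln (2::real) \<le> 7/10" using ln2_le_25_over_36 by simp
    then have "exp (ln (4::real)) \<le> exp (7/5)"
      using ln_realpow[of 2 2] by (subst exp_le_cancel_iff) simp
    then have "(4::real) \<le> exp (7/5)" by simp
    then have "(4::real) ^ card J \<le> exp (7/5) ^ card J"
      by (intro power_mono) auto
    also have "\<dots> = exp (7/5 * card J)"
      by (simp add: exp_of_nat_mult[symmetric] mult.commute)
    finally have "4 ^ card J * exp (32/25 * card J) \<le> exp (7/5 * card J) * exp (32/25 * card J)"
      by (intro mult_right_mono) auto
    then show ?thesis
      by (simp add: exp_add[symmetric] ennreal_leI)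
  qed
  finally have EZ: "(\<integral>\<^sup>+a. Z a \<partial>cgauss I) \<le> ennreal (exp (67/25 * card J))" .
  define B where "B = {a \<in> space (cgauss I). card {j\<in>J. M j a \<le> 5} < card J / 4}"
  \<comment> \<open>On \<open>B\<close> more than three quarters of the means exceed 5, so their sum
    times \<open>l\<close> is at least \<open>3 * card J\<close>. Markov's inequality then gives the
    exponent 67/25 - 3 = - 8/25, which is below - 1/4.\<close>
  have "B \<subseteq> {a \<in> space (cgauss I). 1 \<le> ennreal (exp (- 3 * card J)) * Z a}"
  proof
    fix a assume a: "a \<in> B"
    have "card J = card {j\<in>J. M j a \<le> 5} + card {j\<in>J. \<not> M j a \<le> 5}"
      using J by (subst card_Un_disjoint[symmetric]) (auto intro!: arg_cong[where f = card])
    with a have "5 * card {j\<in>J. \<not> M j a \<le> 5} \<ge> 15/4 * card J"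
      by (simp add: B_def)
    also have "real (5 * card {j\<in>J. \<not> M j a \<le> 5}) = (\<Sum>j\<in>{j\<in>J. \<not> M j a \<le> 5}. 5)"
      by simp
    also have "\<dots> \<le> (\<Sum>j\<in>{j\<in>J. \<not> M j a \<le> 5}. M j a)"
      by (intro sum_mono) auto
    also have "\<dots> \<le> (\<Sum>j\<in>J. M j a)"
      using J by (intro sum_mono2) (auto simp: M_def intro!: sum_nonneg divide_nonneg_nonneg)
    finally have "3 * card J \<le> l * (\<Sum>j\<in>J. M j a)"
      by (simp add: l_def)
    then have "1 \<le> ennreal (exp (- 3 * card J)) * Z a"
      unfolding Z_def by (simp add: ennreal_mult[symmetric] exp_add[symmetric] ennreal_1[symmetric] del: ennreal_1)
    with a show "a \<in> {a \<in> space (cgauss I). 1 \<le> ennreal (exp (- 3 * card J)) * Z a}"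
      by (simp add: B_def)
  qed
  then have "emeasure (cgauss I) B \<le> emeasure (cgauss I) {a \<in> space (cgauss I). 1 \<le> ennreal (exp (- 3 * card J)) * Z a}"
    by (intro emeasure_mono) measurable
  also have "\<dots> \<le> ennreal (exp (- 3 * card J)) * (\<integral>\<^sup>+a. Z a \<partial>cgauss I)"
  proof -
    have "emeasure (cgauss I) {a \<in> space (cgauss I). 1 \<le> ennreal (exp (- 3 * card J)) * Z a}
        \<le> ennreal (exp (- 3 * card J)) * (\<integral>\<^sup>+a. Z a * indicator (space (cgauss I)) a \<partial>cgauss I)"
      by (rule nn_integral_Markov_inequality) measurable
    also have "(\<integral>\<^sup>+a. Z a * indicator (space (cgauss I)) a \<partial>cgauss I) = (\<integral>\<^sup>+a. Z a \<partial>cgauss I)"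
      by (intro nn_integral_cong) simp
    finally show ?thesis .
  qed
  also have "\<dots> \<le> ennreal (exp (- 3 * card J)) * ennreal (exp (67/25 * card J))"
    by (intro mult_left_mono EZ) auto
  also have "\<dots> \<le> ennreal (exp (- real (card J) / 4))"
    by (simp add: ennreal_mult[symmetric] exp_add[symmetric] ennreal_leI)
  finally have "measure (cgauss I) B \<le> exp (- real (card J) / 4)"
    by (simp add: emeasure_eq_measure)
  then show ?thesis by (simp add: B_def M_def)
qed

section \<open>Counting by disjoint translates\<close>

lemma sum_power_card_Pow:
  fixes x :: real
  assumes "finite A"
  shows "(\<Sum>S\<in>Pow A. x ^ card S) = (1 + x) ^ card A"
  using prod_add[OF assms, of "\<lambda>_. x" "\<lambda>_. 1"] by (simp add: add.commute)

text \<open>The translates of the sets \<open>F \<inter> {S is tame}\<close> by \<open>h S\<close> are disjoint, because \<open>S\<close> can be read off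
  the translated point. Each of them loses at most a factor \<open>exp (- C * card S)\<close>.\<close>

lemma disjoint_translates_bound:
  fixes h :: "'j set \<Rightarrow> 'i \<Rightarrow> complex" and C :: real
  assumes I: "finite I" and J: "finite J"
    and F [measurable]: "F \<in> sets (cgauss I)"
    and tame [measurable]: "\<And>j. j \<in> J \<Longrightarrow> Measurable.pred (cgauss I) (tame j)"
    and recover: "\<And>S a j. \<lbrakk>S \<subseteq> J; a \<in> F; \<And>i. i \<in> S \<Longrightarrow> tame i a; j \<in> J\<rbrakk> \<Longrightarrow> rec j (translate I (h S) a) \<longleftrightarrow> j \<in> S"
    and cost: "\<And>S a. \<lbrakk>S \<subseteq> J; a \<in> F; \<And>i. i \<in> S \<Longrightarrow> tame i a\<rbrakk> \<Longrightarrow>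
       2 * Re (cdot I a (h S)) + Re (cdot I (h S) (h S)) \<le> C * card S"
  shows "measure (cgauss I) {a \<in> F. n \<le> card {j\<in>J. tame j a}} * (1 + exp (- C)) ^ n \<le> 1"
proof -
  interpret prob_space "cgauss I" by (rule prob_space_cgauss[OF I])
  have Fsub: "F \<subseteq> space (cgauss I)" using F by (rule sets.sets_into_space)
  define G where "G S = {a \<in> F. \<forall>i\<in>S. tame i a}" for S
  have tame' [measurable]: "{a \<in> space (cgauss I). tame j a} \<in> sets (cgauss I)" if "j \<in> J" for j
    using tame[OF that] by measurable
  have G [measurable]: "G S \<in> sets (cgauss I)" if "S \<subseteq> J" for S
  proof -
    have fS: "finite S" using that J finite_subset by blast
    have "{a \<in> space (cgauss I). \<forall>i\<in>S. tame i a} \<in> sets (cgauss I)"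
      using fS that by (intro sets.sets_Collect_finite_All tame') auto
    then have "F \<inter> {a \<in> space (cgauss I). \<forall>i\<in>S. tame i a} \<in> sets (cgauss I)" by auto
    also have "F \<inter> {a \<in> space (cgauss I). \<forall>i\<in>S. tame i a} = G S"
      using Fsub by (auto simp: G_def)
    finally show ?thesis .
  qed
  define sub where "sub S = translate I (\<lambda>i. - h S i)" for S
  have sub: "sub S (translate I (h S) a) = a" if "a \<in> space (cgauss I)" for S a
    using that by (auto simp: sub_def translate_def space_cgauss PiE_def extensional_def)
  have sub': "translate I (h S) (sub S a) = a" if "a \<in> space (cgauss I)" for S a
    using that by (auto simp: sub_def translate_def space_cgauss PiE_def extensional_def)
  have [measurable]: "sub S \<in> cgauss I \<rightarrow>\<^sub>M cgauss I" for S
    unfolding sub_def by measurable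
  \<comment> \<open>If \<open>a\<close> is the translate by \<open>h S\<close> of a point of
    \<open>G S\<close>, then \<open>rec\<close> reads \<open>S\<close> off \<open>a\<close>; so at
    most one \<open>S\<close> contributes.\<close>
  have disj: "(\<Sum>S\<in>Pow J. indicator (G S) (sub S a) :: ennreal) \<le> 1" if a: "a \<in> space (cgauss I)" for a
  proof -
    have uniq: "S = {j\<in>J. rec j a}" if "S \<subseteq> J" "sub S a \<in> G S" for S
      using recover[of S "sub S a"] that a by (auto simp: G_def sub')
    have "(\<Sum>S\<in>Pow J. indicator (G S) (sub S a) :: ennreal)
        \<le> (\<Sum>S\<in>Pow J. if S = {j\<in>J. rec j a} then 1 else 0)"
    proof (rule sum_mono)
      fix S assume "S \<in> Pow J"
      then show "indicator (G S) (sub S a) \<le> (if S = {j\<in>J. rec j a} then 1 else (0 :: ennreal))"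
        using uniq[of S] by (cases "sub S a \<in> G S") auto
    qed
    also have "\<dots> = 1" using J by simp
    finally show ?thesis .
  qed
  \<comment> \<open>Cameron-Martin weight of the translation by \<open>h S\<close>: the integral of
    \<open>w S\<close> over \<open>G S\<close> is the probability of the translated set.\<close>
  define w where "w S a = ennreal (exp (- 2 * Re (cdot I a (h S)) - Re (cdot I (h S) (h S))))" for S a
  have [measurable]: "w S \<in> borel_measurable (cgauss I)" for S
    unfolding w_def by measurable
  let ?Fn = "{a \<in> F. n \<le> card {j\<in>J. tame j a}}"
  have Fn [measurable]: "?Fn \<in> sets (cgauss I)"
  proof -
    have "real (card {j\<in>J. tame j a}) = (\<Sum>j\<in>J. of_bool (tame j a))" for a
      using J by (simp add: sum.If_cases of_bool_def Int_def)
    then have "n \<le> card {j\<in>J. tame j a} \<longleftrightarrow> real n \<le> (\<Sum>j\<in>J. of_bool (tame j a))" for a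
      by (metis of_nat_le_iff)
    moreover have "{a \<in> space (cgauss I). real n \<le> (\<Sum>j\<in>J. of_bool (tame j a))} \<in> sets (cgauss I)"
      unfolding of_bool_def by measurable
    ultimately have "{a \<in> space (cgauss I). n \<le> card {j\<in>J. tame j a}} \<in> sets (cgauss I)"
      by simp
    then have "F \<inter> {a \<in> space (cgauss I). n \<le> card {j\<in>J. tame j a}} \<in> sets (cgauss I)" by auto
    also have "F \<inter> {a \<in> space (cgauss I). n \<le> card {j\<in>J. tame j a}} = ?Fn"
      using Fsub by auto
    finally show ?thesis .
  qed
  have "ennreal ((1 + exp (- C)) ^ n) * emeasure (cgauss I) ?Fn
      = (\<integral>\<^sup>+a. ennreal ((1 + exp (- C)) ^ n) * indicator ?Fn a \<partial>cgauss I)"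
    by (simp add: nn_integral_cmult)
  also have "\<dots> \<le> (\<integral>\<^sup>+a. (\<Sum>S\<in>Pow J. indicator (G S) a * w S a) \<partial>cgauss I)"
  proof (rule nn_integral_mono)
    fix a assume "a \<in> space (cgauss I)"
    show "ennreal ((1 + exp (- C)) ^ n) * indicator ?Fn a \<le> (\<Sum>S\<in>Pow J. indicator (G S) a * w S a)"
    proof (cases "a \<in> ?Fn")
      case True
      let ?A = "{j\<in>J. tame j a}"
      \<comment> \<open>A point with at least \<open>n\<close> tame indices lies in
        \<open>G S\<close> for every set \<open>S\<close> of them, each with weight at least
        \<open>exp (- C) ^ card S\<close>; summed over all these sets, the weights form a binomial
        product.\<close>
      have "(1 + exp (- C)) ^ n \<le> (1 + exp (- C)) ^ card ?A"
        using True by (intro power_increasing) auto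
      also have "\<dots> = (\<Sum>S\<in>Pow ?A. exp (- C) ^ card S)"
        using J by (simp add: sum_power_card_Pow)
      finally have "ennreal ((1 + exp (- C)) ^ n) \<le> ennreal (\<Sum>S\<in>Pow ?A. exp (- C) ^ card S)"
        by (rule ennreal_leI)
      also have "\<dots> = (\<Sum>S\<in>Pow ?A. ennreal (exp (- C) ^ card S))"
        by simp
      also have "\<dots> \<le> (\<Sum>S\<in>Pow ?A. indicator (G S) a * w S a)"
      proof (rule sum_mono)
        fix S assume S: "S \<in> Pow ?A"
        then have "a \<in> G S" using True by (auto simp: G_def)
        moreover have "exp (- C) ^ card S \<le> exp (- 2 * Re (cdot I a (h S)) - Re (cdot I (h S) (h S)))"
        proof -
          have "2 * Re (cdot I a (h S)) + Re (cdot I (h S) (h S)) \<le> C * card S"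
            using S True by (intro cost) auto
          then show ?thesis by (simp add: exp_of_nat_mult[symmetric] mult.commute)
        qed
        ultimately show "ennreal (exp (- C) ^ card S) \<le> indicator (G S) a * w S a"
          by (simp add: w_def ennreal_leI)
      qed
      also have "\<dots> \<le> (\<Sum>S\<in>Pow J. indicator (G S) a * w S a)"
        using J by (intro sum_mono2) auto
      finally show ?thesis using True by simp
    qed simp
  qed
  also have "\<dots> = (\<Sum>S\<in>Pow J. \<integral>\<^sup>+a. indicator (G S) a * w S a \<partial>cgauss I)"
    by (rule nn_integral_sum) measurable
  also have "\<dots> = (\<Sum>S\<in>Pow J. \<integral>\<^sup>+a. indicator (G S) (sub S a) \<partial>cgauss I)"
  proof (rule sum.cong[OF refl])
    fix S assume S: "S \<in> Pow J"
    have [measurable]: "G S \<in> sets (cgauss I)" using S G by auto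
    have "(\<integral>\<^sup>+a. indicator (G S) a * w S a \<partial>cgauss I)
       = (\<integral>\<^sup>+a. indicator (G S) (sub S (translate I (h S) a)) * w S a \<partial>cgauss I)"
      by (intro nn_integral_cong) (simp add: sub)
    also have "\<dots> = (\<integral>\<^sup>+a. indicator (G S) (sub S a) \<partial>cgauss I)"
      unfolding w_def by (rule nn_integral_cgauss_translate[OF I]) measurable
    finally show "(\<integral>\<^sup>+a. indicator (G S) a * w S a \<partial>cgauss I)
       = (\<integral>\<^sup>+a. indicator (G S) (sub S a) \<partial>cgauss I)" .
  qed
  also have "\<dots> = (\<integral>\<^sup>+a. (\<Sum>S\<in>Pow J. indicator (G S) (sub S a)) \<partial>cgauss I)"
    by (rule nn_integral_sum[symmetric]) measurable
  also have "\<dots> \<le> (\<integral>\<^sup>+a. 1 \<partial>cgauss I)"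
    by (rule nn_integral_mono) (rule disj)
  also have "\<dots> = 1" by (simp add: emeasure_space_1)
  finally have "ennreal ((1 + exp (- C)) ^ n) * ennreal (measure (cgauss I) ?Fn) \<le> 1"
    by (simp add: emeasure_eq_measure)
  then show ?thesis
    by (subst mult.commute)
       (simp add: ennreal_mult[symmetric] ennreal_1[symmetric] del: ennreal_1)
qed

section \<open>Random forms and coherent states\<close>

lemma exponents_bij:
  "bij_betw (\<lambda>(i, j). (i, j, d - i - j)) (Sigma {..d} (\<lambda>i. {..d - i})) (exponents d)"
  by (rule bij_betwI[of _ _ _ "\<lambda>(i, j, k). (i, j)"]) (auto simp: exponents_def)

lemma finite_exponents [simp]: "finite (exponents d)"
  using bij_betw_finite[OF exponents_bij[of d]] by simp

lemma card_exponents: "card (exponents d) = (d + 1) * (d + 2) div 2"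
proof -
  have "card (exponents d) = (\<Sum>i\<le>d. Suc (d - i))"
    by (simp add: bij_betw_same_card[OF exponents_bij, symmetric])
  also have "\<dots> = (\<Sum>i\<le>d. Suc i)"
    by (rule sum.reindex_bij_witness[of _ "\<lambda>i. d - i" "\<lambda>i. d - i"]) auto
  also have "\<dots> = (d + 1) * (d + 2) div 2"
    by (induction d) auto
  finally show ?thesis .
qed

lemma trinomial:
  fixes x y z :: complex
  shows "(x + y + z) ^ d =
    (\<Sum>(i, j, k)\<in>exponents d. of_real (fact d / (fact i * fact j * fact k)) * x ^ i * y ^ j * z ^ k)"
proof -
  have "(x + y + z) ^ d = (\<Sum>i\<le>d. \<Sum>j\<le>d - i. of_nat (d choose i) * x ^ i * (of_nat ((d - i) choose j) * y ^ j * z ^ (d - i - j)))"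
    by (simp add: add.assoc binomial_ring[of x "y + z" d] binomial_ring[of y z] sum_distrib_left)
  also have "\<dots> = (\<Sum>i\<le>d. \<Sum>j\<le>d - i. of_real (fact d / (fact i * fact j * fact (d - i - j))) * x ^ i * y ^ j * z ^ (d - i - j))"
  proof (intro sum.cong refl)
    fix i j assume "i \<in> {..d}" "j \<in> {..d - i}"
    then have "of_nat (d choose i) * of_nat ((d - i) choose j) = (of_real (fact d / (fact i * fact j * fact (d - i - j))) :: complex)"
      by (simp add: binomial_fact)
    then show "of_nat (d choose i) * x ^ i * (of_nat ((d - i) choose j) * y ^ j * z ^ (d - i - j))
        = of_real (fact d / (fact i * fact j * fact (d - i - j))) * x ^ i * y ^ j * z ^ (d - i - j)"
      by (metis (no_types, lifting) mult.assoc mult.left_commute)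
  qed
  also have "\<dots> = (\<Sum>(i, j, k)\<in>exponents d. of_real (fact d / (fact i * fact j * fact k)) * x ^ i * y ^ j * z ^ k)"
    by (subst sum.Sigma) (auto simp: sum.reindex_bij_betw[OF exponents_bij, symmetric] split_def)
  finally show ?thesis .
qed

text \<open>The coherent state at \<open>u\<close>: pairing with it evaluates a form at \<open>u\<close>, up to the factor
  \<open>sqrt (dim)\<close> (see \<open>cdot_kvec\<close>).\<close>

definition kvec :: "nat \<Rightarrow> complex^3 \<Rightarrow> nat \<times> nat \<times> nat \<Rightarrow> complex" where
  "kvec d u = (\<lambda>(i, j, k). of_real (sqrt (fact d / (fact i * fact j * fact k)))
     * cnj ((u $ 1) ^ i * (u $ 2) ^ j * (u $ 3) ^ k))"

definition form_of :: "nat \<Rightarrow> form \<Rightarrow> form" where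
  "form_of d a = (\<lambda>i\<in>exponents d. a i / of_real (sqrt (monomial_sqnorm i)))"

text \<open>Trinomial theorem. The arguments are exchanged on the right because \<open>kvec\<close>
  contains the conjugated monomials.\<close>

lemma cdot_kvec_kvec: "cdot (exponents d) (kvec d u) (kvec d v) = cinner3 v u ^ d"
proof -
  have "cinner3 v u ^ d = (v $ 1 * cnj (u $ 1) + v $ 2 * cnj (u $ 2) + v $ 3 * cnj (u $ 3)) ^ d"
    by (simp add: cinner3_def sum_3)
  also have "\<dots> = cdot (exponents d) (kvec d u) (kvec d v)"
    unfolding trinomial cdot_def
  proof (intro sum.cong refl, clarify)
    fix i j k
    let ?r = "fact d / (fact i * fact j * fact k) :: real"
    have "complex_of_real (sqrt ?r) * complex_of_real (sqrt ?r) = of_real ?r"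
      unfolding of_real_mult[symmetric] by simp
    then show "of_real ?r * (v $ 1 * cnj (u $ 1)) ^ i * (v $ 2 * cnj (u $ 2)) ^ j * (v $ 3 * cnj (u $ 3)) ^ k
       = kvec d u (i, j, k) * cnj (kvec d v (i, j, k))"
      unfolding kvec_def by (simp add: power_mult_distrib mult_ac del: of_real_divide)
  qed
  finally show ?thesis ..
qed

text \<open>The multinomial coefficient times the squared norm of the monomial equals 1 / dimension
  for every exponent. The normalisation is thus one global constant, which does not affect
  zeros.\<close>

lemma cdot_kvec:
  "cdot (exponents d) a (kvec d u) = form_eval d (form_of d a) u / of_real (sqrt (real ((d + 1) * (d + 2)) / 2))"
  unfolding cdot_def form_eval_def sum_divide_distrib
proof (intro sum.cong refl, clarify)
  fix i j k assume e: "(i, j, k) \<in> exponents d"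
  then have d: "d = i + j + k" by (simp add: exponents_def)
  define r :: real where "r = fact d / (fact i * fact j * fact k)"
  define n where "n = monomial_sqnorm (i, j, k)"
  define N :: real where "N = real ((d + 1) * (d + 2)) / 2"
  have pos: "n > 0" "N > 0" by (auto simp: n_def N_def monomial_sqnorm_def simp del: of_nat_mult)
  have n: "n = 2 * fact i * fact j * fact k / fact (d + 2)"
    by (simp add: n_def monomial_sqnorm_def d)
  have F: "(fact (d + 2) :: real) = (real d + 2) * ((real d + 1) * fact d)"
    by (simp add: algebra_simps)
  have "n = 1 / (r * N)"
    unfolding n F r_def N_def by (simp add: field_simps)
  then have "r = 1 / (n * N)"
    using pos by (simp add: field_simps)
  then have "sqrt r = 1 / (sqrt n * sqrt N)"
    by (simp add: real_sqrt_mult real_sqrt_divide)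
  then have eq: "complex_of_real (sqrt r) = 1 / (of_real (sqrt n) * of_real (sqrt N))"
    by simp
  have "a (i, j, k) * cnj (kvec d u (i, j, k)) = a (i, j, k) * of_real (sqrt r) * ((u $ 1) ^ i * (u $ 2) ^ j * (u $ 3) ^ k)"
    by (simp add: kvec_def r_def)
  also have "\<dots> = form_of d a (i, j, k) * (u $ 1) ^ i * (u $ 2) ^ j * (u $ 3) ^ k / of_real (sqrt N)"
    unfolding eq using e by (simp add: form_of_def n_def)
  finally show "a (i, j, k) * cnj (kvec d u (i, j, k))
     = form_of d a (i, j, k) * (u $ 1) ^ i * (u $ 2) ^ j * (u $ 3) ^ k / of_real (sqrt (real ((d + 1) * (d + 2)) / 2))"
    by (simp add: N_def)
qed

lemma measurable_form_of: "form_of d \<in> (\<Pi>\<^sub>M i\<in>exponents d. borel) \<rightarrow>\<^sub>M (\<Pi>\<^sub>M i\<in>exponents d. borel)"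
  unfolding form_of_def by (rule measurable_restrict) measurable

text \<open>In the orthonormal basis of normalised monomials the random form is a standard complex
  Gaussian vector, so probabilities can be computed for \<open>cgauss\<close>.\<close>

lemma form_gaussian_eq_distr:
  "form_gaussian d = distr (cgauss (exponents d)) (\<Pi>\<^sub>M i\<in>exponents d. borel) (form_of d)"
proof -
  let ?L = "\<Pi>\<^sub>M i\<in>exponents d. lborel :: complex measure"
  let ?B = "\<Pi>\<^sub>M i\<in>exponents d. borel :: complex measure"
  have sL: "sets ?L = sets ?B" by (rule sets_PiM_cong) auto
  have m: "form_of d \<in> ?L \<rightarrow>\<^sub>M ?B"
    using measurable_form_of by (simp cong: measurable_cong_sets add: sL)
  have c [measurable]: "(\<lambda>P. P i) \<in> borel_measurable ?B" if "i \<in> exponents d" for i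
    using that by simp
  have [measurable]: "cnj \<in> borel_measurable borel"
    by (intro borel_measurable_continuous_onI continuous_intros)
  have "(\<lambda>P. ennreal (exp (- form_sqnorm d P) / r)) \<in> borel_measurable ?B" for r
    unfolding form_sqnorm_def form_inner_def
    by (intro measurable_compose[OF _ measurable_ennreal] borel_measurable_divide borel_measurable_const
        measurable_compose[OF _ borel_measurable_exp] borel_measurable_uminus measurable_compose[OF _ borel_measurable_Re]
        borel_measurable_sum borel_measurable_times measurable_compose[OF c, of _ cnj]) auto
  then have g: "(\<lambda>P. ennreal (exp (- form_sqnorm d P) / pi ^ ((d + 1) * (d + 2) div 2))) \<in> borel_measurable ?B" .
  have "form_gaussian d = density (distr ?L ?B (form_of d)) (\<lambda>P. ennreal (exp (- form_sqnorm d P) / pi ^ ((d + 1) * (d + 2) div 2)))"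
    by (simp add: form_gaussian_def form_lebesgue_def form_of_def[abs_def])
  also have "\<dots> = distr (density ?L (\<lambda>a. ennreal (exp (- form_sqnorm d (form_of d a)) / pi ^ ((d + 1) * (d + 2) div 2)))) ?B (form_of d)"
    by (rule density_distr[OF g m])
  also have "(\<lambda>a. ennreal (exp (- form_sqnorm d (form_of d a)) / pi ^ ((d + 1) * (d + 2) div 2)))
      = (\<lambda>a. ennreal (cgauss_density (exponents d) a))"
    unfolding form_of_def form_sqnorm_normalised cgauss_density_def card_exponents ..
  finally show ?thesis by (simp add: cgauss_def)
qed

section \<open>Discrete Fourier analysis and polynomial restrictions\<close>

definition unity_root :: "nat \<Rightarrow> nat \<Rightarrow> complex" where
  "unity_root m s = exp (2 * of_real pi * \<i> * of_nat s / of_nat m)"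

lemma norm_unity_root [simp]: "cmod (unity_root m s) = 1"
  by (simp add: unity_root_def norm_exp_eq_Re)

lemma unity_root_orthogonal:
  assumes "a < m" "b < m"
  shows "(\<Sum>s<m. unity_root m s ^ a * cnj (unity_root m s) ^ b) = (if a = b then of_nat m else 0)"
proof -
  define z where "z = unity_root m a * cnj (unity_root m b)"
  have m: "m > 0" using assms by simp
  \<comment> \<open>Exchanging index and exponent turns the sum over \<open>s\<close> into a
    geometric sum with ratio \<open>z\<close>.\<close>
  have sw: "unity_root m s ^ c = unity_root m c ^ s" for s c
    by (simp add: unity_root_def exp_of_nat_mult[symmetric] mult_ac)
  have "(\<Sum>s<m. unity_root m s ^ a * cnj (unity_root m s) ^ b) = (\<Sum>s<m. z ^ s)"
    by (simp add: z_def power_mult_distrib sw complex_cnj_power[symmetric] del: complex_cnj_power)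
  also have "\<dots> = (if a = b then of_nat m else 0)"
  proof (cases "a = b")
    case True
    then have "z = 1" by (simp add: z_def complex_norm_square[symmetric])
    then show ?thesis using True by simp
  next
    case False
    have "unity_root m a \<noteq> unity_root m b"
      using complex_root_unity_eq[of m a b] m assms False by (simp add: unity_root_def)
    moreover have "unity_root m a = z * unity_root m b"
      by (simp add: z_def mult.assoc complex_norm_square[symmetric] mult.commute[of "cnj _"])
    ultimately have "z \<noteq> 1" by auto
    moreover have "unity_root m c ^ m = 1" for c
      using m by (simp add: unity_root_def exp_of_nat_mult[symmetric] mult_ac exp_eq_1)
    then have "z ^ m = 1"
      by (simp add: z_def power_mult_distrib complex_cnj_power[symmetric] del: complex_cnj_power)
    ultimately show ?thesis
      using False by (simp add: geometric_sum)
  qed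
  finally show ?thesis .
qed

text \<open>Discrete Cauchy formula on the circle of radius 2. There is no aliasing, because all
  exponents are below the number of nodes.\<close>

lemma interpolation:
  assumes f: "\<And>X. f X = (\<Sum>k<m. e k * X ^ k)" and k: "k < m"
  shows "e k = (\<Sum>s<m. f (2 * unity_root m s) * cnj (unity_root m s) ^ k / 2 ^ k) / of_nat m"
proof -
  have "(\<Sum>s<m. f (2 * unity_root m s) * cnj (unity_root m s) ^ k / 2 ^ k)
      = (\<Sum>s<m. \<Sum>i<m. e i * 2 ^ i / 2 ^ k * (unity_root m s ^ i * cnj (unity_root m s) ^ k))"
    unfolding f sum_distrib_right sum_divide_distrib
    by (intro sum.cong refl) (simp add: power_mult_distrib mult_ac)
  also have "\<dots> = (\<Sum>i<m. e i * 2 ^ i / 2 ^ k * (\<Sum>s<m. unity_root m s ^ i * cnj (unity_root m s) ^ k))"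
    by (subst sum.swap) (simp add: sum_distrib_left)
  also have "\<dots> = (\<Sum>i<m. if i = k then e k * of_nat m else 0)"
    by (intro sum.cong refl) (use k in \<open>simp add: unity_root_orthogonal\<close>)
  also have "\<dots> = e k * of_nat m" using k by simp
  finally show ?thesis using k by simp
qed

text \<open>The degree bound is what matters: it makes \<open>d + 1\<close> nodes per variable
  sufficient.\<close>

lemma form_eval_line:
  "\<exists>e. \<forall>X. form_eval d P (u + X *s v) = (\<Sum>k<Suc d. e k * X ^ k)"
proof -
  define p where "p = (\<Sum>(i, j, k)\<in>exponents d. smult (P (i, j, k))
      ([:u $ 1, v $ 1:] ^ i * [:u $ 2, v $ 2:] ^ j * [:u $ 3, v $ 3:] ^ k))"
  have p: "poly p X = form_eval d P (u + X *s v)" for X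
    unfolding p_def poly_sum form_eval_def
    by (intro sum.cong refl) (auto simp: mult_ac)
  have "degree p \<le> d"
    unfolding p_def
  proof (intro degree_sum_le finite_exponents, clarify)
    fix i j k assume "(i, j, k) \<in> exponents d"
    then have d: "d = i + j + k" by (simp add: exponents_def)
    have 1: "degree ([:a, b:] ^ n) \<le> n" for a b :: complex and n
      using degree_power_le[of "[:a, b:]" n] degree_pCons_le[of a "[:b:]"] by (simp split: if_splits)
    have "degree ([:u $ 1, v $ 1:] ^ i * [:u $ 2, v $ 2:] ^ j * [:u $ 3, v $ 3:] ^ k) \<le> i + j + k"
      by (intro order.trans[OF degree_mult_le] add_mono 1)
    then show "degree (smult (P (i, j, k)) ([:u $ 1, v $ 1:] ^ i * [:u $ 2, v $ 2:] ^ j * [:u $ 3, v $ 3:] ^ k)) \<le> d"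
      unfolding d using degree_smult_le order.trans by blast
  qed
  then have "poly p X = (\<Sum>k<Suc d. coeff p k * X ^ k)" for X
    unfolding poly_altdef lessThan_Suc_atMost
    by (intro sum.mono_neutral_left) (auto simp: coeff_eq_0)
  with p show ?thesis by metis
qed

section \<open>Local expansion in a chart\<close>

text \<open>A homogeneous lift of the chart, rescaled so that the bidisc becomes
  \<open>cmod X \<le> 1\<close>, \<open>cmod Y \<le> \<kappa>\<close> for every
  \<open>d\<close>.\<close>

definition local_point :: "nat \<Rightarrow> complex^3^3 \<Rightarrow> complex \<Rightarrow> complex \<Rightarrow> complex^3" where
  "local_point d A X Y = A *v vector [1, X / sqrt (6 * real d), Y / sqrt (6 * real d)]"

definition torus :: "nat \<Rightarrow> (nat \<times> nat) set" where
  "torus d = {..<Suc d} \<times> {..<Suc d}"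

text \<open>The radius 2 is larger than the polyradii of the rescaled bidisc; this gains
  \<open>1 / 2 ^ (k + l)\<close> in the Cauchy estimates, which is summable even with the weight
  \<open>l\<close>.\<close>

definition node :: "nat \<Rightarrow> nat \<Rightarrow> complex" where
  "node d s = 2 * unity_root (Suc d) s"

definition torus_kvec :: "nat \<Rightarrow> complex^3^3 \<Rightarrow> nat \<times> nat \<Rightarrow> nat \<times> nat \<times> nat \<Rightarrow> complex" where
  "torus_kvec d A x = kvec d (local_point d A (node d (fst x)) (node d (snd x)))"

text \<open>Discrete Cauchy formula on the torus of radius 2: pairing with this vector extracts the
  coefficient of \<open>X\<^sup>k Y\<^sup>l\<close> in the rescaled chart.\<close>

definition coeff_vec :: "nat \<Rightarrow> complex^3^3 \<Rightarrow> nat \<Rightarrow> nat \<Rightarrow> nat \<times> nat \<times> nat \<Rightarrow> complex" where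
  "coeff_vec d A k l i = (\<Sum>x\<in>torus d.
     unity_root (Suc d) (fst x) ^ k * unity_root (Suc d) (snd x) ^ l / (2 ^ (k + l) * of_nat (card (torus d)))
       * torus_kvec d A x i)"

abbreviation edot :: "nat \<Rightarrow> (nat \<times> nat \<times> nat \<Rightarrow> complex) \<Rightarrow> (nat \<times> nat \<times> nat \<Rightarrow> complex) \<Rightarrow> complex" where
  "edot d \<equiv> cdot (exponents d)"

lemma card_torus: "card (torus d) = Suc d * Suc d"
  by (simp add: torus_def card_cartesian_product)

lemma finite_torus [simp]: "finite (torus d)" and torus_nonempty [simp]: "torus d \<noteq> {}"
  by (auto simp: torus_def)

lemma norm_node [simp]: "cmod (node d s) = 2"
  by (simp add: node_def norm_mult)

lemma edot_coeff_vec: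
  "edot d a (coeff_vec d A k l) = (\<Sum>x\<in>torus d. edot d a (torus_kvec d A x)
     * cnj (unity_root (Suc d) (fst x)) ^ k * cnj (unity_root (Suc d) (snd x)) ^ l) / (2 ^ (k + l) * of_nat (card (torus d)))"
  unfolding coeff_vec_def cdot_sum_right cdot_scale_right
  by (simp add: sum_divide_distrib mult_ac)

lemma norm_edot_coeff_vec_le:
  "cmod (edot d a (coeff_vec d A k l)) \<le> ((\<Sum>x\<in>torus d. cmod (edot d a (torus_kvec d A x))) / card (torus d)) / 2 ^ (k + l)"
proof -
  have "cmod (\<Sum>x\<in>torus d. edot d a (torus_kvec d A x)
     * cnj (unity_root (Suc d) (fst x)) ^ k * cnj (unity_root (Suc d) (snd x)) ^ l)
     \<le> (\<Sum>x\<in>torus d. cmod (edot d a (torus_kvec d A x)))"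
    by (rule sum_norm_le) (simp add: norm_mult norm_power)
  then have "cmod (edot d a (coeff_vec d A k l)) \<le> (\<Sum>x\<in>torus d. cmod (edot d a (torus_kvec d A x))) / (2 ^ (k + l) * card (torus d))"
    unfolding edot_coeff_vec norm_divide norm_mult norm_power
    by (simp add: divide_right_mono)
  then show ?thesis by (simp add: mult.commute)
qed

lemma local_point_lines:
  "local_point d A X Y = local_point d A 0 Y + X *s (A *v vector [0, 1 / sqrt (6 * real d), 0])"
  "local_point d A X Y = local_point d A X 0 + Y *s (A *v vector [0, 0, 1 / sqrt (6 * real d)])"
  unfolding local_point_def
  by (simp_all add: vec_eq_iff matrix_vector_mult_def sum_3 algebra_simps)

text \<open>Interpolation in each variable separately, the other one being frozen. This is why the
  indices run over a square rather than over \<open>k + l \<le> d\<close>.\<close>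

lemma local_expansion:
  "edot d a (kvec d (local_point d A X Y)) = (\<Sum>k\<le>d. \<Sum>l\<le>d. edot d a (coeff_vec d A k l) * X ^ k * Y ^ l)"
proof -
  define q where "q X Y = edot d a (kvec d (local_point d A X Y))" for X Y
  define w where "w = unity_root (Suc d)"
  define c where "c = complex_of_real (sqrt (real ((d + 1) * (d + 2)) / 2))"
  have q: "q X Y = form_eval d (form_of d a) (local_point d A X Y) / c" for X Y
    by (simp add: q_def cdot_kvec c_def)
  have X: "q X Y = (\<Sum>k<Suc d. ((\<Sum>s<Suc d. q (2 * w s) Y * cnj (w s) ^ k / 2 ^ k) / of_nat (Suc d)) * X ^ k)" for X Y
  proof -
    obtain e where e: "\<And>X. form_eval d (form_of d a) (local_point d A X Y) = (\<Sum>k<Suc d. e k * X ^ k)"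
      using form_eval_line[of d "form_of d a" "local_point d A 0 Y"] local_point_lines(1) by metis
    have "q X Y = (\<Sum>k<Suc d. e k / c * X ^ k)" for X
      unfolding q e by (simp add: sum_divide_distrib del: sum.lessThan_Suc)
    note interpolation[OF this] this[of X]
    then show ?thesis unfolding w_def by (metis (no_types, lifting) lessThan_iff sum.cong)
  qed
  have Y: "q X Y = (\<Sum>l<Suc d. ((\<Sum>t<Suc d. q X (2 * w t) * cnj (w t) ^ l / 2 ^ l) / of_nat (Suc d)) * Y ^ l)" for X Y
  proof -
    obtain e where e: "\<And>Y. form_eval d (form_of d a) (local_point d A X Y) = (\<Sum>k<Suc d. e k * Y ^ k)"
      using form_eval_line[of d "form_of d a" "local_point d A X 0"] local_point_lines(2) by metis
    have "q X Y = (\<Sum>k<Suc d. e k / c * Y ^ k)" for Y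
      unfolding q e by (simp add: sum_divide_distrib del: sum.lessThan_Suc)
    note interpolation[OF this] this[of Y]
    then show ?thesis unfolding w_def by (metis (no_types, lifting) lessThan_iff sum.cong)
  qed
  have coef: "edot d a (coeff_vec d A k l) = (\<Sum>s<Suc d. \<Sum>t<Suc d. q (2 * w s) (2 * w t) * cnj (w s) ^ k * cnj (w t) ^ l)
      / (2 ^ (k + l) * of_nat (Suc d * Suc d))" for k l
    unfolding edot_coeff_vec card_torus
    unfolding torus_def q_def w_def torus_kvec_def node_def sum.cartesian_product split_def ..
  have "q X Y = (\<Sum>k<Suc d. ((\<Sum>s<Suc d. (\<Sum>l<Suc d. ((\<Sum>t<Suc d. q (2 * w s) (2 * w t) * cnj (w t) ^ l / 2 ^ l) / of_nat (Suc d)) * Y ^ l)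
       * cnj (w s) ^ k / 2 ^ k) / of_nat (Suc d)) * X ^ k)"
    by (subst X, subst Y) (rule refl)
  also have "\<dots> = (\<Sum>k<Suc d. \<Sum>l<Suc d. edot d a (coeff_vec d A k l) * X ^ k * Y ^ l)"
  proof (rule sum.cong[OF refl])
    fix k
    have "((\<Sum>s<Suc d. (\<Sum>l<Suc d. ((\<Sum>t<Suc d. q (2 * w s) (2 * w t) * cnj (w t) ^ l / 2 ^ l) / of_nat (Suc d)) * Y ^ l)
       * cnj (w s) ^ k / 2 ^ k) / of_nat (Suc d)) * X ^ k
       = (\<Sum>s<Suc d. \<Sum>l<Suc d. \<Sum>t<Suc d. q (2 * w s) (2 * w t) * cnj (w s) ^ k * cnj (w t) ^ l * X ^ k * Y ^ l
           / (2 ^ (k + l) * of_nat (Suc d * Suc d)))"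
      unfolding sum_divide_distrib sum_distrib_right
      by (intro sum.cong refl) (simp add: power_add field_simps del: of_nat_Suc mult_Suc mult_Suc_right)
    also have "\<dots> = (\<Sum>l<Suc d. \<Sum>s<Suc d. \<Sum>t<Suc d. q (2 * w s) (2 * w t) * cnj (w s) ^ k * cnj (w t) ^ l * X ^ k * Y ^ l
           / (2 ^ (k + l) * of_nat (Suc d * Suc d)))"
      by (rule sum.swap)
    also have "\<dots> = (\<Sum>l<Suc d. edot d a (coeff_vec d A k l) * X ^ k * Y ^ l)"
      unfolding coef sum_divide_distrib sum_distrib_right
      by (intro sum.cong refl) simp
    finally show "((\<Sum>s<Suc d. (\<Sum>l<Suc d. ((\<Sum>t<Suc d. q (2 * w s) (2 * w t) * cnj (w t) ^ l / 2 ^ l) / of_nat (Suc d)) * Y ^ l)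
       * cnj (w s) ^ k / 2 ^ k) / of_nat (Suc d)) * X ^ k = (\<Sum>l<Suc d. edot d a (coeff_vec d A k l) * X ^ k * Y ^ l)" .
  qed
  finally show ?thesis by (simp add: q_def lessThan_Suc_atMost)
qed

section \<open>Unitary invariance and the vector representing the coefficient of Y\<close>

lemma cinner3_unitary:
  assumes "unitary3 A"
  shows "cinner3 (A *v u) (A *v v) = cinner3 u v"
proof -
  have U: "(\<Sum>i\<in>UNIV. cnj (A $ i $ j) * A $ i $ k) = (if j = k then 1 else 0)" for j k
    using arg_cong[OF assms[unfolded unitary3_def], of "\<lambda>B. B $ j $ k"]
    by (simp add: matrix_matrix_mult_def mat_def)
  have "cinner3 (A *v u) (A *v v) = (\<Sum>i\<in>UNIV. (\<Sum>k\<in>UNIV. A $ i $ k * u $ k) * (\<Sum>j\<in>UNIV. cnj (A $ i $ j) * cnj (v $ j)))"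
    by (simp add: cinner3_def matrix_vector_mult_def)
  also have "\<dots> = (\<Sum>i\<in>UNIV. \<Sum>k\<in>UNIV. \<Sum>j\<in>UNIV. u $ k * cnj (v $ j) * (cnj (A $ i $ j) * A $ i $ k))"
    by (simp add: sum_product mult_ac)
  also have "\<dots> = (\<Sum>k\<in>UNIV. \<Sum>j\<in>UNIV. u $ k * cnj (v $ j) * (\<Sum>i\<in>UNIV. cnj (A $ i $ j) * A $ i $ k))"
    by (simp add: sum_3 algebra_simps)
  also have "\<dots> = cinner3 u v"
    by (simp add: U cinner3_def if_distrib[of "\<lambda>x. _ * x"] cong: if_cong)
  finally show ?thesis .
qed

lemma cinner3_local_point:
  assumes "unitary3 A"
  shows "cinner3 (local_point d A X Y) (local_point d A X' Y') = 1 + X * cnj X' / (6 * of_nat d) + Y * cnj Y' / (6 * of_nat d)"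
proof -
  have "complex_of_real (sqrt (6 * real d)) * complex_of_real (sqrt (6 * real d)) = 6 * of_nat d"
    unfolding of_real_mult[symmetric] by simp
  then show ?thesis
    unfolding local_point_def cinner3_unitary[OF assms]
    by (simp add: cinner3_def sum_3)
qed

text \<open>Orthogonality of characters selects one term of the binomial expansion;
  \<open>n < m\<close> excludes aliasing.\<close>

lemma average_unity_root_binomial:
  assumes "n < m" "j < m"
  shows "(\<Sum>s<m. unity_root m s ^ j * (\<alpha> + \<beta> * cnj (unity_root m s)) ^ n) = of_nat m * (of_nat (n choose j) * \<beta> ^ j * \<alpha> ^ (n - j))"
proof -
  have "(\<Sum>s<m. unity_root m s ^ j * (\<alpha> + \<beta> * cnj (unity_root m s)) ^ n)
     = (\<Sum>s<m. \<Sum>k\<le>n. of_nat (n choose k) * \<beta> ^ k * \<alpha> ^ (n - k) * (unity_root m s ^ j * cnj (unity_root m s) ^ k))"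
    by (simp add: add.commute[of \<alpha>] binomial_ring sum_distrib_left power_mult_distrib mult_ac)
  also have "\<dots> = (\<Sum>k\<le>n. of_nat (n choose k) * \<beta> ^ k * \<alpha> ^ (n - k) * (\<Sum>s<m. unity_root m s ^ j * cnj (unity_root m s) ^ k))"
    by (subst sum.swap) (simp add: sum_distrib_left)
  also have "\<dots> = (\<Sum>k\<le>n. if k = j then of_nat m * (of_nat (n choose j) * \<beta> ^ j * \<alpha> ^ (n - j)) else 0)"
    by (intro sum.cong refl) (use assms in \<open>simp add: unity_root_orthogonal\<close>)
  also have "\<dots> = of_nat m * (of_nat (n choose j) * \<beta> ^ j * \<alpha> ^ (n - j))"
    by simp
  finally show ?thesis .
qed

text \<open>In the d-th power of the kernel
  \<open>1 + X * cnj X' / (6 * d) + Y * cnj Y' / (6 * d)\<close>, the term free of X' and linear in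
  \<open>cnj Y'\<close> is \<open>d * Y / (6 * d)\<close>. The exponent 0 removes X', the exponent 1
  selects Y'.\<close>

lemma edot_coeff_vec_01_kvec:
  assumes A: "unitary3 A" and d: "d \<ge> 1"
  shows "edot d (coeff_vec d A 0 1) (kvec d (local_point d A X Y)) = Y / 6"
proof -
  let ?m = "Suc d"
  define w where "w = unity_root ?m"
  define \<alpha> \<beta> where "\<alpha> = X * 2 / (6 * of_nat d)" and "\<beta> = Y * 2 / (6 * complex_of_nat d)"
  have "edot d (coeff_vec d A 0 1) (kvec d (local_point d A X Y))
      = (\<Sum>x\<in>torus d. w (snd x) / (2 * of_nat (?m * ?m)) * (1 + \<alpha> * cnj (w (fst x)) + \<beta> * cnj (w (snd x))) ^ d)"
    unfolding coeff_vec_def cdot_sum_left cdot_scale_left torus_kvec_def cdot_kvec_kvec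
      cinner3_local_point[OF A] card_torus w_def node_def
    by (simp add: \<alpha>_def \<beta>_def mult_ac)
  also have "\<dots> = (\<Sum>t<?m. \<Sum>s<?m. w t / (2 * of_nat (?m * ?m)) * (1 + \<alpha> * cnj (w s) + \<beta> * cnj (w t)) ^ d)"
    unfolding torus_def by (subst sum.swap) (unfold sum.cartesian_product split_def, rule refl)
  also have "\<dots> = (\<Sum>t<?m. w t / (2 * of_nat (?m * ?m)) * (\<Sum>s<?m. w s ^ 0 * ((1 + \<beta> * cnj (w t)) + \<alpha> * cnj (w s)) ^ d))"
    by (simp add: sum_distrib_left add_ac del: sum.lessThan_Suc of_nat_Suc of_nat_mult)
  also have "\<dots> = (\<Sum>t<?m. w t / (2 * of_nat (?m * ?m)) * (of_nat ?m * (1 + \<beta> * cnj (w t)) ^ d))"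
    unfolding w_def by (subst average_unity_root_binomial) auto
  also have "\<dots> = (\<Sum>t<?m. w t ^ 1 * (1 + \<beta> * cnj (w t)) ^ d) / (2 * of_nat ?m)"
    unfolding sum_divide_distrib by (intro sum.cong refl) (simp add: field_simps del: of_nat_Suc mult_Suc mult_Suc_right)
  also have "\<dots> = of_nat d * \<beta> / 2"
    unfolding w_def using d by (subst average_unity_root_binomial) (auto simp del: of_nat_Suc)
  also have "\<dots> = Y / 6"
    using d by (simp add: \<beta>_def)
  finally show ?thesis .
qed

text \<open>The polynomial of this vector in its own chart is Y / 6, whose only nonzero coefficient
  is that of Y. Moving along it changes b and no other coefficient of the chart; its squared norm is
  1 / 6.\<close>

lemma edot_coeff_vec_01:
  assumes A: "unitary3 A" and d: "d \<ge> 1" and kl: "k \<le> d" "l \<le> d"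
  shows "edot d (coeff_vec d A 0 1) (coeff_vec d A k l) = (if k = 0 \<and> l = 1 then 1 / 6 else 0)"
proof -
  let ?m = "Suc d"
  define w where "w = unity_root ?m"
  have "edot d (coeff_vec d A 0 1) (coeff_vec d A k l)
     = (\<Sum>x\<in>torus d. (2 * w (snd x) / 6) * cnj (w (fst x)) ^ k * cnj (w (snd x)) ^ l) / (2 ^ (k + l) * of_nat (?m * ?m))"
    unfolding edot_coeff_vec[of _ _ _ k l] torus_kvec_def edot_coeff_vec_01_kvec[OF A d] card_torus node_def w_def ..
  also have "(\<Sum>x\<in>torus d. (2 * w (snd x) / 6) * cnj (w (fst x)) ^ k * cnj (w (snd x)) ^ l)
     = (1/3) * ((\<Sum>s<?m. w s ^ 0 * cnj (w s) ^ k) * (\<Sum>t<?m. w t ^ 1 * cnj (w t) ^ l))"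
    unfolding torus_def sum_product sum.cartesian_product by (simp add: sum_distrib_left split_def mult_ac)
  also have "\<dots> = (if k = 0 \<and> l = 1 then of_nat (?m * ?m) / 3 else 0)"
    unfolding w_def using kl d by (subst (1 2) unity_root_orthogonal) (auto simp: algebra_simps)
  moreover have "complex_of_nat (?m * ?m) \<noteq> 0"
    by (simp only: of_nat_eq_0_iff) simp
  ultimately show ?thesis by (auto simp del: of_nat_mult of_nat_Suc)
qed

section \<open>Size of the other coefficients and the contraction\<close>

definition other_indices :: "nat \<Rightarrow> (nat \<times> nat) set" where
  "other_indices d = {..d} \<times> {..d} - {(0, 1)}"

definition weighted_rest :: "nat \<Rightarrow> complex^3^3 \<Rightarrow> (nat \<Rightarrow> real) \<Rightarrow> (nat \<times> nat \<times> nat \<Rightarrow> complex) \<Rightarrow> real" where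
  "weighted_rest d A g a = (\<Sum>x\<in>other_indices d. g (snd x) * cmod (edot d a (coeff_vec d A (fst x) (snd x))))"

text \<open>With weight 1 the sum bounds the remainder on the bidisc, with weight \<open>l\<close>
  its Lipschitz constant in Y. The fixed point argument needs both bounds.\<close>

definition rest :: "nat \<Rightarrow> complex^3^3 \<Rightarrow> (nat \<times> nat \<times> nat \<Rightarrow> complex) \<Rightarrow> real" where
  "rest d A a = max (weighted_rest d A (\<lambda>_. 1) a) (weighted_rest d A real a)"

text \<open>The Cauchy estimates factor into a sum over \<open>k\<close> and a weighted sum over
  \<open>l\<close>, each at most 2; hence the factor 4.\<close>

lemma weighted_rest_le:
  assumes g: "\<And>l. g l \<ge> 0" "(\<Sum>l\<le>d. g l / 2 ^ l) \<le> 2"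
    and M: "(\<Sum>x\<in>torus d. cmod (edot d a (torus_kvec d A x))) / card (torus d) \<le> M"
  shows "weighted_rest d A g a \<le> 4 * M"
proof -
  have M0: "M \<ge> 0" by (rule order.trans[OF _ M]) (auto intro!: sum_nonneg divide_nonneg_nonneg)
  have "weighted_rest d A g a \<le> (\<Sum>x\<in>other_indices d. g (snd x) * (M / 2 ^ (fst x + snd x)))"
    unfolding weighted_rest_def
    by (intro sum_mono mult_left_mono g order.trans[OF norm_edot_coeff_vec_le] divide_right_mono M) auto
  also have "\<dots> \<le> (\<Sum>x\<in>{..d} \<times> {..d}. g (snd x) * (M / 2 ^ (fst x + snd x)))"
    using g M0 by (intro sum_mono2) (auto simp: other_indices_def)
  also have "\<dots> = M * ((\<Sum>k\<le>d. 1 / 2 ^ k) * (\<Sum>l\<le>d. g l / 2 ^ l))"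
    unfolding sum_product sum.cartesian_product by (simp add: sum_distrib_left split_def power_add mult_ac)
  also have "\<dots> \<le> M * (2 * 2)"
  proof (intro mult_left_mono mult_mono g M0)
    have "(\<Sum>k\<le>d. 1 / 2 ^ k) = 2 - 1 / (2 ^ d :: real)"
      by (induction d) (auto simp: field_simps)
    then show "(\<Sum>k\<le>d. 1 / 2 ^ k) \<le> (2 :: real)" by simp
  qed (auto intro!: sum_nonneg divide_nonneg_nonneg g)
  finally show ?thesis by simp
qed

lemma rest_le:
  assumes "(\<Sum>x\<in>torus d. cmod (edot d a (torus_kvec d A x))) / card (torus d) \<le> M"
  shows "rest d A a \<le> 4 * M"
  unfolding rest_def
proof (intro max.boundedI weighted_rest_le assms)
  have "(\<Sum>l\<le>d. 1 / 2 ^ l) = 2 - 1 / (2 ^ d :: real)"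
    by (induction d) (auto simp: field_simps)
  then show "(\<Sum>l\<le>d. 1 / 2 ^ l) \<le> (2 :: real)" by simp
  have "(\<Sum>l\<le>d. real l / 2 ^ l) = 2 - (real d + 2) / 2 ^ d"
    by (induction d) (auto simp: field_simps)
  then show "(\<Sum>l\<le>d. real l / 2 ^ l) \<le> 2" by simp
qed auto

lemma weighted_rest_triangle:
  assumes "\<And>l. g l \<ge> 0" "\<And>v. edot d a v = edot d b v + edot d c v"
  shows "weighted_rest d A g a \<le> weighted_rest d A g b + weighted_rest d A g c"
  unfolding weighted_rest_def sum.distrib[symmetric] assms(2) distrib_left[symmetric]
  by (intro sum_mono mult_left_mono assms norm_triangle_ineq)

lemma rest_triangle:
  assumes "\<And>v. edot d a v = edot d b v + edot d c v"
  shows "rest d A a \<le> rest d A b + rest d A c"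
  unfolding rest_def
proof (rule max.boundedI)
  show "weighted_rest d A (\<lambda>_. 1) a \<le> max (weighted_rest d A (\<lambda>_. 1) b) (weighted_rest d A real b)
      + max (weighted_rest d A (\<lambda>_. 1) c) (weighted_rest d A real c)"
    by (rule order.trans[OF weighted_rest_triangle[OF _ assms]]) (auto intro!: add_mono)
  show "weighted_rest d A real a \<le> max (weighted_rest d A (\<lambda>_. 1) b) (weighted_rest d A real b)
      + max (weighted_rest d A (\<lambda>_. 1) c) (weighted_rest d A real c)"
    by (rule order.trans[OF weighted_rest_triangle[OF _ assms]]) (auto intro!: add_mono)
qed

lemma rest_scale: "rest d A (\<lambda>i. c * v i) = cmod c * rest d A v"
  unfolding rest_def weighted_rest_def cdot_scale_left
  by (simp add: norm_mult max_mult_distrib_left sum_distrib_left mult_ac)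

lemma rest_translate:
  "\<bar>rest d A (translate (exponents d) h a) - rest d A a\<bar> \<le> rest d A h"
proof -
  have "rest d A (translate (exponents d) h a) \<le> rest d A a + rest d A h"
    by (rule rest_triangle) (rule cdot_translate)
  moreover have "rest d A a \<le> rest d A (translate (exponents d) h a) + rest d A (\<lambda>i. - 1 * h i)"
    by (rule rest_triangle) (unfold cdot_translate cdot_scale_left, simp)
  ultimately show ?thesis
    unfolding rest_scale by simp
qed

lemma measurable_rest [measurable]: "rest d A \<in> borel_measurable (cgauss (exponents d))"
  unfolding rest_def[abs_def] weighted_rest_def by measurable

text \<open>For fixed \<open>X\<close>, the equation is the fixed point equation of the contraction
  \<open>Y \<mapsto> - (the terms other than b Y) / b\<close>.\<close>

lemma unique_root:
  assumes d: "d \<ge> 1" and \<kappa>: "0 < \<kappa>" "\<kappa> \<le> 1" and X: "cmod X \<le> 1"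
    and dom: "rest d A a < \<kappa> * cmod (edot d a (coeff_vec d A 0 1))"
  shows "\<exists>Y. cmod Y < \<kappa> \<and> (\<forall>Z. cmod Z \<le> \<kappa> \<longrightarrow>
     (edot d a (kvec d (local_point d A X Z)) = 0 \<longleftrightarrow> Z = Y))"
proof -
  define b where "b = edot d a (coeff_vec d A 0 1)"
  define R where "R = rest d A a"
  define c where "c x = edot d a (coeff_vec d A (fst x) (snd x)) * X ^ fst x" for x
  define r where "r Y = (\<Sum>x\<in>other_indices d. c x * Y ^ snd x)" for Y
  have c: "cmod (c x) \<le> cmod (edot d a (coeff_vec d A (fst x) (snd x)))" for x
    using X by (auto simp: c_def norm_mult norm_power intro!: mult_right_le_one_le power_le_one)
  have R0: "R \<ge> 0"
    unfolding R_def rest_def by (intro max.coboundedI1) (auto simp: weighted_rest_def intro!: sum_nonneg)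
  then have b: "R < \<kappa> * cmod b" "cmod b > 0" "R < cmod b"
    using dom \<kappa> mult_right_le_one_le[of "cmod b" \<kappa>]
    by (auto simp: b_def R_def mult.commute zero_less_mult_iff)
  have q: "edot d a (kvec d (local_point d A X Y)) = b * Y + r Y" for Y
  proof -
    have "edot d a (kvec d (local_point d A X Y)) = (\<Sum>x\<in>{..d} \<times> {..d}. c x * Y ^ snd x)"
      unfolding local_expansion sum.cartesian_product by (simp add: c_def split_def)
    also have "\<dots> = c (0, 1) * Y + r Y"
      using d by (subst sum.remove[of _ "(0, 1)"]) (auto simp: r_def other_indices_def)
    finally show ?thesis by (simp add: c_def b_def)
  qed
  have r_le: "cmod (r Y) \<le> R" if "cmod Y \<le> \<kappa>" for Y
  proof -
    have "cmod (r Y) \<le> (\<Sum>x\<in>other_indices d. 1 * cmod (edot d a (coeff_vec d A (fst x) (snd x))))"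
      unfolding r_def
    proof (rule sum_norm_le)
      fix x
      have "cmod (c x * Y ^ snd x) \<le> cmod (c x) * 1"
        unfolding norm_mult norm_power using that \<kappa> by (intro mult_left_mono power_le_one) auto
      then show "cmod (c x * Y ^ snd x) \<le> 1 * cmod (edot d a (coeff_vec d A (fst x) (snd x)))"
        using c[of x] by simp
    qed
    also have "\<dots> \<le> R"
      by (auto simp: R_def rest_def weighted_rest_def)
    finally show ?thesis .
  qed
  have pow: "cmod (Y ^ l - Z ^ l) \<le> l * cmod (Y - Z)" if "cmod Y \<le> 1" "cmod Z \<le> 1" for Y Z :: complex and l
    using norm_power_diff[OF that] by simp
  have r_lip: "cmod (r Y - r Z) \<le> R * cmod (Y - Z)" if "cmod Y \<le> \<kappa>" "cmod Z \<le> \<kappa>" for Y Z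
  proof -
    have "r Y - r Z = (\<Sum>x\<in>other_indices d. c x * (Y ^ snd x - Z ^ snd x))"
      by (simp add: r_def sum_subtractf right_diff_distrib)
    also have "cmod \<dots> \<le> (\<Sum>x\<in>other_indices d. (real (snd x) * cmod (edot d a (coeff_vec d A (fst x) (snd x)))) * cmod (Y - Z))"
    proof (rule sum_norm_le)
      fix x
      have "cmod (c x * (Y ^ snd x - Z ^ snd x)) \<le> cmod (edot d a (coeff_vec d A (fst x) (snd x))) * (real (snd x) * cmod (Y - Z))"
        unfolding norm_mult using that \<kappa> by (intro mult_mono c pow) auto
      then show "cmod (c x * (Y ^ snd x - Z ^ snd x)) \<le> (real (snd x) * cmod (edot d a (coeff_vec d A (fst x) (snd x)))) * cmod (Y - Z)"
        by (simp add: mult_ac)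
    qed
    also have "\<dots> = weighted_rest d A real a * cmod (Y - Z)"
      by (simp add: weighted_rest_def sum_distrib_right)
    also have "\<dots> \<le> R * cmod (Y - Z)"
      by (intro mult_right_mono) (auto simp: R_def rest_def)
    finally show ?thesis .
  qed
  \<comment> \<open>\<open>R < \<kappa> * cmod b\<close> sends the closed disc of radius \<kappa>
    into its interior, and \<open>R < cmod b\<close> makes the map a strict contraction.\<close>
  define f where "f Y = - r Y / b" for Y
  have f_lt: "cmod (f Y) < \<kappa>" if "cmod Y \<le> \<kappa>" for Y
    using r_le[OF that] b by (simp add: f_def norm_divide divide_less_eq)
  have "\<exists>!Y. Y \<in> cball 0 \<kappa> \<and> f Y = Y"
  proof (rule Banach_fix[where c = "R / cmod b"])
    show "R / cmod b < 1" "0 \<le> R / cmod b" using b R0 by auto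
    show "f ` cball 0 \<kappa> \<subseteq> cball 0 \<kappa>" using f_lt by (auto simp: less_imp_le)
    show "dist (f Y) (f Z) \<le> R / cmod b * dist Y Z" if "Y \<in> cball 0 \<kappa>" "Z \<in> cball 0 \<kappa>" for Y Z
    proof -
      have "f Y - f Z = - (r Y - r Z) / b" by (simp add: f_def diff_divide_distrib)
      then have "dist (f Y) (f Z) = cmod (r Y - r Z) / cmod b"
        by (simp add: dist_norm norm_divide norm_minus_commute)
      also have "\<dots> \<le> R * cmod (Y - Z) / cmod b"
        using that by (intro divide_right_mono r_lip) auto
      finally show ?thesis by (simp add: dist_norm)
    qed
  qed (use \<kappa> in \<open>auto simp: complete_eq_closed\<close>)
  then obtain Y where Y': "Y \<in> cball 0 \<kappa> \<and> f Y = Y" and uniq': "\<forall>Z. Z \<in> cball 0 \<kappa> \<and> f Z = Z \<longrightarrow> Z = Y"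
    by (rule ex1E)
  from Y' have Y: "cmod Y \<le> \<kappa>" "f Y = Y" by simp_all
  have uniq: "Z = Y" if "cmod Z \<le> \<kappa>" "f Z = Z" for Z
    using uniq'[rule_format, of Z] that by simp
  have root: "b * Z + r Z = 0 \<longleftrightarrow> f Z = Z" for Z
  proof -
    have "f Z = Z \<longleftrightarrow> - r Z = Z * b"
      unfolding f_def using b(2) by (subst nonzero_divide_eq_eq) auto
    also have "\<dots> \<longleftrightarrow> Z * b + r Z = 0"
      using eq_neg_iff_add_eq_0[of "Z * b" "r Z"] by (simp only: eq_commute[of "Z * b"])
    finally show ?thesis by (simp only: mult.commute)
  qed
  show ?thesis
    using Y f_lt[OF Y(1)] unfolding q root by (intro exI[of _ Y] conjI allI impI iffI uniq) simp_all
qed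

section \<open>The submanifold chart condition\<close>

lemma cinner3_self: "cinner3 u u = of_real ((norm u)\<^sup>2)"
  by (simp add: cinner3_def norm_vec_def L2_set_def sum_nonneg complex_norm_square[symmetric])

lemma unitary3_mult_eq_0_iff:
  assumes "unitary3 A"
  shows "A *v u = 0 \<longleftrightarrow> u = 0"
proof -
  have "norm (A *v u) = norm u"
    using cinner3_unitary[OF assms, of u u] unfolding cinner3_self of_real_eq_iff by simp
  then show ?thesis by (metis norm_eq_zero)
qed

lemma cp2_cases:
  obtains u where "u \<noteq> 0" "p = proj u"
proof (induction p rule: cp2.abs_induct)
  case (1 u)
  then show ?case by (auto simp: proj_def proportional_def)
qed

lemma form_eval_scale: "form_eval d P (c *s u) = c ^ d * form_eval d P u"
  unfolding form_eval_def sum_distrib_left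
proof (intro sum.cong refl, clarify)
  fix i j k assume "(i, j, k) \<in> exponents d"
  then have "d = i + j + k" by (simp add: exponents_def)
  then show "P (i, j, k) * (c *s u) $ 1 ^ i * (c *s u) $ 2 ^ j * (c *s u) $ 3 ^ k
      = c ^ d * (P (i, j, k) * u $ 1 ^ i * u $ 2 ^ j * u $ 3 ^ k)"
    by (simp add: power_mult_distrib power_add mult_ac)
qed

lemma proj_in_plane_curve_iff:
  assumes "u \<noteq> 0"
  shows "proj u \<in> plane_curve d P \<longleftrightarrow> form_eval d P u = 0"
proof
  assume "proj u \<in> plane_curve d P"
  then obtain v where v: "v \<noteq> 0" "proj u = proj v" "form_eval d P v = 0"
    by (auto simp: plane_curve_def)
  then obtain c where "c \<noteq> 0" "v = c *s u"
    using proj_eq_iff[OF assms v(1)] by auto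
  with v(3) show "form_eval d P u = 0" by (simp add: form_eval_scale)
qed (use assms in \<open>auto simp: plane_curve_def\<close>)

lemma vector_1_nonzero [simp]: "(vector [1, x, y] :: complex^3) \<noteq> 0"
  by (metis vector_3(1) zero_index zero_neq_one)

lemma inj_affine_chart: "inj affine_chart"
proof (rule injI)
  fix z w assume "affine_chart z = affine_chart w"
  then obtain c where c: "vector [1, fst w, snd w] = c *s (vector [1, fst z, snd z] :: complex^3)"
    by (auto simp: affine_chart_def proj_eq_iff)
  from arg_cong[OF c, of "\<lambda>v. v $ 1"] have "c = 1" by simp
  with arg_cong[OF c, of "\<lambda>v. v $ 2"] arg_cong[OF c, of "\<lambda>v. v $ 3"] show "z = w"
    by (simp add: prod_eq_iff)
qed

lemma inj_projectivity:
  assumes A: "unitary3 A" and \<psi>: "\<And>u. u \<noteq> 0 \<Longrightarrow> \<psi> (proj u) = proj (A *v u)"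
  shows "inj \<psi>"
proof (rule injI)
  fix p q assume eq: "\<psi> p = \<psi> q"
  obtain u v where u: "u \<noteq> 0" "p = proj u" and v: "v \<noteq> 0" "q = proj v"
    by (metis cp2_cases)
  have "proj (A *v u) = proj (A *v v)" using eq u v \<psi> by simp
  then obtain c where c: "c \<noteq> 0" "A *v v = c *s (A *v u)"
    using proj_eq_iff[of "A *v u" "A *v v"] unitary3_mult_eq_0_iff[OF A] u v by auto
  then have "A *v (v - c *s u) = 0"
    by (simp add: matrix_vector_mult_diff_distrib vector_scalar_commute[symmetric])
  then have "v = c *s u"
    using unitary3_mult_eq_0_iff[OF A] by simp
  then show "p = q" using u v c(1) proj_eq_iff by auto
qed

text \<open>Both \<psi> and \<open>affine_chart\<close> are injective, so the condition can be read
  in affine coordinates: over each point of the first disc there is exactly one zero in the closed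
  second disc, and it is interior. Rescaling then removes \<open>sqrt (6 * d)\<close>.\<close>

lemma submanifold_chart_iff:
  assumes A: "unitary3 A" and \<psi>: "\<And>u. u \<noteq> 0 \<Longrightarrow> \<psi> (proj u) = proj (A *v u)"
    and d: "d \<ge> 1" and \<kappa>: "\<kappa> > 0"
  shows "submanifold_chart d \<kappa> \<psi> P \<longleftrightarrow>
     (\<forall>X. cmod X \<le> 1 \<longrightarrow> (\<exists>Y. cmod Y < \<kappa> \<and> (\<forall>Z. cmod Z \<le> \<kappa> \<longrightarrow> (form_eval d P (local_point d A X Z) = 0 \<longleftrightarrow> Z = Y))))"
    (is "_ \<longleftrightarrow> ?R")
proof -
  define s where "s = sqrt (6 * real d)"
  have s: "s > 0" using d by (simp add: s_def)
  define ev where "ev x y = form_eval d P (A *v vector [1, x, y])" for x y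
  have aff: "\<psi> (affine_chart z) = proj (A *v vector [1, fst z, snd z])" for z
    by (simp add: affine_chart_def \<psi>)
  have curve: "\<psi> (affine_chart z) \<in> plane_curve d P \<longleftrightarrow> ev (fst z) (snd z) = 0" for z
    unfolding aff ev_def by (rule proj_in_plane_curve_iff) (simp add: unitary3_mult_eq_0_iff[OF A])
  have pre: "\<psi> -` (plane_curve d P \<inter> FS_chart d \<kappa> \<psi>) = affine_chart ` {z \<in> bidisc d \<kappa>. ev (fst z) (snd z) = 0}"
  proof (intro set_eqI iffI)
    fix p assume "p \<in> \<psi> -` (plane_curve d P \<inter> FS_chart d \<kappa> \<psi>)"
    then obtain z where z: "\<psi> p \<in> plane_curve d P" "z \<in> bidisc d \<kappa>" "\<psi> p = \<psi> (affine_chart z)"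
      by (auto simp: FS_chart_def)
    then have "p = affine_chart z"
      using inj_projectivity[of A \<psi>, OF A \<psi>] by (auto simp: inj_def)
    with z curve show "p \<in> affine_chart ` {z \<in> bidisc d \<kappa>. ev (fst z) (snd z) = 0}" by auto
  qed (use curve in \<open>auto simp: FS_chart_def\<close>)
  have "submanifold_chart d \<kappa> \<psi> P \<longleftrightarrow>
     (\<exists>f \<in> cball 0 (1 / s) \<rightarrow> ball 0 (\<kappa> / s). {z \<in> bidisc d \<kappa>. ev (fst z) (snd z) = 0} = {(x, f x) | x. x \<in> cball 0 (1 / s)})"
    unfolding submanifold_chart_def pre inj_image_eq_iff[OF inj_affine_chart] s_def ..
  also have "\<dots> \<longleftrightarrow> (\<forall>x. cmod x \<le> 1 / s \<longrightarrow> (\<exists>y. cmod y < \<kappa> / s \<and> (\<forall>z. cmod z \<le> \<kappa> / s \<longrightarrow> (ev x z = 0 \<longleftrightarrow> z = y))))"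
    (is "?L \<longleftrightarrow> ?M")
  proof
    assume ?L
    then obtain f where f0: "f \<in> cball 0 (1 / s) \<rightarrow> ball 0 (\<kappa> / s)"
      and eq: "{z \<in> bidisc d \<kappa>. ev (fst z) (snd z) = 0} = {(x, f x) | x. x \<in> cball 0 (1 / s)}"
      by (rule bexE)
    have f: "cmod (f x) < \<kappa> / s" if "cmod x \<le> 1 / s" for x
      using funcset_mem[OF f0, of x] that by simp
    show ?M
    proof (intro allI impI exI conjI)
      fix x z assume x: "cmod x \<le> 1 / s"
      then show "cmod (f x) < \<kappa> / s" by (rule f)
      assume z: "cmod z \<le> \<kappa> / s"
      have "(x, z) \<in> {z \<in> bidisc d \<kappa>. ev (fst z) (snd z) = 0} \<longleftrightarrow> z = f x"
        unfolding eq using x by auto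
      then show "ev x z = 0 \<longleftrightarrow> z = f x"
        using x z by (simp add: bidisc_def s_def)
    qed
  next
    assume ?M
    then obtain f where f: "\<And>x. cmod x \<le> 1 / s \<Longrightarrow> cmod (f x) < \<kappa> / s"
        "\<And>x z. cmod x \<le> 1 / s \<Longrightarrow> cmod z \<le> \<kappa> / s \<Longrightarrow> ev x z = 0 \<longleftrightarrow> z = f x"
      by metis
    show ?L
    proof (rule bexI[of _ f])
      show "{z \<in> bidisc d \<kappa>. ev (fst z) (snd z) = 0} = {(x, f x) | x. x \<in> cball 0 (1 / s)}"
        using f(2) f(1)[THEN less_imp_le] by (auto simp: bidisc_def s_def[symmetric])
    qed (use f in auto)
  qed
  also have "\<dots> \<longleftrightarrow> ?R"
  proof -
    have ev: "form_eval d P (local_point d A X Z) = ev (X / of_real s) (Z / of_real s)" for X Z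
      by (simp add: ev_def local_point_def s_def)
    have le: "cmod (X / of_real s) \<le> r / s \<longleftrightarrow> cmod X \<le> r" "cmod (X / of_real s) < r / s \<longleftrightarrow> cmod X < r" for X :: complex and r
      using s by (simp_all add: norm_divide divide_le_cancel divide_less_cancel)
    have sc: "\<exists>X. x = X / complex_of_real s" for x
      using s by (intro exI[of _ "x * of_real s"]) simp
    have all: "(\<forall>x. Q x) \<longleftrightarrow> (\<forall>X. Q (X / complex_of_real s))" "(\<exists>x. Q x) \<longleftrightarrow> (\<exists>X. Q (X / complex_of_real s))" for Q
      using sc by metis+
    have inj: "Z / complex_of_real s = Y / complex_of_real s \<longleftrightarrow> Z = Y" for Z Y
      using s by simp
    have "(\<exists>y. cmod y < \<kappa> / s \<and> (\<forall>z. cmod z \<le> \<kappa> / s \<longrightarrow> (ev x z = 0 \<longleftrightarrow> z = y)))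
       \<longleftrightarrow> (\<exists>Y. cmod Y < \<kappa> \<and> (\<forall>Z. cmod Z \<le> \<kappa> \<longrightarrow> (ev x (Z / of_real s) = 0 \<longleftrightarrow> Z = Y)))" for x
      by (subst all(2), subst all(1)) (simp only: le inj)
    then have "?M \<longleftrightarrow> (\<forall>x. cmod x \<le> 1 / s \<longrightarrow>
        (\<exists>Y. cmod Y < \<kappa> \<and> (\<forall>Z. cmod Z \<le> \<kappa> \<longrightarrow> (ev x (Z / of_real s) = 0 \<longleftrightarrow> Z = Y))))"
      by (simp only:)
    also have "\<dots> \<longleftrightarrow> ?R"
      unfolding ev by (subst all(1)) (simp only: le)
    finally show ?thesis .
  qed
  finally show ?thesis .
qed

text \<open>On a compact set, a continuous function with arbitrarily small absolute values has a
  zero, and by continuity small values can be sought in a countable dense subset. This makes the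
  existential countable.\<close>

lemma sets_exists_zero_compact:
  fixes h :: "'p \<Rightarrow> 'a :: euclidean_space \<Rightarrow> real"
  assumes K: "compact K" and cont: "\<And>P. P \<in> space M \<Longrightarrow> continuous_on K (h P)"
    and meas: "\<And>x. x \<in> K \<Longrightarrow> (\<lambda>P. h P x) \<in> borel_measurable M"
  shows "{P \<in> space M. \<exists>x\<in>K. h P x = 0} \<in> sets M"
proof -
  obtain D where D: "countable D" "D \<subseteq> K" "K \<subseteq> closure D" by (rule separable)
  have "{P \<in> space M. \<exists>x\<in>K. h P x = 0} = {P \<in> space M. \<forall>n::nat. \<exists>x\<in>D. \<bar>h P x\<bar> < inverse (Suc n)}"
  proof (intro Collect_cong conj_cong refl iffI)
    fix P assume P: "P \<in> space M" and "\<exists>x\<in>K. h P x = 0"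
    then obtain x where x: "x \<in> K" "h P x = 0" by auto
    show "\<forall>n::nat. \<exists>x\<in>D. \<bar>h P x\<bar> < inverse (Suc n)"
    proof
      fix n :: nat
      obtain e where e: "e > 0" "\<And>y. y \<in> K \<Longrightarrow> dist y x < e \<Longrightarrow> dist (h P y) (h P x) < inverse (Suc n)"
        using cont[OF P] x(1) unfolding continuous_on_iff by (metis inverse_positive_iff_positive of_nat_0_less_iff zero_less_Suc)
      obtain y where "y \<in> D" "dist y x < e"
        using x(1) D(3) e(1) closure_approachable by blast
      then show "\<exists>x\<in>D. \<bar>h P x\<bar> < inverse (Suc n)"
        using e(2)[of y] D(2) x(2) by (auto simp: dist_real_def)
    qed
  next
    fix P assume P: "P \<in> space M" and *: "\<forall>n::nat. \<exists>x\<in>D. \<bar>h P x\<bar> < inverse (Suc n)"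
    have "K \<noteq> {}" using * D(2) by auto
    moreover have "continuous_on K (\<lambda>x. \<bar>h P x\<bar>)" using cont[OF P] by (intro continuous_intros)
    ultimately obtain x where x: "x \<in> K" "\<And>y. y \<in> K \<Longrightarrow> \<bar>h P x\<bar> \<le> \<bar>h P y\<bar>"
      using continuous_attains_inf[OF K] by metis
    have "h P x = 0"
    proof (rule ccontr)
      assume "h P x \<noteq> 0"
      then obtain n where "inverse (Suc n) < \<bar>h P x\<bar>" using reals_Archimedean[of "\<bar>h P x\<bar>"] by auto
      then show False using * x(2) D(2) by (metis order.strict_trans1 not_less_iff_gr_or_eq subsetD)
    qed
    with x show "\<exists>x\<in>K. h P x = 0" by auto
  qed
  also have "\<dots> \<in> sets M"
  proof -
    have "{P \<in> space M. \<bar>h P x\<bar> < inverse (Suc n)} \<in> sets M" if "x \<in> D" for x and n :: nat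
    proof -
      have "(\<lambda>P. \<bar>h P x\<bar>) \<in> borel_measurable M"
        using meas[of x] that D(2) by (intro borel_measurable_abs) auto
      then show ?thesis by measurable
    qed
    then show ?thesis
      using D(1) by (intro sets.sets_Collect_countable_All sets.sets_Collect_countable_Bex) auto
  qed
  finally show ?thesis .
qed

text \<open>The condition splits into three parts: no root on the boundary circle, existence of a root for
  \<open>X\<close> in a dense set, and no two roots at distance at least \<open>1 / (n + 1)\<close>, for each \<open>n\<close>.\<close>

lemma sets_unique_root:
  fixes g :: "'p \<Rightarrow> complex \<Rightarrow> complex \<Rightarrow> complex"
  assumes meas [measurable]: "\<And>X Y. (\<lambda>P. g P X Y) \<in> borel_measurable M"
    and cont: "\<And>P. P \<in> space M \<Longrightarrow> continuous_on UNIV (\<lambda>z. g P (fst z) (snd z))"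
    and \<kappa>: "\<kappa> > 0"
  shows "{P \<in> space M. \<forall>X. cmod X \<le> 1 \<longrightarrow> (\<exists>Y. cmod Y < \<kappa> \<and> (\<forall>Z. cmod Z \<le> \<kappa> \<longrightarrow> (g P X Z = 0 \<longleftrightarrow> Z = Y)))} \<in> sets M"
proof -
  have cont': "continuous_on S (\<lambda>x. g P (u x) (v x))" if "P \<in> space M" "continuous_on S u" "continuous_on S v"
    for P and S :: "'c :: topological_space set" and u v
    using continuous_on_compose2[OF cont[OF that(1)], of S "\<lambda>x. (u x, v x)"] that by (simp add: continuous_on_Pair)
  obtain D where D: "countable D" "D \<subseteq> cball (0::complex) 1" "cball 0 1 \<subseteq> closure D" by (rule separable)
  define bd where "bd P \<longleftrightarrow> (\<exists>z\<in>cball 0 1 \<times> sphere 0 \<kappa>. cmod (g P (fst z) (snd z)) = 0)" for P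
  define ex where "ex P X \<longleftrightarrow> (\<exists>Y\<in>cball 0 \<kappa>. cmod (g P X Y) = 0)" for P X
  \<comment> \<open>The closed condition keeps pairs of roots away from the diagonal, so the set
    stays compact; two distinct roots are detected by some \<open>n\<close>.\<close>
  define K where "K n = (cball 0 1 \<times> cball 0 \<kappa> \<times> cball 0 \<kappa>) \<inter> {z :: complex \<times> complex \<times> complex. inverse (real (Suc n)) \<le> cmod (fst (snd z) - snd (snd z))}" for n
  define two where "two P n \<longleftrightarrow> (\<exists>z\<in>K n. cmod (g P (fst z) (fst (snd z))) + cmod (g P (fst z) (snd (snd z))) = 0)" for P n
  have K: "compact (K n)" for n
    unfolding K_def
    by (intro compact_Int_closed compact_Times compact_cball closed_Collect_le continuous_intros)
  have mbd: "{P \<in> space M. bd P} \<in> sets M"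
    unfolding bd_def
    by (rule sets_exists_zero_compact) (auto intro!: compact_Times continuous_intros cont')
  have mex: "{P \<in> space M. ex P X} \<in> sets M" for X
    unfolding ex_def
    by (rule sets_exists_zero_compact) (auto intro!: continuous_intros cont')
  have mtwo: "{P \<in> space M. two P n} \<in> sets M" for n
    unfolding two_def
    by (rule sets_exists_zero_compact[OF K]) (auto intro!: continuous_intros cont')
  have "{P \<in> space M. \<forall>X. cmod X \<le> 1 \<longrightarrow> (\<exists>Y. cmod Y < \<kappa> \<and> (\<forall>Z. cmod Z \<le> \<kappa> \<longrightarrow> (g P X Z = 0 \<longleftrightarrow> Z = Y)))}
      = {P \<in> space M. \<not> bd P \<and> (\<forall>X\<in>D. ex P X) \<and> (\<forall>n. \<not> two P n)}"
  proof (intro Collect_cong conj_cong refl iffI)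
    fix P assume P: "P \<in> space M"
      and *: "\<forall>X. cmod X \<le> 1 \<longrightarrow> (\<exists>Y. cmod Y < \<kappa> \<and> (\<forall>Z. cmod Z \<le> \<kappa> \<longrightarrow> (g P X Z = 0 \<longleftrightarrow> Z = Y)))"
    show "\<not> bd P \<and> (\<forall>X\<in>D. ex P X) \<and> (\<forall>n. \<not> two P n)"
    proof (intro conjI ballI allI)
      show "\<not> bd P"
      proof
        assume "bd P"
        then obtain X Z where "cmod X \<le> 1" "cmod Z = \<kappa>" "g P X Z = 0" by (auto simp: bd_def)
        with * show False by fastforce
      qed
      show "ex P X" if "X \<in> D" for X
        using * D(2) that unfolding ex_def by (metis less_imp_le mem_cball_0 norm_zero subsetD)
      show "\<not> two P n" for n
      proof
        assume "two P n"
        then obtain X Y Z where "cmod X \<le> 1" "cmod Y \<le> \<kappa>" "cmod Z \<le> \<kappa>" "inverse (real (Suc n)) \<le> cmod (Y - Z)"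
            "g P X Y = 0" "g P X Z = 0"
          unfolding two_def K_def by (auto simp: add_nonneg_eq_0_iff)
        moreover then have "Y = Z" using * by metis
        ultimately show False by simp
      qed
    qed
  next
    fix P assume P: "P \<in> space M" and *: "\<not> bd P \<and> (\<forall>X\<in>D. ex P X) \<and> (\<forall>n. \<not> two P n)"
    \<comment> \<open>The values X that have a root form the projection of a compact set, hence a
      closed set; roots over the dense set \<open>D\<close> therefore give roots over the whole
      disc.\<close>
    let ?Z = "{z \<in> cball 0 1 \<times> cball 0 \<kappa>. g P (fst z) (snd z) = 0}"
    have "compact ((cball 0 1 \<times> cball 0 \<kappa>) \<inter> {z. g P (fst z) (snd z) = 0})"
      by (intro compact_Int_closed compact_Times compact_cball closed_Collect_eq continuous_intros cont[OF P])
    then have "compact (fst ` ?Z)"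
      unfolding Collect_conj_eq Collect_mem_eq
      by (rule compact_continuous_image[OF continuous_on_fst[OF continuous_on_id]])
    then have cl: "closed (fst ` ?Z)" by (rule compact_imp_closed)
    have "D \<subseteq> fst ` ?Z"
    proof
      fix X assume X: "X \<in> D"
      then obtain Y where "Y \<in> cball 0 \<kappa>" "g P X Y = 0" using * by (auto simp: ex_def)
      then show "X \<in> fst ` ?Z" using X D(2) by (intro image_eqI[of _ _ "(X, Y)"]) auto
    qed
    then have all: "cball 0 1 \<subseteq> fst ` ?Z"
      using D(3) closure_minimal[OF _ cl] by blast
    show "\<forall>X. cmod X \<le> 1 \<longrightarrow> (\<exists>Y. cmod Y < \<kappa> \<and> (\<forall>Z. cmod Z \<le> \<kappa> \<longrightarrow> (g P X Z = 0 \<longleftrightarrow> Z = Y)))"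
    proof (intro allI impI)
      fix X :: complex assume X: "cmod X \<le> 1"
      then have "X \<in> fst ` ?Z" using all by auto
      then obtain Y where Y: "cmod Y \<le> \<kappa>" "g P X Y = 0" by auto
      have "cmod Y \<noteq> \<kappa>" using * X Y by (force simp: bd_def)
      then have lt: "cmod Y < \<kappa>" using Y(1) by simp
      have uniq: "Z = Y" if Z: "cmod Z \<le> \<kappa>" "g P X Z = 0" for Z
      proof (rule ccontr)
        assume "Z \<noteq> Y"
        then obtain n where "inverse (real (Suc n)) < cmod (Z - Y)"
          using reals_Archimedean[of "cmod (Z - Y)"] by auto
        then have "(X, Z, Y) \<in> K n" using X Y Z by (simp add: K_def)
        then have "two P n" unfolding two_def using Y Z by (intro bexI[of _ "(X, Z, Y)"]) simp_all
        with * show False by blast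
      qed
      show "\<exists>Y. cmod Y < \<kappa> \<and> (\<forall>Z. cmod Z \<le> \<kappa> \<longrightarrow> (g P X Z = 0 \<longleftrightarrow> Z = Y))"
        using lt Y(2) by (intro exI[of _ Y] conjI allI impI iffI uniq) simp_all
    qed
  qed
  also have "\<dots> \<in> sets M"
    using D(1) mbd mex mtwo
    by (intro sets.sets_Collect_conj sets.sets_Collect_neg sets.sets_Collect_countable_All sets.sets_Collect_countable_Ball) auto
  finally show ?thesis .
qed

lemma sets_submanifold_chart:
  assumes A: "unitary3 A" and \<psi>: "\<And>u. u \<noteq> 0 \<Longrightarrow> \<psi> (proj u) = proj (A *v u)"
    and d: "d \<ge> 1" and \<kappa>: "\<kappa> > 0"
  shows "{P \<in> space (form_gaussian d). submanifold_chart d \<kappa> \<psi> P} \<in> sets (form_gaussian d)"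
proof -
  have "{P \<in> space (form_gaussian d). \<forall>X. cmod X \<le> 1 \<longrightarrow> (\<exists>Y. cmod Y < \<kappa> \<and> (\<forall>Z. cmod Z \<le> \<kappa> \<longrightarrow>
      (form_eval d P (local_point d A X Z) = 0 \<longleftrightarrow> Z = Y)))} \<in> sets (form_gaussian d)"
  proof (rule sets_unique_root)
    have s: "sets (form_gaussian d) = sets (\<Pi>\<^sub>M i\<in>exponents d. borel)"
      by (simp add: form_gaussian_eq_distr)
    have c: "(\<lambda>P. P i) \<in> borel_measurable (form_gaussian d)" if "i \<in> exponents d" for i
      using that by (subst measurable_cong_sets[OF s refl]) simp
    show "(\<lambda>P. form_eval d P (local_point d A X Y)) \<in> borel_measurable (form_gaussian d)" for X Y
      unfolding form_eval_def split_def
      by (intro borel_measurable_sum borel_measurable_times borel_measurable_const c) simp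
    fix P
    have "continuous_on UNIV (\<lambda>z. local_point d A (fst z) (snd z) $ i)" for i
      unfolding local_point_def matrix_vector_mult_def
      by (simp add: sum_3 divide_inverse) (intro continuous_intros)
    then show "continuous_on UNIV (\<lambda>z. form_eval d P (local_point d A (fst z) (snd z)))"
      unfolding form_eval_def split_def
      by (intro continuous_on_sum continuous_on_mult continuous_on_const continuous_on_power)
  qed (rule \<kappa>)
  moreover have "submanifold_chart d \<kappa> \<psi> P \<longleftrightarrow> (\<forall>X. cmod X \<le> 1 \<longrightarrow> (\<exists>Y. cmod Y < \<kappa> \<and> (\<forall>Z. cmod Z \<le> \<kappa> \<longrightarrow>
      (form_eval d P (local_point d A X Z) = 0 \<longleftrightarrow> Z = Y))))" for P
    using A \<psi> d \<kappa> by (rule submanifold_chart_iff)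
  ultimately show ?thesis by (simp only:)
qed

section \<open>Correlations between distant charts\<close>

text \<open>\<open>S\<close> is the frame operator. Its trace is the sum of the squared norms and
  its squared Frobenius norm the sum of the squared Gram entries; Cauchy-Schwarz on the diagonal
  compares the two.\<close>

lemma welch_bound:
  assumes "finite I" "finite J"
  shows "(\<Sum>j\<in>J. Re (cdot I (v j) (v j)))\<^sup>2 \<le> card I * (\<Sum>i\<in>J. \<Sum>j\<in>J. (cmod (cdot I (v i) (v j)))\<^sup>2)"
proof -
  define S where "S x y = (\<Sum>j\<in>J. v j x * cnj (v j y))" for x y
  have diag: "(\<Sum>x\<in>I. S x x) = (\<Sum>j\<in>J. cdot I (v j) (v j))"
    unfolding S_def cdot_def by (rule sum.swap)
  have "(\<Sum>x\<in>I. \<Sum>y\<in>I. S x y * cnj (S x y))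
      = (\<Sum>x\<in>I. \<Sum>y\<in>I. \<Sum>i\<in>J. \<Sum>j\<in>J. (v i x * cnj (v j x)) * cnj (v i y * cnj (v j y)))"
    unfolding S_def cnj_sum sum_product by (intro sum.cong refl) (simp add: mult_ac)
  also have "\<dots> = (\<Sum>x\<in>I. \<Sum>i\<in>J. \<Sum>y\<in>I. \<Sum>j\<in>J. (v i x * cnj (v j x)) * cnj (v i y * cnj (v j y)))"
    by (intro sum.cong refl sum.swap)
  also have "\<dots> = (\<Sum>i\<in>J. \<Sum>x\<in>I. \<Sum>y\<in>I. \<Sum>j\<in>J. (v i x * cnj (v j x)) * cnj (v i y * cnj (v j y)))"
    by (rule sum.swap)
  also have "\<dots> = (\<Sum>i\<in>J. \<Sum>x\<in>I. \<Sum>j\<in>J. \<Sum>y\<in>I. (v i x * cnj (v j x)) * cnj (v i y * cnj (v j y)))"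
    by (intro sum.cong refl sum.swap)
  also have "\<dots> = (\<Sum>i\<in>J. \<Sum>j\<in>J. \<Sum>x\<in>I. \<Sum>y\<in>I. (v i x * cnj (v j x)) * cnj (v i y * cnj (v j y)))"
    by (intro sum.cong refl sum.swap)
  also have "\<dots> = (\<Sum>i\<in>J. \<Sum>j\<in>J. cdot I (v i) (v j) * cnj (cdot I (v i) (v j)))"
    unfolding cdot_def cnj_sum sum_product ..
  finally have "complex_of_real (\<Sum>x\<in>I. \<Sum>y\<in>I. (cmod (S x y))\<^sup>2) = of_real (\<Sum>i\<in>J. \<Sum>j\<in>J. (cmod (cdot I (v i) (v j)))\<^sup>2)"
    by (simp add: complex_norm_square del: of_real_power)
  then have frob: "(\<Sum>x\<in>I. \<Sum>y\<in>I. (cmod (S x y))\<^sup>2) = (\<Sum>i\<in>J. \<Sum>j\<in>J. (cmod (cdot I (v i) (v j)))\<^sup>2)"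
    unfolding of_real_eq_iff .
  have "(\<Sum>j\<in>J. Re (cdot I (v j) (v j))) = (\<Sum>x\<in>I. Re (S x x))"
    using arg_cong[OF diag, of Re] by simp
  also have "(\<Sum>x\<in>I. Re (S x x))\<^sup>2 \<le> card I * (\<Sum>x\<in>I. (Re (S x x))\<^sup>2)"
    using sum_squared_le_sum_of_squares[of "\<lambda>x. Re (S x x)" I] by (simp add: mult.commute)
  also have "\<dots> \<le> card I * (\<Sum>x\<in>I. \<Sum>y\<in>I. (cmod (S x y))\<^sup>2)"
  proof (intro mult_left_mono sum_mono)
    fix x assume x: "x \<in> I"
    have "(Re (S x x))\<^sup>2 \<le> (cmod (S x x))\<^sup>2"
      by (simp add: cmod_power2)
    also have "\<dots> \<le> (\<Sum>y\<in>I. (cmod (S x y))\<^sup>2)"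
      using x assms by (intro member_le_sum) auto
    finally show "(Re (S x x))\<^sup>2 \<le> (\<Sum>y\<in>I. (cmod (S x y))\<^sup>2)" .
  qed auto
  finally show ?thesis unfolding frob .
qed

text \<open>Each row of the Gram matrix has one diagonal entry and fewer than \<open>card S\<close>
  others, so correlations enter only as \<open>card S * \<epsilon>\<close>.\<close>

lemma gram_sum_le:
  fixes B \<epsilon> :: real
  assumes "finite S" and B: "\<And>j. j \<in> S \<Longrightarrow> Re (cdot I (w j) (w j)) \<le> B"
    and \<epsilon>: "\<epsilon> \<ge> 0" "\<And>i j. \<lbrakk>i \<in> S; j \<in> S; i \<noteq> j\<rbrakk> \<Longrightarrow> cmod (cdot I (w i) (w j)) \<le> \<epsilon>"
  shows "Re (cdot I (\<lambda>x. \<Sum>j\<in>S. w j x) (\<lambda>x. \<Sum>j\<in>S. w j x)) \<le> card S * (B + card S * \<epsilon>)"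
proof -
  have "Re (cdot I (\<lambda>x. \<Sum>j\<in>S. w j x) (\<lambda>x. \<Sum>j\<in>S. w j x)) = (\<Sum>i\<in>S. \<Sum>j\<in>S. Re (cdot I (w j) (w i)))"
    by (subst cdot_sum_right) (simp add: cdot_sum_left)
  also have "\<dots> \<le> (\<Sum>i\<in>S. B + card S * \<epsilon>)"
  proof (rule sum_mono)
    fix i assume i: "i \<in> S"
    have "(\<Sum>j\<in>S. Re (cdot I (w j) (w i))) = Re (cdot I (w i) (w i)) + (\<Sum>j\<in>S - {i}. Re (cdot I (w j) (w i)))"
      using assms(1) i by (simp add: sum.remove)
    also have "\<dots> \<le> B + (\<Sum>j\<in>S - {i}. \<epsilon>)"
      by (intro add_mono B sum_mono i order.trans[OF complex_Re_le_cmod \<epsilon>(2)]) (use i in auto)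
    also have "(\<Sum>j\<in>S - {i}. \<epsilon>) \<le> (\<Sum>j\<in>S. \<epsilon>)"
      using assms(1) \<epsilon>(1) by (intro sum_mono2) auto
    finally show "(\<Sum>j\<in>S. Re (cdot I (w j) (w i))) \<le> B + card S * \<epsilon>" by simp
  qed
  finally show ?thesis by simp
qed

section \<open>Distance of complex lines and decay of correlations\<close>

lemma norm_diff_scale_sq:
  fixes u v :: "complex^3"
  assumes "cmod e = 1"
  shows "(norm (u - e *s v))\<^sup>2 = (norm u)\<^sup>2 + (norm v)\<^sup>2 - 2 * Re (cnj e * cinner3 u v)"
proof -
  have "Re (cinner3 (u - e *s v) (u - e *s v))
      = Re (cinner3 u u) + (cmod e)\<^sup>2 * Re (cinner3 v v) - 2 * Re (cnj e * cinner3 u v)"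
    unfolding cmod_power2 by (simp add: cinner3_def sum_3 power2_eq_square algebra_simps)
  then show ?thesis using assms by (simp add: cinner3_self)
qed

lemma exists_phase:
  fixes u v :: "complex^3"
  obtains e where "cmod e = 1" "(norm (u - e *s v))\<^sup>2 = (norm u)\<^sup>2 + (norm v)\<^sup>2 - 2 * cmod (cinner3 u v)"
proof
  define c where "c = cinner3 u v"
  define e where "e = (if c = 0 then 1 else c / of_real (cmod c))"
  show e: "cmod e = 1" by (simp add: e_def norm_divide)
  have "cnj e * c = of_real (cmod c)"
    by (simp add: e_def complex_norm_square[symmetric] mult.commute[of "cnj _"] power2_eq_square)
  then show "(norm (u - e *s v))\<^sup>2 = (norm u)\<^sup>2 + (norm v)\<^sup>2 - 2 * cmod (cinner3 u v)"
    using norm_diff_scale_sq[OF e, of u v] by (simp add: c_def)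
qed

lemma norm_cinner3_le_1:
  assumes "norm u = 1" "norm v = 1"
  shows "cmod (cinner3 u v) \<le> 1"
proof -
  obtain e where "(norm (u - e *s v))\<^sup>2 = (norm u)\<^sup>2 + (norm v)\<^sup>2 - 2 * cmod (cinner3 u v)"
    by (rule exists_phase)
  with zero_le_power2[of "norm (u - e *s v)"] assms show ?thesis by simp
qed

text \<open>The distance of two complex lines, measured as the distance of unit vectors minimised over a
  phase, satisfies the triangle inequality.\<close>

lemma cinner3_nearby_le:
  fixes u u' w w' :: "complex^3" and D \<delta> :: real
  assumes u: "norm u = 1" "norm u' = 1" and D: "D\<^sup>2 \<le> 2 - 2 * cmod (cinner3 u u')"
    and near: "norm (w - u) \<le> \<delta>" "norm (w' - u') \<le> \<delta>" and \<delta>: "2 * \<delta> \<le> D"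
  shows "cmod (cinner3 w w') \<le> ((norm w)\<^sup>2 + (norm w')\<^sup>2) / 2 - (D - 2 * \<delta>)\<^sup>2 / 2"
proof -
  obtain e where e: "cmod e = 1"
    and ww: "(norm (w - e *s w'))\<^sup>2 = (norm w)\<^sup>2 + (norm w')\<^sup>2 - 2 * cmod (cinner3 w w')"
    by (rule exists_phase)
  have "Re (cnj e * cinner3 u u') \<le> cmod (cinner3 u u')"
    using complex_Re_le_cmod[of "cnj e * cinner3 u u'"] e by (simp add: norm_mult)
  then have "D\<^sup>2 \<le> (norm (u - e *s u'))\<^sup>2"
    using norm_diff_scale_sq[OF e, of u u'] u D by simp
  then have "D \<le> norm (u - e *s u')"
    by (rule power2_le_imp_le) simp
  also have "u - e *s u' = (w - e *s w') - (w - u) + e *s (w' - u')"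
    by (simp add: vec_eq_iff algebra_simps)
  also have "norm \<dots> \<le> norm (w - e *s w') + norm (w - u) + norm (e *s (w' - u'))"
    by (intro order.trans[OF norm_triangle_ineq] add_mono norm_triangle_ineq4 order.refl)
  also have "\<dots> \<le> norm (w - e *s w') + \<delta> + \<delta>"
    unfolding norm_scale3 e using near by (intro add_mono) auto
  finally have "D - 2 * \<delta> \<le> norm (w - e *s w')" by simp
  then have "(D - 2 * \<delta>)\<^sup>2 \<le> (norm (w - e *s w'))\<^sup>2"
    using \<delta> by (intro power_mono) auto
  then have "2 * cmod (cinner3 w w') \<le> ((norm w)\<^sup>2 + (norm w')\<^sup>2) - (D - 2 * \<delta>)\<^sup>2"
    unfolding ww by (simp only: le_diff_eq add.commute)
  then have "cmod (cinner3 w w') \<le> (((norm w)\<^sup>2 + (norm w')\<^sup>2) - (D - 2 * \<delta>)\<^sup>2) / 2" by simp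
  then show ?thesis unfolding diff_divide_distrib .
qed

lemma norm_local_point_sq:
  assumes "unitary3 A" "d \<ge> 1"
  shows "(norm (local_point d A X Y))\<^sup>2 = 1 + ((cmod X)\<^sup>2 + (cmod Y)\<^sup>2) / (6 * d)"
proof -
  have "of_real ((norm (local_point d A X Y))\<^sup>2) = (of_real (1 + ((cmod X)\<^sup>2 + (cmod Y)\<^sup>2) / (6 * d)) :: complex)"
    unfolding cinner3_self[symmetric] cinner3_local_point[OF assms(1)]
    by (simp add: complex_norm_square[symmetric] add_divide_distrib)
  then show ?thesis unfolding of_real_eq_iff .
qed

lemma norm_local_point_diff_sq:
  assumes "unitary3 A" "d \<ge> 1"
  shows "(norm (local_point d A X Y - local_point d A 0 0))\<^sup>2 = ((cmod X)\<^sup>2 + (cmod Y)\<^sup>2) / (6 * d)"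
proof -
  have "local_point d A X Y - local_point d A 0 0
      = A *v (vector [1, X / sqrt (6 * real d), Y / sqrt (6 * real d)] - vector [1, 0, 0])"
    by (simp add: local_point_def matrix_vector_mult_diff_distrib)
  also have "vector [1, X / sqrt (6 * real d), Y / sqrt (6 * real d)] - vector [1, 0, 0]
      = (vector [0, X / sqrt (6 * real d), Y / sqrt (6 * real d)] :: complex^3)"
    by (simp add: vec_eq_iff forall_3)
  finally have "of_real ((norm (local_point d A X Y - local_point d A 0 0))\<^sup>2)
      = cinner3 (vector [0, X / sqrt (6 * real d), Y / sqrt (6 * real d)]) (vector [0, X / sqrt (6 * real d), Y / sqrt (6 * real d)])"
    unfolding cinner3_self[symmetric] by (simp add: cinner3_unitary[OF assms(1)])
  also have "\<dots> = of_real (((cmod X)\<^sup>2 + (cmod Y)\<^sup>2) / (6 * d))"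
  proof -
    have "complex_of_real (sqrt (6 * real d)) * complex_of_real (sqrt (6 * real d)) = 6 * of_nat d"
      unfolding of_real_mult[symmetric] by simp
    then show ?thesis
      by (simp add: cinner3_def sum_3 complex_norm_square add_divide_distrib del: of_real_power)
  qed
  finally show ?thesis unfolding of_real_eq_iff .
qed

text \<open>With \<open>D = 4 sqrt (ln d / d)\<close> and \<open>\<delta> = 2 / sqrt (3 d)\<close> in \<open>cinner3_nearby_le\<close>, this bounds the
  \<open>d\<close>-th power of the inner product.\<close>

definition cross_bound :: "nat \<Rightarrow> real" where
  "cross_bound d = exp (4 / 3 - 8 * (sqrt (ln d) - 1 / sqrt 3)\<^sup>2)"

lemma cross_bound_pos: "cross_bound d > 0"
  by (simp add: cross_bound_def)

lemma cross_gram_le: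
  assumes A: "unitary3 A" "unitary3 A'" and d: "d \<ge> 1" "ln d \<ge> 1"
    and sep: "cmod (cinner3 (local_point d A 0 0) (local_point d A' 0 0)) \<le> 1 - 8 * ln d / d"
  shows "cmod (edot d (torus_kvec d A x) (torus_kvec d A' y)) \<le> cross_bound d"
proof -
  \<comment> \<open>The roles of \<open>A\<close> and \<open>A'\<close> are exchanged, as in
    \<open>cdot_kvec_kvec\<close>.\<close>
  define w w' where "w = local_point d A' (node d (fst y)) (node d (snd y))"
    and "w' = local_point d A (node d (fst x)) (node d (snd x))"
  \<comment> \<open>\<open>D\<close> squared is twice the gap \<open>8 * ln d / d\<close> of the
    hypothesis; \<delta> is the exact displacement of a node with both coordinates of modulus
    2.\<close>
  define D where "D = 4 * sqrt (ln d) / sqrt d"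
  define \<delta> where "\<delta> = 2 / (sqrt 3 * sqrt d)"
  have sd: "sqrt (real d) > 0" using d by simp
  have \<delta>2: "\<delta>\<^sup>2 = 8 / (6 * d)"
    using d by (simp add: \<delta>_def power_divide power_mult_distrib)
  have sq: "(4 * q / sqrt d)\<^sup>2 / 2 = 8 * q\<^sup>2 / d" for q
    using d by (simp add: power_divide power_mult_distrib)
  have "cmod (cinner3 w w') \<le> ((norm w)\<^sup>2 + (norm w')\<^sup>2) / 2 - (D - 2 * \<delta>)\<^sup>2 / 2"
  proof (rule cinner3_nearby_le)
    have "norm (local_point d B 0 0) = 1" if "unitary3 B" for B
      using norm_local_point_sq[OF that d(1), of 0 0] norm_ge_zero[of "local_point d B 0 0"]
      by (auto simp: power2_eq_1_iff)
    then show "norm (local_point d A' 0 0) = 1" "norm (local_point d A 0 0) = 1"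
      using A by blast+
    have "cmod (cinner3 (local_point d A' 0 0) (local_point d A 0 0)) = cmod (cinner3 (local_point d A 0 0) (local_point d A' 0 0))"
      by (rule trans[OF complex_mod_cnj[symmetric]]) (simp add: cinner3_def mult.commute)
    then show "D\<^sup>2 \<le> 2 - 2 * cmod (cinner3 (local_point d A' 0 0) (local_point d A 0 0))"
      using sep d by (simp add: D_def power_divide power_mult_distrib)
    have "\<delta> \<ge> 0" by (simp add: \<delta>_def)
    have "norm (local_point d B (node d s) (node d t) - local_point d B 0 0) \<le> \<delta>" if "unitary3 B" for B s t
      by (rule power2_le_imp_le[OF _ \<open>\<delta> \<ge> 0\<close>]) (simp add: norm_local_point_diff_sq[OF that d(1)] \<delta>2)
    then show "norm (w - local_point d A' 0 0) \<le> \<delta>" "norm (w' - local_point d A 0 0) \<le> \<delta>"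
      unfolding w_def w'_def using A by blast+
    have "1 \<le> sqrt (ln d)" "1 \<le> sqrt (3::real)" using d by simp_all
    then have "1 / sqrt 3 \<le> sqrt (ln d)"
      by (meson divide_le_eq_1 le_less_trans less_le_trans not_le order.trans zero_less_one)
    then have "4 * (1 / sqrt 3) / sqrt d \<le> 4 * sqrt (ln d) / sqrt d"
      using sd by (intro divide_right_mono mult_left_mono) auto
    then show "2 * \<delta> \<le> D" by (simp add: D_def \<delta>_def)
  qed
  also have "((norm w)\<^sup>2 + (norm w')\<^sup>2) / 2 = 1 + 8 / (6 * d)"
    unfolding w_def w'_def norm_local_point_sq[OF A(1) d(1)] norm_local_point_sq[OF A(2) d(1)] by simp
  also have "D - 2 * \<delta> = 4 * (sqrt (ln d) - 1 / sqrt 3) / sqrt d"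
    by (simp add: D_def \<delta>_def diff_divide_distrib)
  also have "(4 * (sqrt (ln d) - 1 / sqrt 3) / sqrt d)\<^sup>2 / 2 = 8 * (sqrt (ln d) - 1 / sqrt 3)\<^sup>2 / d"
    by (rule sq)
  finally have "cmod (cinner3 w w') \<le> 1 + (4 / 3 - 8 * (sqrt (ln d) - 1 / sqrt 3)\<^sup>2) / d"
    by (simp add: diff_divide_distrib)
  also have "\<dots> \<le> exp ((4 / 3 - 8 * (sqrt (ln d) - 1 / sqrt 3)\<^sup>2) / d)"
    by (rule exp_ge_add_one_self)
  finally have "cmod (cinner3 w w') ^ d \<le> exp ((4 / 3 - 8 * (sqrt (ln d) - 1 / sqrt 3)\<^sup>2) / d) ^ d"
    by (rule power_mono) simp
  also have "\<dots> = cross_bound d"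
    using d by (simp add: cross_bound_def exp_of_nat_mult[symmetric])
  finally show ?thesis
    unfolding torus_kvec_def cdot_kvec_kvec norm_power w_def w'_def .
qed

text \<open>The diagonal entry is \<open>(1 + 4 / (3 * d)) ^ d\<close>, at most exp (4 / 3). The
  value 19/5 leaves room below 4 for the correlations; the lower bound serves the Welch
  bound.\<close>

lemma torus_gram_diag:
  assumes "unitary3 A" "d \<ge> 1"
  shows "Re (edot d (torus_kvec d A x) (torus_kvec d A x)) \<ge> 1"
    and "cmod (edot d (torus_kvec d A x) (torus_kvec d A x)) \<le> 19 / 5"
proof -
  define t :: real where "t = 1 + 8 / (6 * d)"
  have eq: "edot d (torus_kvec d A x) (torus_kvec d A x) = of_real (t ^ d)"
    unfolding torus_kvec_def cdot_kvec_kvec cinner3_self norm_local_point_sq[OF assms]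
    by (simp add: t_def)
  have t: "t \<ge> 1" by (simp add: t_def)
  then show "Re (edot d (torus_kvec d A x) (torus_kvec d A x)) \<ge> 1"
    by (simp add: eq del: of_real_power)
  have "t \<le> exp (4 / (3 * d))"
    using exp_ge_add_one_self[of "4 / (3 * d)"] by (simp add: t_def)
  then have "t ^ d \<le> exp (4 / (3 * d)) ^ d"
    using t by (intro power_mono) auto
  also have "\<dots> = exp (4 / 3)"
    using assms by (simp add: exp_of_nat_mult[symmetric])
  also have "\<dots> \<le> 19 / 5"
  \<comment> \<open>Comparison of cubes: exp 4 is at most 2.72 ^ 4, which is below 3.8 ^ 3.\<close>
  proof (rule power_le_imp_le_base[of _ 2])
    have "exp (4 / 3 :: real) ^ Suc 2 = exp 1 ^ 4"
      by (simp only: exp_of_nat_mult[symmetric]) simp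
    also have "\<dots> \<le> (272 / 100) ^ 4"
      by (intro power_mono less_imp_le[OF e_less_272]) auto
    also have "\<dots> \<le> (19 / 5 :: real) ^ Suc 2" by (simp add: power_numeral_reduce)
    finally show "exp (4 / 3 :: real) ^ Suc 2 \<le> (19 / 5) ^ Suc 2" .
  qed simp
  finally show "cmod (edot d (torus_kvec d A x) (torus_kvec d A x)) \<le> 19 / 5"
    unfolding eq norm_of_real using t by simp
qed

section \<open>Probability that all charts fail\<close>

lemma norm_average_le:
  assumes "finite T" "T \<noteq> {}" "\<And>x. x \<in> T \<Longrightarrow> f x \<le> (M :: real)"
  shows "(\<Sum>x\<in>T. f x) / card T \<le> M"
proof -
  have "(\<Sum>x\<in>T. f x) \<le> card T * M"
    using assms by (intro sum_bounded_above) auto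
  then show ?thesis using assms by (simp add: divide_le_eq card_gt_0_iff mult.commute)
qed

lemma cmod_cdot_commute: "cmod (cdot I a b) = cmod (cdot I b a)"
  by (metis cnj_cdot complex_mod_cnj)

lemma rest_sum_le:
  assumes "finite S"
  shows "rest d A (\<lambda>i. \<Sum>j\<in>S. v j i) \<le> (\<Sum>j\<in>S. rest d A (v j))"
  using assms
proof (induction S rule: finite_induct)
  case empty
  then show ?case
    using rest_scale[of d A 0 "\<lambda>_. 0"] by simp
next
  case (insert j S)
  have "rest d A (\<lambda>i. \<Sum>j\<in>insert j S. v j i) \<le> rest d A (v j) + rest d A (\<lambda>i. \<Sum>j\<in>S. v j i)"
    by (rule rest_triangle) (unfold cdot_sum_left, use insert.hyps in simp)
  with insert show ?case by simp
qed

lemma rest_coeff_vec_01: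
  assumes "unitary3 A" "d \<ge> 1"
  shows "rest d A (coeff_vec d A 0 1) = 0"
proof -
  have "edot d (coeff_vec d A 0 1) (coeff_vec d A (fst x) (snd x)) = 0" if "x \<in> other_indices d" for x
    using that edot_coeff_vec_01[OF assms, of "fst x" "snd x"] by (auto simp: other_indices_def split: if_splits)
  then show ?thesis by (simp add: rest_def weighted_rest_def)
qed

lemma charts_fail_bound:
  fixes A :: "'j \<Rightarrow> complex^3^3" and \<kappa> \<epsilon> :: real
  assumes J: "finite J" and A: "\<And>j. j \<in> J \<Longrightarrow> unitary3 (A j)" and d: "d \<ge> 1"
    and \<kappa>: "0 < \<kappa>" "\<kappa> \<le> 1"
    and cross: "\<And>i j x y. \<lbrakk>i \<in> J; j \<in> J; i \<noteq> j; x \<in> torus d; y \<in> torus d\<rbrakk> \<Longrightarrow>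
      cmod (edot d (torus_kvec d (A i) x) (torus_kvec d (A j) y)) \<le> \<epsilon>"
    and \<epsilon>: "\<epsilon> \<ge> 0" "card J * \<epsilon> \<le> \<kappa> / 3000"
  shows "measure (cgauss (exponents d)) {a \<in> space (cgauss (exponents d)). \<forall>j\<in>J.
      \<not> rest d (A j) a < \<kappa> * cmod (edot d a (coeff_vec d (A j) 0 1))}
    \<le> 2 * exp (- exp (- (28000 / \<kappa>\<^sup>2)) / 8 * card J)"
proof -
  let ?G = "cgauss (exponents d)"
  interpret prob_space ?G by (rule prob_space_cgauss) simp
  define N where "N = card J"
  define b where "b j a = edot d a (coeff_vec d (A j) 0 1)" for j a
  define F where "F = {a \<in> space ?G. \<forall>j\<in>J. \<not> rest d (A j) a < \<kappa> * cmod (b j a)}"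
  define C where "C = 28000 / \<kappa>\<^sup>2"
  \<comment> \<open>\<open>coeff_vec d (A j) 0 1\<close> has squared norm \<open>1 / 6\<close>, so adding \<open>c\<close> times it raises \<open>b\<close> by \<open>c / 6 = 47 / \<kappa>\<close>.\<close>
  define c where "c = 282 / \<kappa>"
  define h where "h S i = (\<Sum>j\<in>S. of_real c * coeff_vec d (A j) 0 1 i)" for S i
  \<comment> \<open>\<open>rest_le\<close> turns a mean of at most 5 into 4 * 5 = 20.\<close>
  define tame where "tame j a \<longleftrightarrow> rest d (A j) a \<le> 20" for j a
  \<comment> \<open>The decoding test. In units of \<open>1 / \<kappa>\<close>, an unshifted b has
    modulus at most 22 + 1/4 and a shifted one at least 47 - 22 - 1/4, with the threshold 47/2 in
    between. The bound 21 allows for the disturbance of \<open>rest\<close> by at most 1/4.\<close>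
  define R where "R j a \<longleftrightarrow> rest d (A j) a \<le> 21 \<and> 47 / 2 / \<kappa> \<le> cmod (b j a)" for j a
  define n where "n = nat \<lceil>real N / 4\<rceil>"
  have c: "c > 0" "c * \<kappa> = 282" using \<kappa> by (simp_all add: c_def)
  have Ne: "real N * \<epsilon> \<le> \<kappa> / 3000" using \<epsilon>(2) by (simp add: N_def)
  have cSe: "c * (card S * \<epsilon>) \<le> 94 / 1000" if "S \<subseteq> J" for S
  proof -
    have "real (card S) * \<epsilon> \<le> real N * \<epsilon>"
      using that J \<epsilon>(1) by (intro mult_right_mono) (simp_all add: N_def card_mono)
    with Ne have "c * (card S * \<epsilon>) \<le> c * (\<kappa> / 3000)"
      using c by (intro mult_left_mono) auto
    also have "\<dots> = 94 / 1000" using c(2) by simp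
    finally show ?thesis .
  qed
  have [measurable]: "(\<lambda>a. b j a) \<in> borel_measurable ?G" for j
    unfolding b_def by measurable
  have [measurable]: "rest d B \<in> borel_measurable ?G" for B by (rule measurable_rest)
  have F [measurable]: "F \<in> sets ?G"
    unfolding F_def
    using J by (intro sets.sets_Collect_finite_All sets.sets_Collect_neg) measurable
  \<comment> \<open>Passing from a node to the coefficient of Y gains a factor 1/2 in each argument:
    \<epsilon>, then \<epsilon> / 2, then \<epsilon> / 4. \<open>rest_le\<close> multiplies
    \<epsilon> / 2 by 4.\<close>
  have coeff_kvec: "cmod (edot d (coeff_vec d (A i) 0 1) (torus_kvec d (A j) y)) \<le> \<epsilon> / 2"
    if "i \<in> J" "j \<in> J" "i \<noteq> j" "y \<in> torus d" for i j y
  proof -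
    have "cmod (edot d (torus_kvec d (A j) y) (coeff_vec d (A i) 0 1))
        \<le> ((\<Sum>x\<in>torus d. cmod (edot d (torus_kvec d (A j) y) (torus_kvec d (A i) x))) / card (torus d)) / 2 ^ (0 + 1)"
      by (rule norm_edot_coeff_vec_le)
    also have "\<dots> \<le> \<epsilon> / 2 ^ (0 + 1)"
      using that by (intro divide_right_mono norm_average_le cross) auto
    finally show ?thesis by (simp add: cmod_cdot_commute)
  qed
  then have coeff_avg: "(\<Sum>y\<in>torus d. cmod (edot d (coeff_vec d (A i) 0 1) (torus_kvec d (A j) y))) / card (torus d) \<le> \<epsilon> / 2"
    if "i \<in> J" "j \<in> J" "i \<noteq> j" for i j
    using that by (intro norm_average_le) auto
  have coeff_coeff: "cmod (edot d (coeff_vec d (A i) 0 1) (coeff_vec d (A j) 0 1)) \<le> \<epsilon> / 4"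
    if "i \<in> J" "j \<in> J" "i \<noteq> j" for i j
  proof -
    have "cmod (edot d (coeff_vec d (A i) 0 1) (coeff_vec d (A j) 0 1))
        \<le> ((\<Sum>y\<in>torus d. cmod (edot d (coeff_vec d (A i) 0 1) (torus_kvec d (A j) y))) / card (torus d)) / 2 ^ (0 + 1)"
      by (rule norm_edot_coeff_vec_le)
    also have "\<dots> \<le> (\<epsilon> / 2) / 2 ^ (0 + 1)"
      by (intro divide_right_mono coeff_avg that) auto
    finally show ?thesis by simp
  qed
  have coeff_rest: "rest d (A j) (coeff_vec d (A i) 0 1) \<le> 2 * \<epsilon>"
    if "i \<in> J" "j \<in> J" "i \<noteq> j" for i j
    using rest_le[OF coeff_avg[OF that]] by simp
  have coeff_diag: "edot d (coeff_vec d (A j) 0 1) (coeff_vec d (A j) 0 1) = 1 / 6" if "j \<in> J" for j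
    using edot_coeff_vec_01[OF A[OF that] d, of 0 1] d by simp
  have h_rest: "\<bar>rest d (A j) (translate (exponents d) (h S) a) - rest d (A j) a\<bar> \<le> 1 / 4"
    if "S \<subseteq> J" "j \<in> J" for S j a
  proof -
    have fS: "finite S" using that J finite_subset by blast
    have "\<bar>rest d (A j) (translate (exponents d) (h S) a) - rest d (A j) a\<bar> \<le> rest d (A j) (h S)"
      by (rule rest_translate)
    also have "\<dots> \<le> (\<Sum>i\<in>S. rest d (A j) (\<lambda>x. of_real c * coeff_vec d (A i) 0 1 x))"
      unfolding h_def by (rule rest_sum_le[OF fS])
    also have "\<dots> \<le> (\<Sum>i\<in>S. c * (2 * \<epsilon>))"
    proof (rule sum_mono)
      fix i assume i: "i \<in> S"
      have "rest d (A j) (coeff_vec d (A i) 0 1) \<le> 2 * \<epsilon>"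
        using coeff_rest[of i j] rest_coeff_vec_01[OF A d] that i \<epsilon>(1) by (cases "i = j") auto
      then show "rest d (A j) (\<lambda>x. of_real c * coeff_vec d (A i) 0 1 x) \<le> c * (2 * \<epsilon>)"
        unfolding rest_scale using c by (simp add: mult_left_mono)
    qed
    also have "\<dots> = 2 * (c * (card S * \<epsilon>))" by simp
    also have "\<dots> \<le> 1 / 4" using cSe[OF that(1)] by simp
    finally show ?thesis .
  qed
  have h_b: "cmod (b j (translate (exponents d) (h S) a) - b j a - of_real (if j \<in> S then 47 / \<kappa> else 0)) \<le> 1 / 4"
    if "S \<subseteq> J" "j \<in> J" for S j a
  proof -
    have fS: "finite S" using that J finite_subset by blast
    let ?t = "\<lambda>i. of_real c * edot d (coeff_vec d (A i) 0 1) (coeff_vec d (A j) 0 1)"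
    have "b j (translate (exponents d) (h S) a) - b j a = (\<Sum>i\<in>S. ?t i)"
      unfolding b_def cdot_translate h_def cdot_sum_left cdot_scale_left by simp
    also have "\<dots> = of_real (if j \<in> S then 47 / \<kappa> else 0) + (\<Sum>i\<in>S - {j}. ?t i)"
    proof (cases "j \<in> S")
      case True
      have "?t j = of_real (47 / \<kappa>)"
        unfolding coeff_diag[OF that(2)] by (simp add: c_def)
      with True show ?thesis by (simp only: sum.remove[OF fS True] if_True)
    qed simp
    finally have "cmod (b j (translate (exponents d) (h S) a) - b j a - of_real (if j \<in> S then 47 / \<kappa> else 0))
        = cmod (\<Sum>i\<in>S - {j}. ?t i)" by simp
    also have "\<dots> \<le> (\<Sum>i\<in>S - {j}. c * (\<epsilon> / 4))"
      using coeff_coeff that c by (intro sum_norm_le) (auto simp: norm_mult intro!: mult_left_mono)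
    also have "\<dots> \<le> (\<Sum>i\<in>S. c * (\<epsilon> / 4))"
      using fS c \<epsilon>(1) by (intro sum_mono2) auto
    also have "\<dots> = c * (card S * \<epsilon>) / 4" by simp
    also have "\<dots> \<le> 1 / 4" using cSe[OF that(1)] by simp
    finally show ?thesis .
  qed
  have k1: "1 \<le> 1 / \<kappa>" using \<kappa> by simp
  \<comment> \<open>Stated with 22 rather than 20, so that it also applies when \<open>rest\<close>
    is known only after a translation.\<close>
  have b_small: "cmod (b j a) \<le> 22 / \<kappa>" if "a \<in> F" "j \<in> J" "rest d (A j) a \<le> 22" for j a
  proof -
    have "\<kappa> * cmod (b j a) \<le> 22" using that by (force simp: F_def)
    then show ?thesis using \<kappa> by (simp add: le_divide_eq mult.commute)
  qed
  have peierls: "measure ?G {a \<in> F. n \<le> card {j\<in>J. tame j a}} * (1 + exp (- C)) ^ n \<le> 1"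
  proof (rule disjoint_translates_bound[where rec = R and h = h])
    show "Measurable.pred ?G (tame j)" for j
      unfolding tame_def by measurable
  next
    fix S a j assume S: "S \<subseteq> J" and a: "a \<in> F" and t: "\<And>i. i \<in> S \<Longrightarrow> tame i a" and j: "j \<in> J"
    let ?a = "translate (exponents d) (h S) a"
    note hr = h_rest[OF S j, of a] and hb = h_b[OF S j, of a]
    show "R j ?a \<longleftrightarrow> j \<in> S"
    proof (cases "j \<in> S")
      case True
      then have r: "rest d (A j) a \<le> 20" using t by (simp add: tame_def)
      have "47 / \<kappa> = cmod (of_real (47 / \<kappa>))" using \<kappa> by (simp only: norm_of_real) simp
      also have "\<dots> \<le> cmod (b j ?a) + cmod (b j a) + cmod (b j ?a - b j a - of_real (47 / \<kappa>))"
        using norm_triangle_ineq4[of "b j ?a - b j a" "b j ?a - b j a - of_real (47 / \<kappa>)"] norm_triangle_ineq4[of "b j ?a" "b j a"]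
        by simp
      also have "\<dots> \<le> cmod (b j ?a) + 22 / \<kappa> + 1 / 4"
        using hb True b_small[OF a j] r by (intro add_mono) auto
      finally have "47 / \<kappa> - 22 / \<kappa> - (1 / 4) * (1 / \<kappa>) \<le> cmod (b j ?a)"
        using k1 by linarith
      moreover have "47 / 2 / \<kappa> \<le> 47 / \<kappa> - 22 / \<kappa> - (1 / 4) * (1 / \<kappa>)"
        using \<kappa> by (simp add: field_simps)
      ultimately show ?thesis using True hr r unfolding R_def by linarith
    next
      case False
      have "\<not> R j ?a"
      proof
        \<comment> \<open>A chart outside \<open>S\<close> may fail to be tame; the bound on
          \<open>rest\<close> inside \<open>R\<close> supplies what is needed to apply
          \<open>b_small\<close>.\<close>
        assume R: "R j ?a"
        then have "rest d (A j) a \<le> 22"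
          using hr unfolding R_def by linarith
        then have "cmod (b j a) \<le> 22 / \<kappa>"
          by (rule b_small[OF a j])
        moreover have "cmod (b j ?a) \<le> cmod (b j a) + cmod (b j ?a - b j a)"
          by (rule norm_triangle_sub)
        moreover have "cmod (b j ?a - b j a) \<le> 1 / 4" using hb False by simp
        ultimately have "47 / 2 / \<kappa> \<le> 22 / \<kappa> + (1 / 4) * (1 / \<kappa>)"
          using R k1 unfolding R_def by linarith
        then show False using \<kappa> by (simp add: field_simps)
      qed
      with False show ?thesis by simp
    qed
  next
    fix S a assume S: "S \<subseteq> J" and a: "a \<in> F" and t: "\<And>i. i \<in> S \<Longrightarrow> tame i a"
    have fS: "finite S" using S J finite_subset by blast
    have "Re (edot d a (h S)) = (\<Sum>j\<in>S. c * Re (b j a))"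
      unfolding h_def[abs_def] cdot_sum_right cdot_scale_right b_def by simp
    also have "\<dots> \<le> (\<Sum>j\<in>S. c * (22 / \<kappa>))"
    proof (intro sum_mono mult_left_mono)
      fix j assume "j \<in> S"
      then have "cmod (b j a) \<le> 22 / \<kappa>"
        using S a t[of j] by (intro b_small) (auto simp: tame_def)
      then show "Re (b j a) \<le> 22 / \<kappa>" using complex_Re_le_cmod[of "b j a"] by linarith
    qed (use c in auto)
    also have "\<dots> = card S * (c * (22 / \<kappa>))" by (rule sum_constant)
    finally have "2 * Re (edot d a (h S)) \<le> 2 * (card S * (c * (22 / \<kappa>)))"
      by (rule mult_left_mono) simp
    also have "\<dots> = card S * (2 * c * (22 / \<kappa>))" by (simp only: mult_ac)
    finally have 1: "2 * Re (edot d a (h S)) \<le> card S * (2 * c * (22 / \<kappa>))" .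
    have "Re (edot d (h S) (h S)) \<le> card S * (c * c / 6 + card S * (c * c * \<epsilon> / 4))"
      unfolding h_def[abs_def]
    proof (rule gram_sum_le[OF fS])
      fix j assume "j \<in> S"
      then have eq: "edot d (coeff_vec d (A j) 0 1) (coeff_vec d (A j) 0 1) = 1 / 6"
        using S by (intro coeff_diag) auto
      show "Re (edot d (\<lambda>i. of_real c * coeff_vec d (A j) 0 1 i) (\<lambda>i. of_real c * coeff_vec d (A j) 0 1 i)) \<le> c * c / 6"
        unfolding cdot_scale_left cdot_scale_right eq by simp
    next
      fix i j assume ij: "i \<in> S" "j \<in> S" "i \<noteq> j"
      have "cmod (edot d (coeff_vec d (A i) 0 1) (coeff_vec d (A j) 0 1)) \<le> \<epsilon> / 4"
        using ij S by (intro coeff_coeff) auto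
      then have "c * c * cmod (edot d (coeff_vec d (A i) 0 1) (coeff_vec d (A j) 0 1)) \<le> c * c * (\<epsilon> / 4)"
        by (intro mult_left_mono) auto
      then show "cmod (edot d (\<lambda>x. of_real c * coeff_vec d (A i) 0 1 x) (\<lambda>x. of_real c * coeff_vec d (A j) 0 1 x)) \<le> c * c * \<epsilon> / 4"
        unfolding cdot_scale_left cdot_scale_right by (simp add: norm_mult c(1) less_imp_le mult.assoc abs_of_pos)
    qed (use \<epsilon>(1) in simp)
    also have "\<dots> = card S * (c * c / 6 + c * (c * (card S * \<epsilon>)) / 4)" by (simp add: algebra_simps)
    also have "\<dots> \<le> card S * (c * c / 6 + c * (94 / 1000) / 4)"
      using cSe[OF S] c(1) by (intro mult_left_mono add_mono divide_right_mono) auto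
    finally have 2: "Re (edot d (h S) (h S)) \<le> card S * (c * c / 6 + c * (94 / 1000) / 4)" .
    \<comment> \<open>The linear term costs 12408, the squared norm 13254, and the correlations less
      than 7, all over the square of \<kappa>; the sum is below 28000.\<close>
    have "2 * c * (22 / \<kappa>) + (c * c / 6 + c * (94 / 1000) / 4) \<le> C"
    proof -
      have e0: "c \<le> 282 / \<kappa>\<^sup>2"
        using \<kappa> by (simp add: c_def field_simps power2_eq_square mult_left_le)
      have e: "2 * c * (22 / \<kappa>) = 12408 / \<kappa>\<^sup>2" "c * c / 6 = 13254 / \<kappa>\<^sup>2"
        by (simp_all add: c_def power2_eq_square)
      have "2 * c * (22 / \<kappa>) + (c * c / 6 + c * (94 / 1000) / 4) \<le> 12408 / \<kappa>\<^sup>2 + (13254 / \<kappa>\<^sup>2 + (282 / \<kappa>\<^sup>2) * (94 / 1000) / 4)"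
        unfolding e by (intro add_mono mult_right_mono divide_right_mono e0 order.refl) auto
      also have "\<dots> \<le> C"
        using \<kappa> by (simp add: C_def field_simps)
      finally show ?thesis .
    qed
    then have "card S * (2 * c * (22 / \<kappa>) + (c * c / 6 + c * (94 / 1000) / 4)) \<le> card S * C"
      by (intro mult_left_mono) auto
    with 1 2 show "2 * Re (edot d a (h S)) + Re (edot d (h S) (h S)) \<le> C * card S"
      by (simp only: distrib_left mult.commute[of C])
  qed (use J F in auto)
  define bad where "bad = {a \<in> space ?G. card {j\<in>J. (\<Sum>x\<in>torus d. cmod (edot d a (torus_kvec d (A j) x))) / card (torus d) \<le> 5} < N / 4}"
  have tail: "measure ?G bad \<le> exp (- real N / 4)"
    unfolding bad_def N_def
  proof (rule tail_bound)
    fix g :: "'j \<Rightarrow> nat \<times> nat" and \<theta> :: "'j \<Rightarrow> complex" assume g: "g \<in> J \<rightarrow> torus d" and \<theta>: "\<And>j. cmod (\<theta> j) = 1"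
    have \<theta>': "\<theta> j * cnj (\<theta> j) = 1" for j
      using \<theta>[of j] by (simp add: complex_norm_square[symmetric])
    have "Re (edot d (\<lambda>i. \<Sum>j\<in>J. \<theta> j * torus_kvec d (A j) (g j) i) (\<lambda>i. \<Sum>j\<in>J. \<theta> j * torus_kvec d (A j) (g j) i))
        \<le> card J * (19 / 5 + card J * \<epsilon>)"
    proof (rule gram_sum_le[OF J])
      fix j assume j: "j \<in> J"
      have eq: "edot d (\<lambda>i. \<theta> j * torus_kvec d (A j) (g j) i) (\<lambda>i. \<theta> j * torus_kvec d (A j) (g j) i)
          = (\<theta> j * cnj (\<theta> j)) * edot d (torus_kvec d (A j) (g j)) (torus_kvec d (A j) (g j))"
        unfolding cdot_scale_left cdot_scale_right by (simp add: mult_ac)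
      show "Re (edot d (\<lambda>i. \<theta> j * torus_kvec d (A j) (g j) i) (\<lambda>i. \<theta> j * torus_kvec d (A j) (g j) i)) \<le> 19 / 5"
        unfolding eq \<theta>' mult_1
        by (rule order.trans[OF complex_Re_le_cmod torus_gram_diag(2)[OF A[OF j] d]])
    next
      fix i j assume ij: "i \<in> J" "j \<in> J" "i \<noteq> j"
      show "cmod (edot d (\<lambda>x. \<theta> i * torus_kvec d (A i) (g i) x) (\<lambda>x. \<theta> j * torus_kvec d (A j) (g j) x)) \<le> \<epsilon>"
        unfolding cdot_scale_left cdot_scale_right
        using cross[OF ij, of "g i" "g j"] g ij by (simp add: norm_mult \<theta> Pi_iff)
    qed (rule \<epsilon>(1))
    also have "\<dots> \<le> real (card J) * 4"
    proof (rule mult_left_mono)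
      show "19 / 5 + card J * \<epsilon> \<le> 4" using \<epsilon>(2) \<kappa>(2) by linarith
    qed simp
    finally show "Re (edot d (\<lambda>i. \<Sum>j\<in>J. \<theta> j * torus_kvec d (A j) (g j) i) (\<lambda>i. \<Sum>j\<in>J. \<theta> j * torus_kvec d (A j) (g j) i))
        \<le> 4 * card J" by simp
  qed (use J in auto)
  have bad_sets: "bad \<in> sets ?G"
  proof -
    have eq: "card {j\<in>J. Q j} = (\<Sum>j\<in>J. of_bool (Q j) :: real)" for Q
      using J by (simp add: sum.If_cases of_bool_def Int_def)
    show ?thesis unfolding bad_def eq of_bool_def by measurable
  qed
  have tame_sets: "{a \<in> F. n \<le> card {j\<in>J. tame j a}} \<in> sets ?G"
  proof -
    have eq: "card {j\<in>J. Q j} = (\<Sum>j\<in>J. of_bool (Q j) :: real)" for Q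
      using J by (simp add: sum.If_cases of_bool_def Int_def)
    have "{a \<in> space ?G. real n \<le> (\<Sum>j\<in>J. of_bool (tame j a) :: real)} \<in> sets ?G"
      unfolding tame_def of_bool_def by measurable
    then have "F \<inter> {a \<in> space ?G. real n \<le> real (card {j\<in>J. tame j a})} \<in> sets ?G"
      unfolding eq by auto
    also have "F \<inter> {a \<in> space ?G. real n \<le> real (card {j\<in>J. tame j a})} = {a \<in> F. n \<le> card {j\<in>J. tame j a}}"
      by (auto simp: F_def)
    finally show ?thesis .
  qed
  have "F \<subseteq> bad \<union> {a \<in> F. n \<le> card {j\<in>J. tame j a}}"
  proof
    fix a assume a: "a \<in> F"
    let ?T = "{j\<in>J. (\<Sum>x\<in>torus d. cmod (edot d a (torus_kvec d (A j) x))) / card (torus d) \<le> 5}"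
    have "?T \<subseteq> {j\<in>J. tame j a}"
      using rest_le[of d a _ 5] by (auto simp: tame_def)
    then have le: "card ?T \<le> card {j\<in>J. tame j a}"
      using J by (intro card_mono) auto
    show "a \<in> bad \<union> {a \<in> F. n \<le> card {j\<in>J. tame j a}}"
    proof (cases "real (card ?T) < N / 4")
      case True
      with a show ?thesis by (simp add: bad_def F_def)
    next
      case False
      then have "n \<le> card ?T" unfolding n_def nat_ceiling_le_eq by linarith
      with le a show ?thesis by simp
    qed
  qed
  then have "measure ?G F \<le> measure ?G (bad \<union> {a \<in> F. n \<le> card {j\<in>J. tame j a}})"
    using bad_sets tame_sets by (intro finite_measure_mono) auto
  also have "\<dots> \<le> measure ?G bad + measure ?G {a \<in> F. n \<le> card {j\<in>J. tame j a}}"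
    using bad_sets tame_sets by (rule measure_Un_le)
  also have "\<dots> \<le> exp (- exp (- C) / 8 * N) + exp (- exp (- C) / 8 * N)"
  proof (rule add_mono)
    \<comment> \<open>Both summands are reduced to one exponential: 1/8 comes from
      \<open>ln (1 + x) \<ge> x / 2\<close> for \<open>x \<le> 1/2\<close> combined with
      \<open>n \<ge> N / 4\<close>.\<close>
    have "1 \<le> C" using \<kappa> power_le_one[of \<kappa> 2] by (simp add: C_def le_divide_eq)
    then have "2 \<le> exp C" using exp_ge_add_one_self[of C] by linarith
    then have C: "exp (- C) \<le> 1 / 2" by (simp add: exp_minus field_simps)
    then have "exp (- C) / 8 \<le> 1 / 4" by linarith
    then have "exp (- C) / 8 * N \<le> 1 / 4 * N"
      by (rule mult_right_mono) simp
    then have "exp (- real N / 4) \<le> exp (- exp (- C) / 8 * N)" by simp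
    with tail show "measure ?G bad \<le> exp (- exp (- C) / 8 * N)" by (rule order.trans)
    have "exp (- C) * exp (- C) \<le> exp (- C) * (1 / 2)"
      using C by (rule mult_left_mono) simp
    moreover have "exp (- C) - (exp (- C))\<^sup>2 \<le> ln (1 + exp (- C))"
      by (rule ln_one_plus_pos_lower_bound[OF exp_ge_zero order.trans[OF C]]) simp
    ultimately have "exp (- C) / 2 \<le> ln (1 + exp (- C))"
      unfolding power2_eq_square by linarith
    then have "exp (exp (- C) / 2) \<le> 1 + exp (- C)"
      by (subst (asm) ln_ge_iff) (auto simp: add_pos_pos)
    then have "exp (exp (- C) / 2) ^ n \<le> (1 + exp (- C)) ^ n"
      by (rule power_mono) simp
    moreover have "exp (exp (- C) / 8 * N) \<le> exp (exp (- C) / 2) ^ n"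
    proof -
      have "N / 4 \<le> real n" by (simp add: n_def real_nat_ceiling_ge)
      then have "exp (- C) / 2 * (N / 4) \<le> exp (- C) / 2 * n" by (intro mult_left_mono) auto
      then show ?thesis by (simp add: exp_of_nat_mult[symmetric] mult.commute)
    qed
    ultimately have "exp (exp (- C) / 8 * N) \<le> (1 + exp (- C)) ^ n" by linarith
    then have "measure ?G {a \<in> F. n \<le> card {j\<in>J. tame j a}} * exp (exp (- C) / 8 * N)
        \<le> measure ?G {a \<in> F. n \<le> card {j\<in>J. tame j a}} * (1 + exp (- C)) ^ n"
      by (intro mult_left_mono) auto
    also have "\<dots> \<le> 1" by (rule peierls)
    finally show "measure ?G {a \<in> F. n \<le> card {j\<in>J. tame j a}} \<le> exp (- exp (- C) / 8 * N)"
      by (simp add: exp_minus field_simps)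
  qed
  finally show ?thesis by (simp add: F_def b_def C_def N_def)
qed

text \<open>One torus node per chart gives nearly orthogonal vectors of squared norm between 1 and
  19/5, and the Welch bound limits their number by the dimension.\<close>

lemma charts_card_bound:
  fixes A :: "'j \<Rightarrow> complex^3^3" and \<epsilon> :: real
  assumes J: "finite J" and A: "\<And>j. j \<in> J \<Longrightarrow> unitary3 (A j)" and d: "d \<ge> 1"
    and cross: "\<And>i j x y. \<lbrakk>i \<in> J; j \<in> J; i \<noteq> j; x \<in> torus d; y \<in> torus d\<rbrakk> \<Longrightarrow>
      cmod (edot d (torus_kvec d (A i) x) (torus_kvec d (A j) y)) \<le> \<epsilon>"
    and \<epsilon>: "\<epsilon> \<ge> 0" "card (exponents d) * \<epsilon> \<le> 1 / 2"
  shows "card J \<le> 32 * card (exponents d)"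
proof -
  define E N where "E = real (card (exponents d))" and "N = real (card J)"
  have x0: "(0, 0) \<in> torus d" by (simp add: torus_def)
  let ?v = "\<lambda>j. torus_kvec d (A j) (0, 0)"
  have "(0, 0, d) \<in> exponents d" by (simp add: exponents_def)
  then have "card (exponents d) \<ge> 1" by (auto simp: Suc_le_eq card_gt_0_iff)
  then have E: "E \<ge> 1" by (simp add: E_def)
  have "N \<le> (\<Sum>j\<in>J. Re (edot d (?v j) (?v j)))"
    using sum_mono[of J "\<lambda>_. 1" "\<lambda>j. Re (edot d (?v j) (?v j))"] torus_gram_diag(1)[OF A d] by (simp add: N_def)
  then have "N\<^sup>2 \<le> (\<Sum>j\<in>J. Re (edot d (?v j) (?v j)))\<^sup>2"
    by (intro power_mono) (auto simp: N_def)
  also have "\<dots> \<le> E * (\<Sum>i\<in>J. \<Sum>j\<in>J. (cmod (edot d (?v i) (?v j)))\<^sup>2)"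
    unfolding E_def by (rule welch_bound) (use J in auto)
  also have "\<dots> \<le> E * (\<Sum>i\<in>J. 16 + N * \<epsilon>\<^sup>2)"
  proof (intro mult_left_mono sum_mono)
    fix i assume i: "i \<in> J"
    have "(\<Sum>j\<in>J. (cmod (edot d (?v i) (?v j)))\<^sup>2) = (cmod (edot d (?v i) (?v i)))\<^sup>2 + (\<Sum>j\<in>J - {i}. (cmod (edot d (?v i) (?v j)))\<^sup>2)"
      using J i by (simp add: sum.remove)
    also have "\<dots> \<le> (19 / 5)\<^sup>2 + (\<Sum>j\<in>J - {i}. \<epsilon>\<^sup>2)"
      using torus_gram_diag(2)[OF A[OF i] d] cross i x0 by (intro add_mono power_mono sum_mono) auto
    also have "\<dots> \<le> 16 + (\<Sum>j\<in>J. \<epsilon>\<^sup>2)"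
      using J by (intro add_mono sum_mono2) (auto simp: power2_eq_square)
    finally show "(\<Sum>j\<in>J. (cmod (edot d (?v i) (?v j)))\<^sup>2) \<le> 16 + N * \<epsilon>\<^sup>2" by (simp add: N_def)
  qed (use E in simp)
  also have "\<dots> = N * (16 * E + N * (E * \<epsilon> * \<epsilon>))"
    by (simp add: N_def power2_eq_square algebra_simps)
  finally have *: "N * N \<le> N * (16 * E + N * (E * \<epsilon> * \<epsilon>))" by (simp add: power2_eq_square)
  \<comment> \<open>The correlation term is at most half of \<open>N\<close> and is absorbed by the
    left side, which doubles 16 to 32.\<close>
  have "\<epsilon> \<le> E * \<epsilon>" using E \<epsilon>(1) mult_right_mono[of 1 E \<epsilon>] by simp
  then have "E * \<epsilon> * \<epsilon> \<le> 1 / 2 * 1"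
    using \<epsilon> E by (intro mult_mono) (auto simp: E_def)
  then have half: "N * (E * \<epsilon> * \<epsilon>) \<le> N * (1 / 2)" by (intro mult_left_mono) (auto simp: N_def)
  have "N \<le> 32 * E"
  proof (cases "N > 0")
    case True
    with * have "N \<le> 16 * E + N * (E * \<epsilon> * \<epsilon>)" by simp
    with half show ?thesis by linarith
  next
    case False
    with E show ?thesis by linarith
  qed
  then have "real (card J) \<le> real (32 * card (exponents d))" by (simp add: E_def N_def)
  then show ?thesis by (simp only: of_nat_le_iff)
qed

text \<open>Since \<open>2 ^ 11 * 3 ^ 3 = 55296\<close>, the exponent exceeds 28000 by enough to
  absorb a factor 16: 8 from the divisor and 2 from \<open>ln (1 - p) \<ge> - 2 * p\<close>.\<close>

lemma exp_le_capacity_gamma: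
  fixes \<kappa> :: real
  assumes "0 < \<kappa>" "\<kappa> \<le> 1"
  shows "exp (- exp (- (28000 / \<kappa>\<^sup>2)) / 8) \<le> capacity_gamma \<kappa>"
proof -
  define p where "p = exp (- (55296 / \<kappa>\<^sup>2)) * (1 - exp (- 1 / 2))"
  have g: "capacity_gamma \<kappa> = 1 - p" by (simp add: capacity_gamma_def p_def)
  have k: "1 \<le> 1 / \<kappa>\<^sup>2" using assms by (simp add: power_le_one)
  have p0: "p \<ge> 0" by (simp add: p_def)
  have p_le: "p \<le> exp (- (55296 / \<kappa>\<^sup>2))" by (simp add: p_def mult_left_le)
  have "16 \<le> 1 + 27296 / \<kappa>\<^sup>2" using k by simp
  also have "\<dots> \<le> exp (27296 / \<kappa>\<^sup>2)" by (rule exp_ge_add_one_self)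
  finally have "16 * p \<le> exp (27296 / \<kappa>\<^sup>2) * exp (- (55296 / \<kappa>\<^sup>2))"
    using p_le p0 by (intro mult_mono) auto
  also have "\<dots> = exp (- (28000 / \<kappa>\<^sup>2))"
    by (simp add: exp_add[symmetric] diff_divide_distrib[symmetric])
  finally have 1: "16 * p \<le> exp (- (28000 / \<kappa>\<^sup>2))" .
  also have "\<dots> \<le> 1" using k by simp
  finally have p1: "p \<le> 1 / 2" by simp
  then have "- p - 2 * p\<^sup>2 \<le> ln (1 - p)" using p0 by (intro ln_one_minus_pos_lower_bound) auto
  moreover have "p\<^sup>2 \<le> p * (1 / 2)" unfolding power2_eq_square using p0 p1 by (intro mult_left_mono)
  ultimately have "- exp (- (28000 / \<kappa>\<^sup>2)) / 8 \<le> ln (1 - p)" using 1 by linarith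
  then have "exp (- exp (- (28000 / \<kappa>\<^sup>2)) / 8) \<le> exp (ln (1 - p))" by simp
  with p1 show ?thesis by (simp add: g)
qed

lemma d_FS_centers:
  assumes A: "unitary3 A" "unitary3 A'" and d: "d \<ge> 1"
    and r: "0 \<le> r" "r \<le> d_FS (proj (local_point d A 0 0)) (proj (local_point d A' 0 0))"
  shows "cmod (cinner3 (local_point d A 0 0) (local_point d A' 0 0)) \<le> cos r"
proof -
  let ?u = "local_point d A 0 0" and ?v = "local_point d A' 0 0"
  have n: "norm (local_point d B 0 0) = 1" if "unitary3 B" for B
    using norm_local_point_sq[OF that d, of 0 0] norm_ge_zero[of "local_point d B 0 0"]
    by (auto simp: power2_eq_1_iff)
  have nz: "?u \<noteq> 0" "?v \<noteq> 0" using n[OF A(1)] n[OF A(2)] by auto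
  have le: "cmod (cinner3 ?u ?v) \<le> 1" by (intro norm_cinner3_le_1 n A)
  have "r \<le> arccos (cmod (cinner3 ?u ?v))"
    using r(2) unfolding d_FS_proj[OF nz] n[OF A(1)] n[OF A(2)] by simp
  then have "cos (arccos (cmod (cinner3 ?u ?v))) \<le> cos r"
    using r(1) le by (intro cos_monotone_0_pi_le arccos_ubound) (auto intro: order.trans[of _ 0])
  then show ?thesis
    using le by (simp add: cos_arccos order.trans[of _ 0])
qed

theorem theorem1p2:
  fixes \<kappa> :: real
  assumes "0 < \<kappa>" and "\<kappa> \<le> 1"
  shows "\<exists>d0::nat. d0 \<ge> 1 \<and>
    (\<forall>d\<ge>d0. \<forall>N>0. \<forall>(z :: nat \<Rightarrow> cp2) (\<psi> :: nat \<Rightarrow> cp2 \<Rightarrow> cp2).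
      (\<forall>i\<in>{1..N}. marked_FS_chart_at (z i) (\<psi> i)) \<longrightarrow>
      (\<forall>i\<in>{1..N}. \<forall>j\<in>{1..N}. i \<noteq> j \<longrightarrow> d_FS (z i) (z j) \<ge> sqrt (20 * ln (real d) / real d)) \<longrightarrow>
      {P \<in> space (form_gaussian d). \<exists>i\<in>{1..N}. submanifold_chart d \<kappa> (\<psi> i) P}
        \<in> sets (form_gaussian d) \<and>
      measure (form_gaussian d)
        {P \<in> space (form_gaussian d). \<exists>i\<in>{1..N}. submanifold_chart d \<kappa> (\<psi> i) P}
        > 1 - 14 * capacity_gamma \<kappa> ^ N)"
proof -
  have "eventually (\<lambda>d::nat. ln d \<ge> 1) at_top" by real_asymp
  \<comment> \<open>The Taylor coefficient 1/2 is weakened to 2/5, so that the inequality holds for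
    all small t. At \<open>t\<^sup>2 = 20 * ln d / d\<close> it leaves the gap
    \<open>8 * ln d / d\<close> required by \<open>cross_gram_le\<close>.\<close>
  moreover have "eventually (\<lambda>d::nat. 2 / 5 * (sqrt (20 * ln d / d))\<^sup>2 \<le> 1 - cos (sqrt (20 * ln d / d))) at_top"
  proof (rule eventually_compose_filterlim[where P = "\<lambda>t. 2 / 5 * t\<^sup>2 \<le> 1 - cos t"])
    show "eventually (\<lambda>t::real. 2 / 5 * t\<^sup>2 \<le> 1 - cos t) (at_right 0)" by real_asymp
    show "filterlim (\<lambda>d::nat. sqrt (20 * ln d / d)) (at_right 0) at_top" by real_asymp
  qed
  \<comment> \<open>The prefactor is 32 times the dimension, the bound on the number of charts; so
    this limit makes the total correlation small.\<close>
  moreover have "((\<lambda>d::nat. 16 * (real d + 1) * (real d + 2) * cross_bound d) \<longlongrightarrow> 0) at_top"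
    unfolding cross_bound_def by real_asymp
  then have "eventually (\<lambda>d::nat. 16 * (real d + 1) * (real d + 2) * cross_bound d < \<kappa> / 3000) at_top"
    using assms(1) by (intro order_tendstoD(2)) auto
  ultimately have "eventually (\<lambda>d::nat. ln d \<ge> 1 \<and> 8 * ln d / d \<le> 1 - cos (sqrt (20 * ln d / d))
      \<and> 16 * (real d + 1) * (real d + 2) * cross_bound d < \<kappa> / 3000) at_top"
    by eventually_elim (auto simp: real_sqrt_pow2)
  then obtain d0 where d0: "\<And>d. d \<ge> d0 \<Longrightarrow> ln (real d) \<ge> 1 \<and> 8 * ln (real d) / d \<le> 1 - cos (sqrt (20 * ln (real d) / d))
      \<and> 16 * (real d + 1) * (real d + 2) * cross_bound d < \<kappa> / 3000"
    unfolding eventually_sequentially by auto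
  show ?thesis
  proof (intro exI[of _ "max d0 1"] conjI allI impI)
    fix d N :: nat and z :: "nat \<Rightarrow> cp2" and \<psi> :: "nat \<Rightarrow> cp2 \<Rightarrow> cp2"
    assume "max d0 1 \<le> d" and N: "0 < N"
      and charts: "\<forall>i\<in>{1..N}. marked_FS_chart_at (z i) (\<psi> i)"
      and far: "\<forall>i\<in>{1..N}. \<forall>j\<in>{1..N}. i \<noteq> j \<longrightarrow> d_FS (z i) (z j) \<ge> sqrt (20 * ln (real d) / real d)"
    then have d: "d \<ge> 1" "d \<ge> d0" by auto
    have ln_d: "ln d \<ge> 1" and cos_d: "cos (sqrt (20 * ln d / d)) \<le> 1 - 8 * ln d / d"
      and small: "16 * (real d + 1) * (real d + 2) * cross_bound d \<le> \<kappa> / 3000"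
      using d0[OF d(2)] by auto
    have "\<forall>i\<in>{1..N}. \<exists>A. unitary3 A \<and> (\<forall>u. u \<noteq> 0 \<longrightarrow> \<psi> i (proj u) = proj (A *v u))"
      using charts by (auto simp: marked_FS_chart_at_def PU3_def)
    then obtain A where A: "\<And>i. i \<in> {1..N} \<Longrightarrow> unitary3 (A i)"
      and \<psi>: "\<And>i u. i \<in> {1..N} \<Longrightarrow> u \<noteq> 0 \<Longrightarrow> \<psi> i (proj u) = proj (A i *v u)"
      by metis
    have z: "z i = proj (local_point d (A i) 0 0)" if "i \<in> {1..N}" for i
    proof -
      have "z i = \<psi> i (affine_chart (0, 0))"
        using charts that by (simp add: marked_FS_chart_at_def)
      also have "\<dots> = proj (A i *v vector [1, 0, 0])"
        unfolding affine_chart_def by (simp add: \<psi>[OF that])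
      finally show ?thesis by (simp add: local_point_def)
    qed
    have cross: "cmod (edot d (torus_kvec d (A i) x) (torus_kvec d (A j) y)) \<le> cross_bound d"
      if "i \<in> {1..N}" "j \<in> {1..N}" "i \<noteq> j" "x \<in> torus d" "y \<in> torus d" for i j x y
    proof (rule cross_gram_le[OF A[OF that(1)] A[OF that(2)] d(1) ln_d])
      have "sqrt (20 * ln d / d) \<le> d_FS (proj (local_point d (A i) 0 0)) (proj (local_point d (A j) 0 0))"
        using far that z by auto
      then have "cmod (cinner3 (local_point d (A i) 0 0) (local_point d (A j) 0 0)) \<le> cos (sqrt (20 * ln d / d))"
        using ln_d by (intro d_FS_centers[OF A[OF that(1)] A[OF that(2)] d(1)]) auto
      with cos_d show "cmod (cinner3 (local_point d (A i) 0 0) (local_point d (A j) 0 0)) \<le> 1 - 8 * ln d / d"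
        by linarith
    qed
    have "card (exponents d) = real ((d + 1) * (d + 2)) / 2"
      unfolding card_exponents by (simp add: real_of_nat_div)
    then have E: "real (card (exponents d)) = (real d + 1) * (real d + 2) / 2" by (simp add: algebra_simps)
    have "card {1..N} \<le> 32 * card (exponents d)"
    proof (rule charts_card_bound[OF _ A d(1) cross])
      have "card (exponents d) * cross_bound d = (16 * (real d + 1) * (real d + 2) * cross_bound d) / 32"
        unfolding E by simp
      then show "card (exponents d) * cross_bound d \<le> 1 / 2"
        using small assms by linarith
    qed (auto simp: cross_bound_pos less_imp_le)
    then have "real (card {1..N}) * cross_bound d \<le> real (32 * card (exponents d)) * cross_bound d"
      by (intro mult_right_mono) (auto simp: cross_bound_pos less_imp_le simp del: card_atLeastAtMost)
    also have "\<dots> = 16 * (real d + 1) * (real d + 2) * cross_bound d"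
      unfolding of_nat_mult E by simp
    finally have Ne: "real (card {1..N}) * cross_bound d \<le> \<kappa> / 3000"
      using small by linarith
    let ?G = "cgauss (exponents d)"
    let ?F = "{a \<in> space ?G. \<forall>i\<in>{1..N}. \<not> rest d (A i) a < \<kappa> * cmod (edot d a (coeff_vec d (A i) 0 1))}"
    have F: "measure ?G ?F \<le> 2 * exp (- exp (- (28000 / \<kappa>\<^sup>2)) / 8 * card {1..N})"
      by (rule charts_fail_bound[OF _ A d(1) assms cross _ Ne]) (auto simp: cross_bound_pos less_imp_le)
    also have "exp (- exp (- (28000 / \<kappa>\<^sup>2)) / 8 * card {1..N}) = exp (- exp (- (28000 / \<kappa>\<^sup>2)) / 8) ^ N"
      by (simp add: exp_of_nat_mult[symmetric] mult.commute)
    also have "\<dots> \<le> capacity_gamma \<kappa> ^ N"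
      by (intro power_mono exp_le_capacity_gamma assms) simp
    finally have F_le: "measure ?G ?F \<le> 2 * capacity_gamma \<kappa> ^ N" by simp
    interpret prob_space ?G by (rule prob_space_cgauss) simp
    let ?U = "{P \<in> space (form_gaussian d). \<exists>i\<in>{1..N}. submanifold_chart d \<kappa> (\<psi> i) P}"
    show U: "?U \<in> sets (form_gaussian d)"
      using sets_submanifold_chart[OF A \<psi> d(1) assms(1)]
      by (intro sets.sets_Collect_finite_Ex) auto
    have fm: "form_of d \<in> ?G \<rightarrow>\<^sub>M (\<Pi>\<^sub>M i\<in>exponents d. borel)"
      using measurable_form_of by (simp cong: measurable_cong_sets add: sets_cgauss)
    let ?V = "form_of d -` ?U \<inter> space ?G"
    have U': "?U \<in> sets (\<Pi>\<^sub>M i\<in>exponents d. borel)"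
      using U by (simp add: form_gaussian_eq_distr)
    have V: "?V \<in> sets ?G" by (rule measurable_sets[OF fm U'])
    have mF: "?F \<in> sets ?G"
      by (intro sets.sets_Collect_finite_All sets.sets_Collect_neg) measurable
    \<comment> \<open>By the contraction argument, a chart that fails has a b that does not
      dominate.\<close>
    have "space ?G - ?V \<subseteq> ?F"
    proof
      fix a assume a: "a \<in> space ?G - ?V"
      show "a \<in> ?F"
      proof (rule ccontr)
        assume "a \<notin> ?F"
        then obtain i where i: "i \<in> {1..N}" and dom: "rest d (A i) a < \<kappa> * cmod (edot d a (coeff_vec d (A i) 0 1))"
          using a by auto
        have ev: "form_eval d (form_of d a) u = 0 \<longleftrightarrow> edot d a (kvec d u) = 0" for u
        proof -
          have "real ((d + 1) * (d + 2)) / 2 > 0" by (simp del: of_nat_mult)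
          then have "complex_of_real (sqrt (real ((d + 1) * (d + 2)) / 2)) \<noteq> 0"
            by (simp only: of_real_eq_0_iff real_sqrt_eq_0_iff)
          then show ?thesis unfolding cdot_kvec divide_eq_0_iff by blast
        qed
        have "submanifold_chart d \<kappa> (\<psi> i) (form_of d a) \<longleftrightarrow>
          (\<forall>X. cmod X \<le> 1 \<longrightarrow> (\<exists>Y. cmod Y < \<kappa> \<and> (\<forall>Z. cmod Z \<le> \<kappa> \<longrightarrow>
            (form_eval d (form_of d a) (local_point d (A i) X Z) = 0 \<longleftrightarrow> Z = Y))))"
          using A[OF i] \<psi>[OF i] d(1) assms(1) by (rule submanifold_chart_iff)
        then have "submanifold_chart d \<kappa> (\<psi> i) (form_of d a)"
          unfolding ev using unique_root[OF d(1) assms _ dom] by blast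
        moreover have "form_of d a \<in> space (form_gaussian d)"
          by (simp add: space_form_gaussian form_of_def forms_def)
        ultimately show False using a i by auto
      qed
    qed
    then have "prob (space ?G - ?V) \<le> prob ?F"
      by (intro finite_measure_mono mF)
    then have "1 - 2 * capacity_gamma \<kappa> ^ N \<le> prob ?V"
      using prob_compl[OF V] F_le by linarith
    also have "prob ?V = measure (form_gaussian d) ?U"
      unfolding form_gaussian_eq_distr[of d] using U' by (subst measure_distr[OF fm]) (auto simp: form_gaussian_eq_distr)
    finally have "1 - 2 * capacity_gamma \<kappa> ^ N \<le> measure (form_gaussian d) ?U" .
    \<comment> \<open>Positivity makes the passage from the factor 2 to 14 strict.\<close>
    moreover have "capacity_gamma \<kappa> > 0"
      using exp_le_capacity_gamma[OF assms] exp_gt_zero by (rule order.strict_trans2[rotated])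
    then have "capacity_gamma \<kappa> ^ N > 0" by simp
    ultimately show "1 - 14 * capacity_gamma \<kappa> ^ N < measure (form_gaussian d) ?U" by linarith
  qed simp
qed

end
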